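(* Consider the primal-dual pair of semidefinite programs with data $(\mathcal{A},b,C)$ and Algorithm SSN described in the context. Then Algorithm SSN is well-defined and generates an infinite sequence $\{(\epsilon^k,X^k,y^k,Z^k)\}\subseteq\mathcal{N}$, where $$\mathcal{N}:=\{(\epsilon,X,y,Z)\in\mathbb{R}\times\mathbb{X}\;:\;\epsilon\ge\zeta(\epsilon,X,y,Z)\,\hat\epsilon\},$$ with the property that any accumulation point $(\bar\epsilon,\bar X,\bar y,\bar Z)$ of $\{(\epsilon^k,X^k,y^k,Z^k)\}$ is a solution of $\widehat{\mathcal{E}}(\epsilon,X,y,Z)=0$, $(\epsilon,X,y,Z)\in\mathbb{R}\times\mathbb{X}$. Moreover, such an accumulation point exists if the set of solutions $(X,y,Z)$ of the KKT system ($\mathcal{A}X=b$, $\mathcal{A}^*y+Z=C$, $X\in\mathbb{S}^n_+$, $Z\in\mathbb{S}^n_+$, $\langle X,Z\rangle=0$) is nonempty and bounded.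
   Context: $\mathbb{S}^n$ is the space of real symmetric $n\times n$ matrices with trace inner product $\langle\cdot,\cdot\rangle$ and induced norm; $\mathbb{S}^n_+$, $\mathbb{S}^n_{++}$ are the cones of positive semidefinite and positive definite matrices. Data: $C\in\mathbb{S}^n$, $b\in\mathbb{R}^m$, and a linear map $\mathcal{A}:\mathbb{S}^n\to\mathbb{R}^m$, $\mathcal{A}X=(\langle A_1,X\rangle,\dots,\langle A_m,X\rangle)^T$ with $A_i\in\mathbb{S}^n$, with adjoint $\mathcal{A}^*y=\sum_i y_iA_i$. Primal problem: $\min\{\langle C,X\rangle:\mathcal{A}X=b,\ X\in\mathbb{S}^n_+\}$; dual problem: $\max\{\langle b,y\rangle:\mathcal{A}^*y+Z=C,\ Z\in\mathbb{S}^n_+\}$. Standing assumption: the primal problem has at least one optimal solution and there is $\tilde X\in\mathbb{S}^n_{++}$ with $\mathcal{A}\tilde X=b$. Huber function: for $\epsilon\ne0$, $h(\epsilon,t)=t-|\epsilon|/2$ if $t>|\epsilon|$, $h(\epsilon,t)=t^2/(2|\epsilon|)$ if $0\le t\le|\epsilon|$, $h(\epsilon,t)=0$ if $t<0$; and $h(0,t)=\max\{0,t\}$. For $W\in\mathbb{S}^n$ with spectral decomposition $W=P\,\mathrm{diag}(d_1,\dots,d_n)P^T$, $\Phi(\epsilon,W):=P\,\mathrm{diag}(h(\epsilon,d_1),\dots,h(\epsilon,d_n))P^T$. Let $\mathbb{X}:=\mathbb{S}^n\times\mathbb{R}^m\times\mathbb{S}^n$ and let $\kappa_p>0,\kappa_c>0$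 be given constants. Define $\mathcal{E}:\mathbb{R}\times\mathbb{X}\to\mathbb{R}^m\times\mathbb{S}^n\times\mathbb{S}^n$ by $$\mathcal{E}(\epsilon,X,y,Z)=\big(\mathcal{A}X+\kappa_p|\epsilon|y-b,\ -\mathcal{A}^*y-Z+C,\ (1+\kappa_c|\epsilon|)X-\Phi(\epsilon,X-Z)\big),$$ $\widehat{\mathcal{E}}(\epsilon,X,y,Z)=(\epsilon,\mathcal{E}(\epsilon,X,y,Z))$, and $\psi=\|\widehat{\mathcal{E}}\|^2$. $\mathcal{E}$ is continuously differentiable where $\epsilon\neq0$; $\mathcal{E}'$, $\widehat{\mathcal{E}}'$ denote derivatives and $\mathcal{E}'_\epsilon$ the partial derivative in $\epsilon$. Parameters: $\hat\epsilon\in(0,\infty)$, $r\in(0,1)$, $\hat r\in(0,\infty)$, $\hat\eta\in(0,1)$ with $\delta:=\sqrt2\max\{r\hat\epsilon,\hat\eta\}<1$, $\rho\in(0,1)$, $\sigma\in(0,1/2)$, $\tau\in(0,1]$. Define $\zeta(\epsilon,X,y,Z)=r\min\{1,\|\widehat{\mathcal{E}}(\epsilon,X,y,Z)\|^{1+\tau}\}$ and $\eta(\epsilon,X,y,Z)=\min\{1,\hat r\|\widehat{\mathcal{E}}(\epsilon,X,y,Z)\|^{\tau}\}$. Algorithm SSN (squared smoothing Newton method). Start with $\epsilon^0=\hat\epsilon$ and any $(X^0,y^0,Z^0)\in\mathbb{X}$. For $k\ge0$, write $w^k=(\epsilon^k,X^k,y^k,Z^k)$. If $\widehat{\mathcal{E}}(w^k)=0$,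 stop and output $w^k$. Otherwise: (1) set $\eta_k=\eta(w^k)$, $\zeta_k=\zeta(w^k)$; (2) set $\Delta\epsilon^k=-\epsilon^k+\zeta_k\hat\epsilon$ and compute $\Delta w^k=(\Delta\epsilon^k,\Delta X^k,\Delta y^k,\Delta Z^k)$ solving approximately $\widehat{\mathcal{E}}(w^k)+\widehat{\mathcal{E}}'(w^k)\Delta w^k=(\zeta_k\hat\epsilon,0,0,0)$, in the sense that the residual $\mathcal{R}_k:=\mathcal{E}(w^k)+\mathcal{E}'(w^k)\Delta w^k$ satisfies $$\|\mathcal{R}_k\|\le\min\{\eta_k\|\mathcal{E}(w^k)+\mathcal{E}'_\epsilon(w^k)\Delta\epsilon^k\|,\ \hat\eta\|\widehat{\mathcal{E}}(w^k)\|\};$$ (3) let $\ell_k$ be the smallest nonnegative integer $\ell$ with $\psi(w^k+\rho^\ell\Delta w^k)\le[1-2\sigma(1-\delta)\rho^\ell]\psi(w^k)$; (4) set $w^{k+1}=w^k+\rho^{\ell_k}\Delta w^k$. "Well-defined" means that at every iteration a direction as in (2) exists and $\ell_k$ in (3) is finite. *)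

theory Defs
  imports "HOL-Analysis.Analysis"
begin

section \<open>The Euclidean space of real symmetric matrices\<close>

text \<open>
  Symmetric matrices are a type of their own (rather than a subspace of all square matrices), so that
  Frechet derivatives of maps defined on them are the library's derivatives at a point of a Euclidean
  space, and hence unique.
\<close>

typedef 'n sym_mat = "{M :: real^'n^'n. transpose M = M}"
  morphisms mat_of Sym
  by (rule exI[of _ 0]) (simp add: transpose_def vec_eq_iff)

setup_lifting type_definition_sym_mat

lemma transpose_mat_of [simp]: "transpose (mat_of A) = mat_of A"
  using mat_of[of A] by simp

instantiation sym_mat :: (finite) real_inner
begin

lift_definition zero_sym_mat :: "'a sym_mat" is 0
  by (simp add: transpose_def vec_eq_iff)

lift_definition plus_sym_mat :: "'a sym_mat \<Rightarrow> 'a sym_mat \<Rightarrow> 'a sym_mat" is "(+)"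
  by (simp add: transpose_def vec_eq_iff)

lift_definition minus_sym_mat :: "'a sym_mat \<Rightarrow> 'a sym_mat \<Rightarrow> 'a sym_mat" is "(-)"
  by (simp add: transpose_def vec_eq_iff)

lift_definition uminus_sym_mat :: "'a sym_mat \<Rightarrow> 'a sym_mat" is uminus
  by (simp add: transpose_def vec_eq_iff)

lift_definition scaleR_sym_mat :: "real \<Rightarrow> 'a sym_mat \<Rightarrow> 'a sym_mat" is "(*\<^sub>R)"
  by (simp add: transpose_def vec_eq_iff)

lift_definition inner_sym_mat :: "'a sym_mat \<Rightarrow> 'a sym_mat \<Rightarrow> real" is "(\<bullet>)" .

lift_definition norm_sym_mat :: "'a sym_mat \<Rightarrow> real" is norm .

definition dist_sym_mat :: "'a sym_mat \<Rightarrow> 'a sym_mat \<Rightarrow> real" where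
  "dist_sym_mat A B = norm (A - B)"

definition sgn_sym_mat :: "'a sym_mat \<Rightarrow> 'a sym_mat" where
  "sgn_sym_mat A = inverse (norm A) *\<^sub>R A"

definition uniformity_sym_mat :: "('a sym_mat \<times> 'a sym_mat) filter" where
  "uniformity_sym_mat = (INF e\<in>{0<..}. principal {(A, B). dist A B < e})"

definition open_sym_mat :: "'a sym_mat set \<Rightarrow> bool" where
  "open_sym_mat U = (\<forall>A\<in>U. \<forall>\<^sub>F (A', B) in uniformity. A' = A \<longrightarrow> B \<in> U)"

instance
proof
  fix A B C :: "'a sym_mat" and a c :: real and U :: "'a sym_mat set"
  show "A + B + C = A + (B + C)" by transfer (simp add: add.assoc)
  show "A + B = B + A" by transfer (simp add: add.commute)
  show "0 + A = A" by transfer simp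
  show "- A + A = 0" by transfer simp
  show "A - B = A + - B" by transfer simp
  show "a *\<^sub>R (A + B) = a *\<^sub>R A + a *\<^sub>R B" by transfer (simp add: scaleR_add_right)
  show "(a + c) *\<^sub>R A = a *\<^sub>R A + c *\<^sub>R A" by transfer (simp add: scaleR_add_left)
  show "a *\<^sub>R c *\<^sub>R A = (a * c) *\<^sub>R A" by transfer simp
  show "1 *\<^sub>R A = A" by transfer simp
  show "dist A B = norm (A - B)" by (rule dist_sym_mat_def)
  show "sgn A = inverse (norm A) *\<^sub>R A" by (rule sgn_sym_mat_def)
  show "uniformity = (INF e\<in>{0<..}. principal {(A, B :: 'a sym_mat). dist A B < e})"
    by (rule uniformity_sym_mat_def)
  show "open U = (\<forall>A\<in>U. \<forall>\<^sub>F (A', B) in uniformity. A' = A \<longrightarrow> B \<in> U)"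
    by (rule open_sym_mat_def)
  show "A \<bullet> B = B \<bullet> A" by transfer (simp add: inner_commute)
  show "(A + B) \<bullet> C = A \<bullet> C + B \<bullet> C" by transfer (simp add: inner_add_left)
  show "(a *\<^sub>R A) \<bullet> B = a * (A \<bullet> B)" by transfer simp
  show "0 \<le> A \<bullet> A" by transfer simp
  show "(A \<bullet> A = 0) = (A = 0)" by transfer simp
  show "norm A = sqrt (A \<bullet> A)" by transfer (simp add: norm_eq_sqrt_inner)
qed

end

lemma inner_sym_mat_eq_trace: "A \<bullet> B = trace (mat_of A ** mat_of B)"
proof -
  have "mat_of A \<bullet> mat_of B = trace (transpose (mat_of A) ** mat_of B)"
    unfolding inner_vec_def trace_def matrix_matrix_mult_def transpose_def
    by simp (rule sum.swap)
  then show ?thesis by (simp add: inner_sym_mat.rep_eq)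
qed

lemma subspace_symmetric: "subspace {M :: real^'n^'n. transpose M = M}"
  by (auto simp: subspace_def transpose_def vec_eq_iff)

lemma symmetric_orthonormal_basis:
  "\<exists>B :: 'n::finite sym_mat set. B \<noteq> {} \<and> finite B
     \<and> (\<forall>u\<in>B. \<forall>v\<in>B. u \<bullet> v = (if u = v then 1 else 0))
     \<and> (\<forall>x. (\<forall>u\<in>B. x \<bullet> u = 0) \<longleftrightarrow> x = 0)"
proof -
  let ?S = "{M :: real^'n^'n. transpose M = M}"
  obtain B where B: "B \<subseteq> ?S" "pairwise orthogonal B" "\<And>M. M \<in> B \<Longrightarrow> norm M = 1"
      "independent B" "card B = dim ?S" "span B = ?S"
    using orthonormal_basis_subspace[OF subspace_symmetric[where ?'n = 'n]] by blast
  have mat_Sym: "mat_of (Sym M) = M" if "M \<in> B" for M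
    using B(1) that Sym_inverse by blast
  have "mat 1 \<in> span B"
    using B(6) by (simp add: transpose_mat)
  moreover have "(mat 1 :: real^'n^'n) \<noteq> 0"
    by (simp add: mat_def vec_eq_iff)
  ultimately have "B \<noteq> {}" by auto
  moreover have "finite B"
    using B(4) by (rule independent_imp_finite)
  moreover have "\<forall>u\<in>Sym ` B. \<forall>v\<in>Sym ` B. u \<bullet> v = (if u = v then 1 else 0)"
  proof (intro ballI)
    fix u v assume "u \<in> Sym ` B" "v \<in> Sym ` B"
    then obtain M N where MN: "M \<in> B" "N \<in> B" "u = Sym M" "v = Sym N" by blast
    have eq: "u = v \<longleftrightarrow> M = N"
      using MN mat_Sym by metis
    have "u \<bullet> v = M \<bullet> N"
      using MN mat_Sym by (simp add: inner_sym_mat.rep_eq)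
    moreover have "M \<bullet> N = (if M = N then 1 else 0)"
      using B(2) B(3)[OF MN(1)] MN(1,2)
      by (auto simp: pairwise_def orthogonal_def dot_square_norm)
    ultimately show "u \<bullet> v = (if u = v then 1 else 0)" by (simp add: eq)
  qed
  moreover have "\<forall>x. (\<forall>u\<in>Sym ` B. x \<bullet> u = 0) \<longleftrightarrow> x = 0"
  proof (intro allI iffI)
    fix x :: "'n sym_mat" assume *: "\<forall>u\<in>Sym ` B. x \<bullet> u = 0"
    have "orthogonal (mat_of x) M" if "M \<in> B" for M
      using * that mat_Sym[OF that] by (auto simp: inner_sym_mat.rep_eq orthogonal_def)
    moreover have "mat_of x \<in> span B"
      using B(6) by simp
    ultimately have "orthogonal (mat_of x) (mat_of x)"
      using orthogonal_to_span by blast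
    then have "mat_of x = 0" by (simp add: orthogonal_def)
    then show "x = 0" by (simp add: zero_sym_mat.rep_eq flip: mat_of_inject)
  qed simp
  ultimately show ?thesis
    by (intro exI[of _ "Sym ` B"]) simp
qed

instantiation sym_mat :: (finite) euclidean_space
begin

definition Basis_sym_mat :: "'a sym_mat set" where
  "Basis_sym_mat = (SOME B. B \<noteq> {} \<and> finite B
     \<and> (\<forall>u\<in>B. \<forall>v\<in>B. u \<bullet> v = (if u = v then 1 else 0))
     \<and> (\<forall>x. (\<forall>u\<in>B. x \<bullet> u = 0) \<longleftrightarrow> x = 0))"

instance
proof -
  note * = someI_ex[OF symmetric_orthonormal_basis, where ?'n1 = 'a, folded Basis_sym_mat_def]
  show "OFCLASS('a sym_mat, euclidean_space_class)"
    by standard (use * in auto)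
qed

end

definition psd_cone :: "'n::finite sym_mat set" where
  "psd_cone = {A. \<forall>x. 0 \<le> x \<bullet> (mat_of A *v x)}"

definition pd_cone :: "'n::finite sym_mat set" where
  "pd_cone = {A. \<forall>x. x \<noteq> 0 \<longrightarrow> 0 < x \<bullet> (mat_of A *v x)}"


section \<open>The smoothing function\<close>

definition huber :: "real \<Rightarrow> real \<Rightarrow> real" where
  "huber e t =
     (if e = 0 then max 0 t
      else if \<bar>e\<bar> < t then t - \<bar>e\<bar> / 2
      else if 0 \<le> t then t\<^sup>2 / (2 * \<bar>e\<bar>)
      else 0)"

definition diag_mat :: "real^'n \<Rightarrow> real^'n^'n" where
  "diag_mat d = (\<chi> i j. if i = j then d $ i else 0)"

text \<open>
  The description is proper: a spectral decomposition exists by the spectral theorem, and the result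
  does not depend on which one is used.
\<close>

definition Phi :: "real \<Rightarrow> 'n::finite sym_mat \<Rightarrow> 'n sym_mat" where
  "Phi e W = (THE V. \<exists>P d. orthogonal_matrix P
     \<and> mat_of W = P ** diag_mat d ** transpose P
     \<and> mat_of V = P ** diag_mat (\<chi> i. huber e (d $ i)) ** transpose P)"


section \<open>The semidefinite program\<close>

type_synonym ('n, 'm) primal_dual = "'n sym_mat \<times> (real^'m) \<times> 'n sym_mat"

type_synonym ('n, 'm) point = "real \<times> ('n, 'm) primal_dual"

locale sdp =
  fixes A :: "'m::finite \<Rightarrow> 'n::finite sym_mat"
    and b :: "real^'m"
    and C :: "'n sym_mat"
begin

definition opA :: "'n sym_mat \<Rightarrow> real^'m" where
  "opA X = (\<chi> i. A i \<bullet> X)"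

definition adjA :: "real^'m \<Rightarrow> 'n sym_mat" where
  "adjA y = (\<Sum>i\<in>UNIV. y $ i *\<^sub>R A i)"

lemma inner_opA: "opA X \<bullet> y = X \<bullet> adjA y"
  by (simp add: opA_def adjA_def inner_vec_def inner_sum_right inner_commute mult.commute)

definition primal_feasible :: "'n sym_mat set" where
  "primal_feasible = {X. opA X = b \<and> X \<in> psd_cone}"

definition primal_optimal :: "'n sym_mat set" where
  "primal_optimal = {X \<in> primal_feasible. \<forall>X'\<in>primal_feasible. C \<bullet> X \<le> C \<bullet> X'}"

definition kkt_solutions :: "('n, 'm) primal_dual set" where
  "kkt_solutions = {(X, y, Z). opA X = b \<and> adjA y + Z = C
     \<and> X \<in> psd_cone \<and> Z \<in> psd_cone \<and> X \<bullet> Z = 0}"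

end

text \<open>
  Points are tuples \<open>w = (\<epsilon>, X, y, Z)\<close>. The library norm of a product type is the Euclidean one,
  so \<open>psi\<close> is the squared norm of the direct sum of the component spaces.
\<close>

locale smoothed_sdp = sdp A b C
  for A :: "'m::finite \<Rightarrow> 'n::finite sym_mat"
    and b :: "real^'m"
    and C :: "'n sym_mat" +
  fixes kappa_p :: real
    and kappa_c :: real
begin

definition E :: "('n, 'm) point \<Rightarrow> (real^'m) \<times> 'n sym_mat \<times> 'n sym_mat" where
  "E = (\<lambda>(e, X, y, Z).
     (opA X + (kappa_p * \<bar>e\<bar>) *\<^sub>R y - b,
      - adjA y - Z + C,
      (1 + kappa_c * \<bar>e\<bar>) *\<^sub>R X - Phi e (X - Z)))"

definition Ehat :: "('n, 'm) point \<Rightarrow> real \<times> (real^'m) \<times> 'n sym_mat \<times> 'n sym_mat" where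
  "Ehat w = (fst w, E w)"

definition psi :: "('n, 'm) point \<Rightarrow> real" where
  "psi w = (norm (Ehat w))\<^sup>2"

definition E_eps :: "('n, 'm) point \<Rightarrow> (real^'m) \<times> 'n sym_mat \<times> 'n sym_mat" where
  "E_eps = (\<lambda>(e, u). vector_derivative (\<lambda>e'. E (e', u)) (at e))"

end


section \<open>The squared smoothing Newton algorithm\<close>

locale ssn = smoothed_sdp A b C kappa_p kappa_c
  for A :: "'m::finite \<Rightarrow> 'n::finite sym_mat"
    and b :: "real^'m"
    and C :: "'n sym_mat"
    and kappa_p :: real
    and kappa_c :: real +
  fixes eps_hat :: real
    and r :: real
    and r_hat :: real
    and eta_hat :: real
    and \<rho> :: real
    and \<sigma> :: real
    and \<tau> :: real
begin

definition \<delta> :: real where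
  "\<delta> = sqrt 2 * max (r * eps_hat) eta_hat"

definition zeta :: "('n, 'm) point \<Rightarrow> real" where
  "zeta w = r * min 1 (norm (Ehat w) powr (1 + \<tau>))"

definition eta :: "('n, 'm) point \<Rightarrow> real" where
  "eta w = min 1 (r_hat * norm (Ehat w) powr \<tau>)"

definition nbhd :: "('n, 'm) point set" where
  "nbhd = {w. fst w \<ge> zeta w * eps_hat}"

text \<open>
  Differentiability is part of the definition because \<open>frechet_derivative\<close> is unspecified at points
  where the derivative does not exist.
\<close>

definition newton_direction :: "('n, 'm) point \<Rightarrow> ('n, 'm) point \<Rightarrow> bool" where
  "newton_direction w dw \<longleftrightarrow>
     E differentiable (at w)
     \<and> fst dw = - fst w + zeta w * eps_hat
     \<and> norm (E w + frechet_derivative E (at w) dw)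
         \<le> min (eta w * norm (E w + fst dw *\<^sub>R E_eps w)) (eta_hat * norm (Ehat w))"

definition line_search :: "('n, 'm) point \<Rightarrow> ('n, 'm) point \<Rightarrow> nat \<Rightarrow> bool" where
  "line_search w dw l \<longleftrightarrow>
     psi (w + \<rho> ^ l *\<^sub>R dw) \<le> (1 - 2 * \<sigma> * (1 - \<delta>) * \<rho> ^ l) * psi w"

text \<open>One pass through the loop. The computed direction is any admissible one, so this is a relation.\<close>

definition ssn_step :: "('n, 'm) point \<Rightarrow> ('n, 'm) point \<Rightarrow> bool" where
  "ssn_step w w' \<longleftrightarrow> Ehat w \<noteq> 0
     \<and> (\<exists>dw l. newton_direction w dw
          \<and> line_search w dw l \<and> (\<forall>l'<l. \<not> line_search w dw l')
          \<and> w' = w + \<rho> ^ l *\<^sub>R dw)"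

text \<open>The points that some finite run of the algorithm reaches, from an arbitrary starting point.\<close>

inductive ssn_iterate :: "('n, 'm) point \<Rightarrow> bool" where
  start: "ssn_iterate (eps_hat, X0, y0, Z0)"
| step: "ssn_iterate w \<Longrightarrow> ssn_step w w' \<Longrightarrow> ssn_iterate w'"

definition well_defined :: bool where
  "well_defined \<longleftrightarrow> (\<forall>w. ssn_iterate w \<and> Ehat w \<noteq> 0 \<longrightarrow>
     (\<exists>dw. newton_direction w dw) \<and>
     (\<forall>dw. newton_direction w dw \<longrightarrow> (\<exists>l. line_search w dw l)))"

definition ssn_sequence :: "('n, 'm) primal_dual \<Rightarrow> (nat \<Rightarrow> ('n, 'm) point) \<Rightarrow> bool" where
  "ssn_sequence u0 w \<longleftrightarrow> w 0 = (eps_hat, u0) \<and> (\<forall>k. ssn_step (w k) (w (Suc k)))"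

end

definition accumulation_point :: "(nat \<Rightarrow> 'a::topological_space) \<Rightarrow> 'a \<Rightarrow> bool" where
  "accumulation_point w a \<longleftrightarrow> (\<exists>s. strict_mono s \<and> (w \<circ> s) \<longlonglongrightarrow> a)"

end

theory Submission
  imports Defs
begin

text \<open>
  Three facts carry the proof.

  \<^item> For \<open>\<epsilon>\<close> bounded away from 0, the map \<open>E(\<epsilon>, \<cdot>)\<close> is strongly injective: increments of the
    value dominate increments of the argument by a fixed factor (\<open>E_coercive\<close>). The spectral map
    \<open>\<Phi>(\<epsilon>, \<cdot>)\<close> is firmly nonexpansive, which is the monotonicity that the two regularization terms
    turn into strong monotonicity. The bound passes to the derivative, so the Newton systems are
    solvable (\<open>newton_system_solvable\<close>) and their solutions stay bounded on compact sets.

  \<^item> \<open>E\<close> is continuously differentiable for \<open>\<epsilon> > 0\<close> (\<open>C1_on_E\<close>). Hence its linearization error is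
    uniformly small on compact sets, so that the line search accepts a step length bounded below
    there (\<open>line_search_uniform\<close>). If the residuals of a run stayed above a positive number, then membership
    in the neighbourhood \<open>nbhd\<close> would keep \<open>\<epsilon>\<close> away from 0, strong injectivity would keep the iterates
    in a compact set, and each step would shrink the residual by a fixed factor, a contradiction. So
    the residuals of every run tend to 0 (\<open>ssn_sequence_residual_tendsto_zero\<close>), and accumulation
    points are zeros by continuity.

  \<^item> If the set of KKT solutions is nonempty and bounded, its recession directions vanish, which makes
    \<open>adjA\<close> injective and yields a strictly feasible dual point. Together with the strictly feasible
    primal point this bounds all points with \<open>\<epsilon> \<ge> 0\<close> and small residual
    (\<open>residual_level_set_bounded\<close>), so the tail of every run is bounded.

  The analysis of \<open>\<Phi>\<close> rests on one identity, \<open>two_basis_inner\<close>: comparing two symmetric matrices in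
  their own eigenbases, an inequality between quadratic expressions in values of scalar functions
  carries over to the spectral functions with the same constants. It gives well-definedness,
  Lipschitz bounds and firm nonexpansiveness at once. Continuous differentiability follows as well:
  a scalar \<open>C\<^sup>1\<close> function differs from a suitable polynomial by a function with a small Lipschitz
  constant, the same then holds for the spectral functions, and \<open>C\<^sup>1\<close> maps are closed under such
  approximation (\<open>C1_on_lipschitz_limit\<close>).
\<close>

section \<open>The spectral theorem for symmetric matrices\<close>

lemma mat_of_simps:
  "mat_of 0 = 0" "mat_of (X + Y) = mat_of X + mat_of Y" "mat_of (X - Y) = mat_of X - mat_of Y"
  "mat_of (- X) = - mat_of X" "mat_of (c *\<^sub>R X) = c *\<^sub>R mat_of X"
  by (simp_all add: zero_sym_mat.rep_eq plus_sym_mat.rep_eq minus_sym_mat.rep_eq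
      uminus_sym_mat.rep_eq scaleR_sym_mat.rep_eq)

lemma bounded_bilinear_matrix_mult:
  "bounded_bilinear ((**) :: real^'n^'m \<Rightarrow> real^'p^'n \<Rightarrow> real^'p^'m)"
  unfolding bilinear_conv_bounded_bilinear [symmetric] bilinear_def linear_iff
  by (auto simp: matrix_matrix_mult_def vec_eq_iff sum.distrib sum_distrib_left algebra_simps)

interpretation matrix_mult:
  bounded_bilinear "(**) :: real^'n^'m \<Rightarrow> real^'p^'n \<Rightarrow> real^'p^'m"
  by (rule bounded_bilinear_matrix_mult)

lemma mat_of_self_adjoint:
  "x \<bullet> (mat_of W *v y) = (mat_of W *v x) \<bullet> y"
  by (metis dot_lmul_matrix transpose_mat_of transpose_matrix_vector)

text \<open>
  A maximizer of the quadratic form on the unit sphere of the subspace is an eigenvector: the vector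
  by which it fails to be one lies in the subspace, and moving along it would increase the quotient.
\<close>

lemma eigenvector_in_invariant_subspace:
  fixes W :: "'n::finite sym_mat"
  assumes V: "subspace V" and v0: "v0 \<in> V" "v0 \<noteq> 0"
    and inv: "\<And>x. x \<in> V \<Longrightarrow> mat_of W *v x \<in> V"
  obtains x c where "x \<in> V" "norm x = 1" "mat_of W *v x = c *\<^sub>R x"
proof -
  let ?f = "\<lambda>x. x \<bullet> (mat_of W *v x)"
  let ?K = "V \<inter> sphere 0 1"
  have "compact ?K"
    by (intro closed_Int_compact closed_subspace V compact_sphere)
  moreover have "(1 / norm v0) *\<^sub>R v0 \<in> ?K"
    using v0 V by (simp add: subspace_scale)
  moreover have "continuous_on ?K ?f"
    by (intro continuous_intros matrix_vector_mult_linear_continuous_on)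
  ultimately obtain x where x: "x \<in> ?K" and max: "\<And>y. y \<in> ?K \<Longrightarrow> ?f y \<le> ?f x"
    using continuous_attains_sup[of ?K ?f] by blast
  define c where "c = ?f x"
  have bound: "?f y \<le> c * (y \<bullet> y)" if "y \<in> V" for y
  proof (cases "y = 0")
    case False
    have "?f ((1 / norm y) *\<^sub>R y) \<le> c"
      unfolding c_def using False that V by (intro max) (simp add: subspace_scale)
    then show ?thesis
      using False
      by (simp add: matrix_vector_mult_scaleR field_simps power2_eq_square flip: power2_norm_eq_inner)
  qed simp
  have xx: "x \<bullet> x = 1" and xV: "x \<in> V"
    using x by (auto simp: norm_eq_1)
  define v where "v = mat_of W *v x - c *\<^sub>R x"
  have vV: "v \<in> V"
    unfolding v_def using V xV by (intro subspace_diff subspace_scale inv)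
  \<comment> \<open>First-order optimality: a nonpositive quadratic in \<open>t\<close> that vanishes at 0 has no linear term.\<close>
  have key: "2 * t * (v \<bullet> v) \<le> t\<^sup>2 * (c * (v \<bullet> v) - ?f v)" for t
  proof -
    let ?Wx = "mat_of W *v x" and ?Wv = "mat_of W *v v"
    have "?f (x + t *\<^sub>R v) \<le> c * ((x + t *\<^sub>R v) \<bullet> (x + t *\<^sub>R v))"
      by (rule bound) (rule subspace_add[OF V xV subspace_scale[OF V vV]])
    moreover have "?f (x + t *\<^sub>R v) = c + 2 * t * (v \<bullet> ?Wx) + t\<^sup>2 * ?f v"
    proof -
      have "x \<bullet> ?Wv = v \<bullet> ?Wx"
        using mat_of_self_adjoint[of x W v] by (simp add: inner_commute)
      moreover have "?f (x + t *\<^sub>R v) = (x + t *\<^sub>R v) \<bullet> (?Wx + t *\<^sub>R ?Wv)"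
        by (simp only: matrix_vector_right_distrib matrix_vector_mult_scaleR)
      ultimately show ?thesis
        unfolding c_def by (simp only: inner_simps power2_eq_square) (simp add: algebra_simps)
    qed
    moreover have "(x + t *\<^sub>R v) \<bullet> (x + t *\<^sub>R v) = 1 + 2 * t * (v \<bullet> x) + t\<^sup>2 * (v \<bullet> v)"
      using xx by (simp only: inner_simps power2_eq_square) (simp add: inner_commute algebra_simps)
    ultimately have "c + 2 * t * (v \<bullet> ?Wx) + t\<^sup>2 * ?f v
        \<le> c * (1 + 2 * t * (v \<bullet> x) + t\<^sup>2 * (v \<bullet> v))"
      by simp
    moreover have "v \<bullet> v = v \<bullet> ?Wx - c * (v \<bullet> x)"
    proof -
      have "v \<bullet> v = v \<bullet> (?Wx - c *\<^sub>R x)" by (simp only: v_def)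
      then show ?thesis by (simp only: inner_simps)
    qed
    ultimately show ?thesis
      by (simp only:) (simp add: algebra_simps)
  qed
  have "v \<bullet> v \<le> 0"
  proof (rule ccontr)
    assume "\<not> v \<bullet> v \<le> 0"
    then have pos: "v \<bullet> v > 0" by linarith
    define K where "K = \<bar>c * (v \<bullet> v) - ?f v\<bar> + 1"
    define t where "t = (v \<bullet> v) / K"
    have K: "K > 0" "c * (v \<bullet> v) - ?f v \<le> K" by (auto simp: K_def)
    have t: "t > 0" using pos K by (simp add: t_def)
    have "2 * t * (v \<bullet> v) \<le> t\<^sup>2 * K"
      using key[of t] mult_left_mono[OF K(2), of "t\<^sup>2"] by simp
    then have "2 * (v \<bullet> v) \<le> t * K"
      using t by (simp add: power2_eq_square)
    then show False
      using K pos by (simp add: t_def)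
  qed
  then have "v = 0"
    by (metis inner_eq_zero_iff inner_ge_zero order_antisym)
  then have "mat_of W *v x = c *\<^sub>R x"
    by (simp add: v_def)
  then show ?thesis
    using x by (intro that[of x c]) auto
qed

text \<open>
  A largest orthonormal set of eigenvectors is a basis, since its orthogonal complement is invariant
  and would otherwise contribute one more eigenvector.
\<close>

lemma orthonormal_eigenbasis:
  fixes W :: "'n::finite sym_mat"
  obtains B where "pairwise orthogonal B" "\<And>x. x \<in> B \<Longrightarrow> norm x = 1"
    "\<And>x. x \<in> B \<Longrightarrow> \<exists>c. mat_of W *v x = c *\<^sub>R x" "finite B" "card B = CARD('n)"
proof -
  define ok where "ok B \<longleftrightarrow> pairwise orthogonal B \<and> (\<forall>x\<in>B. norm x = 1)
    \<and> (\<forall>x\<in>B. \<exists>c. mat_of W *v x = c *\<^sub>R x)" for B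
  have indep: "independent B" if "ok B" for B
    using that by (intro pairwise_orthogonal_independent) (auto simp: ok_def)
  have bound: "finite B" "card B \<le> CARD('n)" if "ok B" for B
    using independent_bound[OF indep[OF that]] by auto
  have "\<exists>k. (\<exists>B. ok B \<and> card B = k) \<and> (\<forall>k'. (\<exists>B. ok B \<and> card B = k') \<longrightarrow> k' \<le> k)"
  proof (rule ex_has_greatest_nat[where b = "Suc CARD('n)"])
    show "\<exists>B. ok B \<and> card B = 0"
      by (intro exI[of _ "{}"]) (simp add: ok_def)
  qed (use bound in \<open>auto simp: less_Suc_eq_le\<close>)
  then obtain B where B: "ok B" and max: "\<And>B'. ok B' \<Longrightarrow> card B' \<le> card B"
    by blast
  have "\<not> card B < CARD('n)"
  proof
    assume "card B < CARD('n)"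
    then have "dim (span B) < DIM(real^'n)"
      using indep[OF B] dim_eq_card_independent by fastforce
    then obtain v0 where v0: "v0 \<noteq> 0" "\<And>y. y \<in> span B \<Longrightarrow> orthogonal v0 y"
      by (metis dim_span orthogonal_to_subspace_exists)
    define V where "V = {x. \<forall>b\<in>B. b \<bullet> x = 0}"
    have "subspace V"
      by (auto simp: V_def subspace_def inner_add_right)
    moreover have "v0 \<in> V"
      using v0(2) span_base by (fastforce simp: V_def orthogonal_def inner_commute)
    moreover have "mat_of W *v x \<in> V" if "x \<in> V" for x
      unfolding V_def
    proof safe
      fix v assume "v \<in> B"
      then obtain c where "mat_of W *v v = c *\<^sub>R v"
        using B by (auto simp: ok_def)
      then show "v \<bullet> (mat_of W *v x) = 0"
        using that \<open>v \<in> B\<close> by (simp add: mat_of_self_adjoint V_def)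
    qed
    ultimately obtain x c where x: "x \<in> V" "norm x = 1" "mat_of W *v x = c *\<^sub>R x"
      using eigenvector_in_invariant_subspace v0(1) by metis
    have "ok (insert x B)"
      using B x unfolding ok_def V_def
      by (auto simp: pairwise_insert orthogonal_def inner_commute)
    moreover have "x \<notin> B"
      using x by (auto simp: V_def)
    ultimately show False
      using max[of "insert x B"] bound(1)[OF B] by simp
  qed
  then have "card B = CARD('n)"
    using bound(2)[OF B] by simp
  then show ?thesis
    using B bound(1)[OF B] by (intro that[of B]) (simp_all add: ok_def)
qed

definition conj_diag :: "real^'n^'n \<Rightarrow> real^'n \<Rightarrow> 'n::finite sym_mat" where
  "conj_diag P d = Sym (P ** diag_mat d ** transpose P)"

lemma transpose_diag_mat: "transpose (diag_mat d) = diag_mat d"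
  by (auto simp: transpose_def diag_mat_def vec_eq_iff)

lemma mat_of_conj_diag: "mat_of (conj_diag P d) = P ** diag_mat d ** transpose P"
  unfolding conj_diag_def
  by (rule Sym_inverse) (simp add: matrix_transpose_mul transpose_diag_mat matrix_mul_assoc)

lemma diag_mat_linear:
  "diag_mat (d + e) = diag_mat d + diag_mat e" "diag_mat (d - e) = diag_mat d - diag_mat e"
  "diag_mat (c *\<^sub>R d) = c *\<^sub>R diag_mat d" "diag_mat 0 = 0"
  by (auto simp: diag_mat_def vec_eq_iff)

lemma mult_diag_mat: "(P ** diag_mat d) $ i $ j = P $ i $ j * d $ j"
  by (simp add: matrix_matrix_mult_def diag_mat_def mult_delta_right)

lemma diag_mat_mult: "(diag_mat d ** P) $ i $ j = d $ i * P $ i $ j"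
  by (simp add: matrix_matrix_mult_def diag_mat_def mult_delta_left)

theorem spectral_decomposition:
  fixes W :: "'n::finite sym_mat"
  obtains P d where "orthogonal_matrix P" "W = conj_diag P d"
proof -
  obtain B where B: "pairwise orthogonal B" "\<And>x. x \<in> B \<Longrightarrow> norm x = 1"
    "\<And>x. x \<in> B \<Longrightarrow> \<exists>c. mat_of W *v x = c *\<^sub>R x" "finite B" "card B = CARD('n)"
    using orthonormal_eigenbasis by blast
  obtain f :: "'n \<Rightarrow> real^'n" where f: "bij_betw f UNIV B"
    using finite_same_card_bij[OF finite B(4)] B(5) by metis
  have fB: "f j \<in> B" for j
    using f by (simp add: bij_betw_apply)
  have "\<forall>j. \<exists>c. mat_of W *v f j = c *\<^sub>R f j"
    using B(3) fB by blast
  then obtain c where c: "\<And>j. mat_of W *v f j = c j *\<^sub>R f j"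
    by (auto dest!: choice)
  define P :: "real^'n^'n" where "P = (\<chi> i j. f j $ i)"
  have col: "column j P = f j" for j
    by (simp add: column_def P_def vec_eq_iff)
  have P: "orthogonal_matrix P"
    unfolding orthogonal_matrix_orthonormal_columns col
    using B(2) fB pairwiseD[OF B(1)] bij_betw_imp_inj_on[OF f] by (metis injD)
  have "mat_of W ** P = P ** diag_mat (vec_lambda c)"
  proof -
    have "(mat_of W ** P) $ i $ j = (mat_of W *v f j) $ i" for i j
      by (simp add: matrix_matrix_mult_def matrix_vector_mult_def P_def)
    then show ?thesis
      by (simp add: vec_eq_iff mult_diag_mat c) (simp add: P_def mult.commute)
  qed
  then have "mat_of W ** P ** transpose P = P ** diag_mat (vec_lambda c) ** transpose P"
    by simp
  then have "mat_of W = mat_of (conj_diag P (vec_lambda c))"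
    using P by (simp add: mat_of_conj_diag orthogonal_matrix_def flip: matrix_mul_assoc)
  then show ?thesis
    using that[OF P] by (simp add: mat_of_inject)
qed

section \<open>Spectral functions compared in two eigenbases\<close>

lemma inner_matrix_trace: "(M :: real^'n^'m) \<bullet> N = trace (transpose M ** N)"
  unfolding inner_vec_def trace_def matrix_matrix_mult_def transpose_def
  by simp (rule sum.swap)

lemma orthogonal_conj_inner:
  fixes P :: "real^'n^'n" and Q :: "real^'m^'m" and M N :: "real^'m^'n"
  assumes "orthogonal_matrix P" "orthogonal_matrix Q"
  shows "(transpose P ** M ** Q) \<bullet> (transpose P ** N ** Q) = M \<bullet> N"
proof -
  have P: "P ** transpose P = mat 1" and Q: "Q ** transpose Q = mat 1"
    using assms by (auto simp: orthogonal_matrix_def)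
  have "(transpose P ** M ** Q) \<bullet> (transpose P ** N ** Q)
      = trace (transpose Q ** (transpose M ** (P ** transpose P) ** N ** Q))"
    by (simp add: inner_matrix_trace matrix_transpose_mul matrix_mul_assoc)
  also have "\<dots> = trace ((transpose M ** N ** Q) ** transpose Q)"
    by (subst trace_mul_sym) (simp add: P)
  also have "\<dots> = M \<bullet> N"
    by (simp add: Q inner_matrix_trace flip: matrix_mul_assoc)
  finally show ?thesis .
qed

text \<open>
  Conjugation by \<open>P\<^sup>T\<close> on the left and \<open>Q\<close> on the right preserves inner products and turns the
  difference of the two matrices into the matrix with entries \<open>(f\<^sub>i - g\<^sub>j) R\<^sub>i\<^sub>j\<close>, where
  \<open>R = P\<^sup>T Q\<close>. The weights \<open>R\<^sub>i\<^sub>j\<^sup>2\<close> are nonnegative and do not depend on the diagonals, which is why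
  scalar inequalities in \<open>f\<^sub>i - g\<^sub>j\<close> can be summed up to matrix inequalities.
\<close>

lemma two_basis_inner:
  fixes P Q :: "real^'n::finite^'n"
  assumes P: "orthogonal_matrix P" and Q: "orthogonal_matrix Q"
  shows "(conj_diag P f - conj_diag Q g) \<bullet> (conj_diag P f' - conj_diag Q g')
    = (\<Sum>i\<in>UNIV. \<Sum>j\<in>UNIV. ((transpose P ** Q) $ i $ j)\<^sup>2 * ((f $ i - g $ j) * (f' $ i - g' $ j)))"
proof -
  let ?R = "transpose P ** Q"
  have conj: "transpose P ** (mat_of (conj_diag P f - conj_diag Q g)) ** Q
      = (\<chi> i j. (f $ i - g $ j) * ?R $ i $ j)" for f g
  proof -
    have "transpose P ** (mat_of (conj_diag P f - conj_diag Q g)) ** Q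
        = (transpose P ** P) ** diag_mat f ** ?R - ?R ** diag_mat g ** (transpose Q ** Q)"
      by (simp add: mat_of_simps mat_of_conj_diag matrix_mul_assoc matrix_mult.diff_left matrix_mult.diff_right)
    also have "\<dots> = diag_mat f ** ?R - ?R ** diag_mat g"
      using P Q by (simp add: orthogonal_matrix_def)
    finally show ?thesis
      by (simp add: vec_eq_iff mult_diag_mat diag_mat_mult algebra_simps)
  qed
  have "(conj_diag P f - conj_diag Q g) \<bullet> (conj_diag P f' - conj_diag Q g')
      = (\<chi> i j. (f $ i - g $ j) * ?R $ i $ j) \<bullet> (\<chi> i j. (f' $ i - g' $ j) * ?R $ i $ j)"
    using orthogonal_conj_inner[OF P Q, of "mat_of (conj_diag P f - conj_diag Q g)" "mat_of (conj_diag P f' - conj_diag Q g')"]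
    by (simp only: conj inner_sym_mat.rep_eq)
  then show ?thesis
    by (simp add: inner_vec_def power2_eq_square mult_ac)
qed

lemma conj_diag_zero [simp]: "conj_diag P 0 = 0"
  by (simp add: mat_of_conj_diag mat_of_simps diag_mat_linear flip: mat_of_inject)

lemma conj_diag_linear:
  "conj_diag P (d + e) = conj_diag P d + conj_diag P e" "conj_diag P (d - e) = conj_diag P d - conj_diag P e"
  "conj_diag P (c *\<^sub>R d) = c *\<^sub>R conj_diag P d"
  by (simp_all add: mat_of_conj_diag mat_of_simps diag_mat_linear matrix_mult.add_left matrix_mult.add_right
      matrix_mult.diff_left matrix_mult.diff_right matrix_mult.scaleR_left matrix_mult.scaleR_right
      flip: mat_of_inject)

definition vec_map :: "(real \<Rightarrow> real) \<Rightarrow> real^'n \<Rightarrow> real^'n" where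
  "vec_map \<phi> d = (\<chi> i. \<phi> (d $ i))"

text \<open>
  The operator \<^const>\<open>Phi\<close> with an arbitrary scalar function in place of the Huber function, so that
  polynomials can serve as approximations.
\<close>

definition spectral_fun :: "(real \<Rightarrow> real) \<Rightarrow> 'n::finite sym_mat \<Rightarrow> 'n sym_mat" where
  "spectral_fun \<phi> W = (THE V. \<exists>P d. orthogonal_matrix P
     \<and> mat_of W = P ** diag_mat d ** transpose P
     \<and> mat_of V = P ** diag_mat (\<chi> i. \<phi> (d $ i)) ** transpose P)"

lemma Phi_eq_spectral_fun: "Phi e = spectral_fun (huber e)"
  by (rule ext) (simp add: Phi_def spectral_fun_def)

text \<open>
  With \<open>R = P\<^sup>T Q\<close>: whenever \<open>R\<^sub>i\<^sub>j \<noteq> 0\<close>, the two eigenvalues agree, and then so do their images. Hence the definite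
  description is proper.
\<close>

lemma conj_diag_vec_map_unique:
  assumes "orthogonal_matrix P" "orthogonal_matrix Q" "conj_diag P d = conj_diag Q e"
  shows "conj_diag P (vec_map \<phi> d) = conj_diag Q (vec_map \<phi> e)"
proof -
  let ?R = "transpose P ** Q"
  have "0 = (conj_diag P d - conj_diag Q e) \<bullet> (conj_diag P d - conj_diag Q e)"
    by (simp add: assms(3))
  then have "(\<Sum>i\<in>UNIV. \<Sum>j\<in>UNIV. (?R $ i $ j)\<^sup>2 * (d $ i - e $ j)\<^sup>2) = 0"
    unfolding two_basis_inner[OF assms(1,2)] by (simp add: power2_eq_square)
  then have zero: "?R $ i $ j = 0 \<or> d $ i = e $ j" for i j
    by (simp add: sum_nonneg_eq_0_iff sum_nonneg)
  have "(?R $ i $ j)\<^sup>2 * ((vec_map \<phi> d $ i - vec_map \<phi> e $ j) * (vec_map \<phi> d $ i - vec_map \<phi> e $ j)) = 0" for i j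
    using zero[of i j] by (auto simp: vec_map_def)
  then have "(conj_diag P (vec_map \<phi> d) - conj_diag Q (vec_map \<phi> e)) \<bullet> (conj_diag P (vec_map \<phi> d) - conj_diag Q (vec_map \<phi> e)) = 0"
    unfolding two_basis_inner[OF assms(1,2)] by (intro sum.neutral ballI)
  then show ?thesis by simp
qed

lemma spectral_fun_conj_diag:
  assumes "orthogonal_matrix P"
  shows "spectral_fun \<phi> (conj_diag P d) = conj_diag P (vec_map \<phi> d)"
proof -
  have "spectral_fun \<phi> (conj_diag P d) = (THE V. \<exists>Q e. orthogonal_matrix Q \<and> conj_diag P d = conj_diag Q e
      \<and> V = conj_diag Q (vec_map \<phi> e))"
    unfolding spectral_fun_def by (simp add: mat_of_conj_diag vec_map_def flip: mat_of_inject)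
  also have "\<dots> = conj_diag P (vec_map \<phi> d)"
  proof (rule the_equality)
    show "\<exists>Q e. orthogonal_matrix Q \<and> conj_diag P d = conj_diag Q e \<and> conj_diag P (vec_map \<phi> d) = conj_diag Q (vec_map \<phi> e)"
      using assms by blast
  next
    fix V assume "\<exists>Q e. orthogonal_matrix Q \<and> conj_diag P d = conj_diag Q e \<and> V = conj_diag Q (vec_map \<phi> e)"
    then show "V = conj_diag P (vec_map \<phi> d)"
      using conj_diag_vec_map_unique[OF assms] by metis
  qed
  finally show ?thesis .
qed

lemma inner_conj_diag_conj_diag:
  assumes "orthogonal_matrix P"
  shows "conj_diag P d \<bullet> conj_diag P e = d \<bullet> e"
proof -
  have 1: "transpose P ** P = mat 1"
    using assms by (simp add: orthogonal_matrix_def)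
  have "conj_diag P d \<bullet> conj_diag P e = (conj_diag P d - conj_diag P 0) \<bullet> (conj_diag P e - conj_diag P 0)"
    by simp
  also have "\<dots> = (\<Sum>i\<in>UNIV. \<Sum>j\<in>UNIV. if i = j then d $ i * e $ i else 0)"
    unfolding two_basis_inner[OF assms assms] 1
    by (intro sum.cong refl) (simp add: mat_def)
  also have "\<dots> = d \<bullet> e"
    by (simp add: inner_vec_def)
  finally show ?thesis .
qed

lemma norm_conj_diag: "orthogonal_matrix P \<Longrightarrow> norm (conj_diag P d) = norm d"
  by (simp add: norm_eq_sqrt_inner inner_conj_diag_conj_diag)

text \<open>
  Only numbers that can occur as eigenvalues matter, and these are bounded by the norm.
\<close>

lemma spectral_fun_pair:
  fixes W W' :: "'n::finite sym_mat"
  assumes pos: "\<And>s t. \<bar>s\<bar> \<le> norm W \<Longrightarrow> \<bar>t\<bar> \<le> norm W' \<Longrightarrow>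
    0 \<le> a * (\<phi> s - \<phi> t)\<^sup>2 + b * ((\<phi> s - \<phi> t) * (s - t)) + c * (s - t)\<^sup>2"
  shows "0 \<le> a * (norm (spectral_fun \<phi> W - spectral_fun \<phi> W'))\<^sup>2
    + b * ((spectral_fun \<phi> W - spectral_fun \<phi> W') \<bullet> (W - W')) + c * (norm (W - W'))\<^sup>2"
proof -
  obtain P d where P: "orthogonal_matrix P" and W: "W = conj_diag P d"
    using spectral_decomposition by blast
  obtain Q e where Q: "orthogonal_matrix Q" and W': "W' = conj_diag Q e"
    using spectral_decomposition by blast
  let ?R = "transpose P ** Q"
  have "a * (norm (spectral_fun \<phi> W - spectral_fun \<phi> W'))\<^sup>2
      + b * ((spectral_fun \<phi> W - spectral_fun \<phi> W') \<bullet> (W - W')) + c * (norm (W - W'))\<^sup>2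
    = (\<Sum>i\<in>UNIV. \<Sum>j\<in>UNIV. (?R $ i $ j)\<^sup>2 * (a * (\<phi> (d $ i) - \<phi> (e $ j))\<^sup>2
      + b * ((\<phi> (d $ i) - \<phi> (e $ j)) * (d $ i - e $ j)) + c * (d $ i - e $ j)\<^sup>2))"
    unfolding W W' spectral_fun_conj_diag[OF P] spectral_fun_conj_diag[OF Q] power2_norm_eq_inner two_basis_inner[OF P Q]
    by (simp add: vec_map_def sum_distrib_left power2_eq_square algebra_simps flip: sum.distrib)
  also have "0 \<le> \<dots>"
  proof (intro sum_nonneg mult_nonneg_nonneg zero_le_power2 pos)
    show "\<bar>d $ i\<bar> \<le> norm W" for i
      using component_le_norm_cart[of d i] by (simp add: W norm_conj_diag P)
    show "\<bar>e $ j\<bar> \<le> norm W'" for j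
      using component_le_norm_cart[of e j] by (simp add: W' norm_conj_diag Q)
  qed
  finally show ?thesis .
qed

lemma spectral_fun_lipschitz:
  fixes W W' :: "'n::finite sym_mat"
  assumes lip: "\<And>s t. \<bar>s\<bar> \<le> norm W \<Longrightarrow> \<bar>t\<bar> \<le> norm W' \<Longrightarrow> \<bar>\<phi> s - \<phi> t\<bar> \<le> L * \<bar>s - t\<bar>"
    and "0 \<le> L"
  shows "norm (spectral_fun \<phi> W - spectral_fun \<phi> W') \<le> L * norm (W - W')"
proof -
  have "0 \<le> (-1) * (norm (spectral_fun \<phi> W - spectral_fun \<phi> W'))\<^sup>2
    + 0 * ((spectral_fun \<phi> W - spectral_fun \<phi> W') \<bullet> (W - W')) + L\<^sup>2 * (norm (W - W'))\<^sup>2"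
  proof (rule spectral_fun_pair)
    fix s t assume "\<bar>s\<bar> \<le> norm W" "\<bar>t\<bar> \<le> norm W'"
    from power_mono[OF lip[OF this], of 2]
    show "0 \<le> -1 * (\<phi> s - \<phi> t)\<^sup>2 + 0 * ((\<phi> s - \<phi> t) * (s - t)) + L\<^sup>2 * (s - t)\<^sup>2"
      by (simp add: power_mult_distrib)
  qed
  then have "(norm (spectral_fun \<phi> W - spectral_fun \<phi> W'))\<^sup>2 \<le> (L * norm (W - W'))\<^sup>2"
    by (simp add: power_mult_distrib)
  then show ?thesis
    by (rule power2_le_imp_le) (use \<open>0 \<le> L\<close> in simp)
qed

text \<open>
  The scalar hypothesis says that \<open>\<phi>\<close> is nondecreasing with slope at most 1.
\<close>

lemma spectral_fun_firmly_nonexpansive: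
  assumes "\<And>s t. (\<phi> s - \<phi> t)\<^sup>2 \<le> (\<phi> s - \<phi> t) * (s - t)"
  shows "(norm (spectral_fun \<phi> W - spectral_fun \<phi> W'))\<^sup>2 \<le> (spectral_fun \<phi> W - spectral_fun \<phi> W') \<bullet> (W - W')"
  using spectral_fun_pair[of W W' "-1" \<phi> 1 0] assms by simp

lemma spectral_fun_scaleR:
  "spectral_fun \<phi> (c *\<^sub>R W) = spectral_fun (\<lambda>t. \<phi> (c * t)) W"
proof -
  obtain P d where P: "orthogonal_matrix P" and W: "W = conj_diag P d"
    using spectral_decomposition by blast
  then show ?thesis
    by (simp add: spectral_fun_conj_diag vec_map_def flip: conj_diag_linear)
qed

lemma spectral_fun_cmult: "spectral_fun (\<lambda>t. c * \<phi> t) W = c *\<^sub>R spectral_fun \<phi> W"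
proof -
  obtain P d where P: "orthogonal_matrix P" and W: "W = conj_diag P d"
    using spectral_decomposition by blast
  have "vec_map (\<lambda>t. c * \<phi> t) d = c *\<^sub>R vec_map \<phi> d"
    by (simp add: vec_map_def vec_eq_iff)
  then show ?thesis
    by (simp add: P W spectral_fun_conj_diag conj_diag_linear)
qed

lemma spectral_fun_add: "spectral_fun (\<lambda>t. \<phi> t + \<theta> t) W = spectral_fun \<phi> W + spectral_fun \<theta> W"
proof -
  obtain P d where P: "orthogonal_matrix P" and W: "W = conj_diag P d"
    using spectral_decomposition by blast
  have "vec_map (\<lambda>t. \<phi> t + \<theta> t) d = vec_map \<phi> d + vec_map \<theta> d"
    by (simp add: vec_map_def vec_eq_iff)
  then show ?thesis
    by (simp add: P W spectral_fun_conj_diag conj_diag_linear)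
qed

lemma spectral_fun_diff: "spectral_fun (\<lambda>t. \<phi> t - \<theta> t) W = spectral_fun \<phi> W - spectral_fun \<theta> W"
  using spectral_fun_add[of \<phi> "\<lambda>t. -1 * \<theta> t" W] unfolding spectral_fun_cmult by simp

lemma spectral_fun_ident: "spectral_fun (\<lambda>t. t) W = W"
proof -
  obtain P d where P: "orthogonal_matrix P" and W: "W = conj_diag P d"
    using spectral_decomposition by blast
  then show ?thesis
    by (simp add: spectral_fun_conj_diag vec_map_def)
qed

lemma spectral_fun_zero: "spectral_fun (\<lambda>t. 0) W = 0"
  using spectral_fun_cmult[of 0 "\<lambda>t. 0" W] by simp

lemma spectral_fun_sum:
  "finite I \<Longrightarrow> spectral_fun (\<lambda>t. \<Sum>i\<in>I. \<phi> i t) W = (\<Sum>i\<in>I. spectral_fun (\<phi> i) W)"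
  by (induction I rule: finite_induct) (simp_all add: spectral_fun_add spectral_fun_zero)

lemma norm_spectral_fun_le:
  fixes W :: "'n::finite sym_mat" and e :: real
  assumes "\<And>t. \<bar>\<phi> t\<bar> \<le> e"
  shows "norm (spectral_fun \<phi> W) \<le> CARD('n) * e"
proof -
  obtain P d where P: "orthogonal_matrix P" and W: "W = conj_diag P d"
    using spectral_decomposition by blast
  have "norm (spectral_fun \<phi> W) = norm (vec_map \<phi> d)"
    by (simp add: P W spectral_fun_conj_diag norm_conj_diag)
  also have "\<dots> \<le> (\<Sum>i\<in>UNIV. \<bar>vec_map \<phi> d $ i\<bar>)"
    by (rule norm_le_l1_cart)
  also have "\<dots> \<le> (\<Sum>i\<in>(UNIV :: 'n set). (e :: real))"
    by (intro sum_mono) (simp add: vec_map_def assms)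
  finally show ?thesis by simp
qed

lemma spectral_fun_orthogonal:
  assumes "\<And>t. \<phi> t * \<theta> t = 0"
  shows "spectral_fun \<phi> W \<bullet> spectral_fun \<theta> W = 0"
proof -
  obtain P d where P: "orthogonal_matrix P" and W: "W = conj_diag P d"
    using spectral_decomposition by blast
  have "vec_map \<phi> d \<bullet> vec_map \<theta> d = 0"
    by (simp add: inner_vec_def vec_map_def assms)
  then show ?thesis
    by (simp add: P W spectral_fun_conj_diag inner_conj_diag_conj_diag)
qed

lemma mat_of_spectral_fun_power_Suc:
  "mat_of (spectral_fun (\<lambda>t. t ^ Suc k) W) = mat_of W ** mat_of (spectral_fun (\<lambda>t. t ^ k) W)"
proof -
  obtain P d where P: "orthogonal_matrix P" and W: "W = conj_diag P d"
    using spectral_decomposition by blast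
  let ?p = "\<lambda>k. vec_map (\<lambda>t. t ^ k) d"
  have diag: "diag_mat d ** diag_mat (?p k) = diag_mat (?p (Suc k))"
    by (simp add: vec_eq_iff diag_mat_mult) (simp add: diag_mat_def vec_map_def)
  have PP: "M ** transpose P ** P = M" for M
    using P by (simp add: orthogonal_matrix_def flip: matrix_mul_assoc)
  show ?thesis
    by (simp add: W spectral_fun_conj_diag P mat_of_conj_diag matrix_mul_assoc PP del: power_Suc)
      (simp add: diag del: power_Suc flip: matrix_mul_assoc)
qed

section \<open>The positive semidefinite and positive definite cones\<close>

lemma matrix_mult_inner_outer:
  "(M :: real^'n^'m) \<bullet> (\<chi> i j. x $ i * y $ j) = x \<bullet> (M *v y)"
  by (simp add: inner_vec_def matrix_vector_mult_def sum_distrib_left mult_ac)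

text \<open>
  Rank-one matrices represent quadratic forms as linear functionals, so that both cones become
  intersections of half-spaces.
\<close>

definition outer :: "real^'n \<Rightarrow> 'n::finite sym_mat" where
  "outer x = Sym (\<chi> i j. x $ i * x $ j)"

lemma mat_of_outer: "mat_of (outer x) = (\<chi> i j. x $ i * x $ j)"
  unfolding outer_def by (rule Sym_inverse) (simp add: transpose_def vec_eq_iff mult.commute)

lemma inner_outer: "M \<bullet> outer x = x \<bullet> (mat_of M *v x)"
  by (simp add: inner_sym_mat.rep_eq mat_of_outer matrix_mult_inner_outer)

lemma psd_cone_iff: "M \<in> psd_cone \<longleftrightarrow> (\<forall>x. 0 \<le> M \<bullet> outer x)"
  by (simp add: psd_cone_def inner_outer)

lemma pd_cone_iff: "M \<in> pd_cone \<longleftrightarrow> (\<forall>x. x \<noteq> 0 \<longrightarrow> 0 < M \<bullet> outer x)"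
  by (simp add: pd_cone_def inner_outer)

lemma conj_diag_eq_sum_outer: "conj_diag P d = (\<Sum>i\<in>UNIV. d $ i *\<^sub>R outer (column i P))"
proof -
  have sum: "mat_of (\<Sum>i\<in>I. f i) = (\<Sum>i\<in>I. mat_of (f i))" if "finite I" for f :: "'a \<Rightarrow> 'a sym_mat" and I
    using that by (induction I rule: finite_induct) (auto simp: mat_of_simps)
  show ?thesis
    by (simp add: sum mat_of_conj_diag mat_of_simps mat_of_outer flip: mat_of_inject)
      (simp add: vec_eq_iff column_def matrix_matrix_mult_def transpose_def diag_mat_def
        mult_delta_right mult_ac)
qed

lemma inner_conj_diag: "X \<bullet> conj_diag P d = (\<Sum>i\<in>UNIV. d $ i * (X \<bullet> outer (column i P)))"
  by (simp add: conj_diag_eq_sum_outer inner_sum_right)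

lemma inner_outer_outer: "outer x \<bullet> outer y = (x \<bullet> y)\<^sup>2"
proof -
  have "mat_of (outer x) *v y = (x \<bullet> y) *\<^sub>R x"
    by (simp add: mat_of_outer matrix_vector_mult_def vec_eq_iff inner_vec_def sum_distrib_left mult_ac)
  then show ?thesis
    by (simp add: inner_outer power2_eq_square inner_commute)
qed

lemma psd_conj_diag_nonneg:
  assumes "orthogonal_matrix P" "conj_diag P d \<in> psd_cone"
  shows "0 \<le> d $ i"
proof -
  have "column j P \<bullet> column i P = (if i = j then 1 else 0)" for j
    using assms(1) unfolding orthogonal_matrix_orthonormal_columns
    by (auto simp: norm_eq_1 orthogonal_def)
  then have "conj_diag P d \<bullet> outer (column i P) = d $ i"
    by (simp add: inner_commute[of "conj_diag P d"] inner_conj_diag inner_outer_outer if_distrib[of "\<lambda>x. x\<^sup>2"]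
        inner_commute[of "column i P"] mult_delta_right cong: if_cong)
  then show ?thesis
    using assms(2) by (metis psd_cone_iff)
qed

lemma conj_diag_psd: "(\<And>i. 0 \<le> d $ i) \<Longrightarrow> conj_diag P d \<in> psd_cone"
  by (simp add: psd_cone_iff inner_commute[of "conj_diag P d"] inner_conj_diag inner_outer_outer sum_nonneg)

lemma spectral_fun_psd:
  assumes "\<And>t. 0 \<le> \<phi> t"
  shows "spectral_fun \<phi> W \<in> psd_cone"
proof -
  obtain P d where "orthogonal_matrix P" "W = conj_diag P d"
    using spectral_decomposition by blast
  then show ?thesis
    by (simp add: spectral_fun_conj_diag) (simp add: conj_diag_psd vec_map_def assms)
qed

lemma psd_inner_nonneg:
  assumes "X \<in> psd_cone" "Y \<in> psd_cone"
  shows "0 \<le> X \<bullet> Y"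
proof -
  obtain P d where "orthogonal_matrix P" "Y = conj_diag P d"
    using spectral_decomposition by blast
  then show ?thesis
    using assms psd_conj_diag_nonneg[of P d] by (auto simp: inner_conj_diag psd_cone_iff intro!: sum_nonneg)
qed

lemma pd_inner_pos:
  assumes "X \<in> pd_cone" "Y \<in> psd_cone" "Y \<noteq> 0"
  shows "0 < X \<bullet> Y"
proof -
  obtain P d where P: "orthogonal_matrix P" and Y: "Y = conj_diag P d"
    using spectral_decomposition by blast
  have nonneg: "0 \<le> d $ i" for i
    using psd_conj_diag_nonneg assms(2) P Y by blast
  have "d \<noteq> 0"
    using assms(3) Y by auto
  then obtain i where i: "d $ i \<noteq> 0"
    by (auto simp: vec_eq_iff)
  have col: "0 < X \<bullet> outer (column j P)" for j
  proof -
    have "norm (column j P) = 1"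
      using P unfolding orthogonal_matrix_orthonormal_columns by blast
    then have "column j P \<noteq> 0" by fastforce
    then show ?thesis using assms(1) by (simp add: pd_cone_iff)
  qed
  have "0 < d $ i * (X \<bullet> outer (column i P))"
    using nonneg[of i] i col[of i] by (simp add: zero_less_mult_iff less_le)
  also have "\<dots> \<le> X \<bullet> Y"
    unfolding Y inner_conj_diag
    by (rule member_le_sum[of i UNIV "\<lambda>i. d $ i * (X \<bullet> outer (column i P))"])
      (simp_all add: nonneg col less_imp_le)
  finally show ?thesis .
qed

lemma closed_psd_cone: "closed (psd_cone :: 'n::finite sym_mat set)"
proof -
  have "(psd_cone :: 'n sym_mat set) = (\<Inter>x. {M. 0 \<le> M \<bullet> outer x})"
    by (auto simp: psd_cone_iff)
  moreover have "closed \<dots>"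
    by (intro closed_INT ballI closed_Collect_le continuous_intros)
  ultimately show ?thesis by simp
qed

text \<open>
  Compactness of the section of the cone by the unit sphere makes positivity uniform.
\<close>

lemma pd_inner_coercive:
  fixes X :: "'n::finite sym_mat"
  assumes X: "X \<in> pd_cone"
  obtains l where "l > 0" "\<And>S. S \<in> psd_cone \<Longrightarrow> l * norm S \<le> X \<bullet> S"
proof -
  let ?K = "(psd_cone :: 'n sym_mat set) \<inter> sphere 0 1"
  have compact: "compact ?K"
    by (intro closed_Int_compact closed_psd_cone compact_sphere)
  have scaled: "(1 / norm S) *\<^sub>R S \<in> ?K" if "S \<in> psd_cone" "S \<noteq> 0" for S
    using that by (simp add: psd_cone_iff)
  show ?thesis
  proof (cases "?K = {}")
    case True
    then have "S = 0" if "S \<in> psd_cone" for S :: "'n sym_mat"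
      using scaled that by blast
    then show ?thesis
      using that[of 1] by force
  next
    case False
    obtain S0 where S0: "S0 \<in> ?K" and min: "\<And>S. S \<in> ?K \<Longrightarrow> X \<bullet> S0 \<le> X \<bullet> S"
      using continuous_attains_inf[OF compact False, of "\<lambda>S. X \<bullet> S"]
        continuous_on_inner[OF continuous_on_const continuous_on_id] by blast
    show ?thesis
    proof (rule that)
      show "0 < X \<bullet> S0"
        using S0 by (intro pd_inner_pos X) auto
      fix S :: "'n sym_mat" assume S: "S \<in> psd_cone"
      show "X \<bullet> S0 * norm S \<le> X \<bullet> S"
      proof (cases "S = 0")
        case False
        from min[OF scaled[OF S this]] show ?thesis
          using False by (simp add: field_simps)
      qed simp
    qed
  qed
qed

section \<open>Continuously differentiable maps between Euclidean spaces\<close>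

text \<open>
  Continuity of the derivative is required in each direction separately. As the domain has finite
  dimension, this amounts to continuity in the operator norm (\<open>C1_on_blinfun\<close>), and directional
  derivatives are what explicit formulas and limits provide.
\<close>

definition C1_on :: "('a::euclidean_space \<Rightarrow> 'b::real_normed_vector) \<Rightarrow> 'a set \<Rightarrow> bool" where
  "C1_on f S \<longleftrightarrow> (\<forall>x\<in>S. f differentiable (at x))
     \<and> (\<forall>h. continuous_on S (\<lambda>x. frechet_derivative f (at x) h))"

lemma C1_onI:
  assumes "\<And>x. x \<in> S \<Longrightarrow> (f has_derivative f' x) (at x)"
    and "\<And>h. continuous_on S (\<lambda>x. f' x h)"
  shows "C1_on f S"
proof -
  have "frechet_derivative f (at x) = f' x" if "x \<in> S" for x
    using frechet_derivative_at[OF assms(1)[OF that]] by simp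
  then have "continuous_on S (\<lambda>x. frechet_derivative f (at x) h)" for h
    using assms(2)[of h] by (simp cong: continuous_on_cong)
  then show ?thesis
    using assms(1) by (auto simp: C1_on_def differentiable_def)
qed

lemma C1_onE:
  assumes "C1_on f S"
  obtains f' where "\<And>x. x \<in> S \<Longrightarrow> (f has_derivative f' x) (at x)"
    "\<And>h. continuous_on S (\<lambda>x. f' x h)"
  using assms by (intro that[of "\<lambda>x. frechet_derivative f (at x)"])
    (auto simp: C1_on_def frechet_derivative_works)

lemma C1_on_blinfun:
  assumes "C1_on f S"
  obtains D where "\<And>x. x \<in> S \<Longrightarrow> (f has_derivative blinfun_apply (D x)) (at x)" "continuous_on S D"
proof -
  obtain f' where f': "\<And>x. x \<in> S \<Longrightarrow> (f has_derivative f' x) (at x)"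
    and cont: "\<And>h. continuous_on S (\<lambda>x. f' x h)"
    using C1_onE[OF assms] by metis
  have ap: "blinfun_apply (Blinfun (f' x)) = f' x" if "x \<in> S" for x
    using has_derivative_bounded_linear[OF f'[OF that]] by (rule bounded_linear_Blinfun_apply)
  show ?thesis
  proof (rule that[of "\<lambda>x. Blinfun (f' x)"])
    show "(f has_derivative blinfun_apply (Blinfun (f' x))) (at x)" if "x \<in> S" for x
      using f'[OF that] by (simp add: ap[OF that])
    show "continuous_on S (\<lambda>x. Blinfun (f' x))"
    proof (rule continuous_on_blinfun_componentwise)
      fix i :: 'a
      show "continuous_on S (\<lambda>x. blinfun_apply (Blinfun (f' x)) i)"
        using cont[of i] by (simp add: ap cong: continuous_on_cong)
    qed
  qed
qed

lemma C1_on_imp_continuous_on: "C1_on f S \<Longrightarrow> continuous_on S f"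
  by (meson C1_onE has_derivative_continuous continuous_at_imp_continuous_on)

lemma C1_on_subset: "C1_on f S \<Longrightarrow> T \<subseteq> S \<Longrightarrow> C1_on f T"
  by (auto simp: C1_on_def intro: continuous_on_subset)

lemma C1_on_cong_open:
  assumes "C1_on f S" "open S" "\<And>x. x \<in> S \<Longrightarrow> f x = g x"
  shows "C1_on g S"
proof -
  obtain f' where "\<And>x. x \<in> S \<Longrightarrow> (f has_derivative f' x) (at x)"
    "\<And>h. continuous_on S (\<lambda>x. f' x h)"
    using C1_onE[OF assms(1)] by metis
  then show ?thesis
    using assms(2,3) has_derivative_transform_within_open by (intro C1_onI[of _ _ f']) blast+
qed

lemma C1_on_const: "C1_on (\<lambda>x. c) S"
  by (rule C1_onI[where f' = "\<lambda>x h. 0"]) auto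

lemma C1_on_bounded_linear: "bounded_linear f \<Longrightarrow> C1_on f S"
  by (rule C1_onI[where f' = "\<lambda>x. f"]) (auto intro: bounded_linear_imp_has_derivative)

lemma C1_on_add:
  assumes "C1_on f S" "C1_on g S"
  shows "C1_on (\<lambda>x. f x + g x) S"
proof -
  obtain f' where f': "\<And>x. x \<in> S \<Longrightarrow> (f has_derivative f' x) (at x)"
    "\<And>h. continuous_on S (\<lambda>x. f' x h)"
    using C1_onE[OF assms(1)] by metis
  obtain g' where g': "\<And>x. x \<in> S \<Longrightarrow> (g has_derivative g' x) (at x)"
    "\<And>h. continuous_on S (\<lambda>x. g' x h)"
    using C1_onE[OF assms(2)] by metis
  show ?thesis
    by (rule C1_onI[where f' = "\<lambda>x h. f' x h + g' x h"])
      (auto intro!: has_derivative_add continuous_on_add f' g')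
qed

lemma C1_on_sum:
  "(\<And>i. i \<in> I \<Longrightarrow> C1_on (f i) S) \<Longrightarrow> C1_on (\<lambda>x. \<Sum>i\<in>I. f i x) S"
  by (induction I rule: infinite_finite_induct) (auto intro: C1_on_const C1_on_add)

lemma C1_on_Pair:
  assumes "C1_on f S" "C1_on g S"
  shows "C1_on (\<lambda>x. (f x, g x)) S"
proof -
  obtain f' where f': "\<And>x. x \<in> S \<Longrightarrow> (f has_derivative f' x) (at x)"
    "\<And>h. continuous_on S (\<lambda>x. f' x h)"
    using C1_onE[OF assms(1)] by metis
  obtain g' where g': "\<And>x. x \<in> S \<Longrightarrow> (g has_derivative g' x) (at x)"
    "\<And>h. continuous_on S (\<lambda>x. g' x h)"
    using C1_onE[OF assms(2)] by metis
  show ?thesis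
    by (rule C1_onI[where f' = "\<lambda>x h. (f' x h, g' x h)"])
      (auto intro!: has_derivative_Pair continuous_on_Pair f' g')
qed

lemma C1_on_bilinear:
  assumes "bounded_bilinear B" "C1_on f S" "C1_on g S"
  shows "C1_on (\<lambda>x. B (f x) (g x)) S"
proof -
  obtain f' where f': "\<And>x. x \<in> S \<Longrightarrow> (f has_derivative f' x) (at x)"
    "\<And>h. continuous_on S (\<lambda>x. f' x h)"
    using C1_onE[OF assms(2)] by metis
  obtain g' where g': "\<And>x. x \<in> S \<Longrightarrow> (g has_derivative g' x) (at x)"
    "\<And>h. continuous_on S (\<lambda>x. g' x h)"
    using C1_onE[OF assms(3)] by metis
  show ?thesis
    by (rule C1_onI[where f' = "\<lambda>x h. B (f x) (g' x h) + B (f' x h) (g x)"])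
      (auto intro!: bounded_bilinear.FDERIV[OF assms(1)] continuous_on_add
        bounded_bilinear.continuous_on[OF assms(1)] f' g' C1_on_imp_continuous_on[OF assms(2)]
        C1_on_imp_continuous_on[OF assms(3)])
qed

lemma C1_on_compose:
  fixes f :: "'a::euclidean_space \<Rightarrow> 'b::euclidean_space"
  assumes g: "C1_on g T" and f: "C1_on f S" and sub: "\<And>x. x \<in> S \<Longrightarrow> f x \<in> T"
  shows "C1_on (\<lambda>x. g (f x)) S"
proof -
  obtain f' where f': "\<And>x. x \<in> S \<Longrightarrow> (f has_derivative f' x) (at x)"
    "\<And>h. continuous_on S (\<lambda>x. f' x h)"
    using C1_onE[OF f] by metis
  obtain D where D: "\<And>y. y \<in> T \<Longrightarrow> (g has_derivative blinfun_apply (D y)) (at y)"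
    "continuous_on T D"
    using C1_on_blinfun[OF g] by metis
  have "continuous_on S (\<lambda>x. D (f x))"
    using sub by (intro continuous_on_compose2[OF D(2) C1_on_imp_continuous_on[OF f]]) auto
  then show ?thesis
    using sub
    by (intro C1_onI[where f' = "\<lambda>x h. blinfun_apply (D (f x)) (f' x h)"]
        has_derivative_compose[OF f'(1) D(1)]
        bounded_bilinear.continuous_on[OF bounded_bilinear_blinfun_apply] f'(2)) auto
qed

lemma C1_on_inverse:
  fixes f :: "'a::euclidean_space \<Rightarrow> real"
  assumes "C1_on f S" and nz: "\<And>x. x \<in> S \<Longrightarrow> f x \<noteq> 0"
  shows "C1_on (\<lambda>x. inverse (f x)) S"
proof -
  obtain f' where f': "\<And>x. x \<in> S \<Longrightarrow> (f has_derivative f' x) (at x)"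
    "\<And>h. continuous_on S (\<lambda>x. f' x h)"
    using C1_onE[OF assms(1)] by metis
  show ?thesis
  proof (rule C1_onI)
    fix x assume x: "x \<in> S"
    show "((\<lambda>x. inverse (f x)) has_derivative (\<lambda>h. - (inverse (f x) * f' x h * inverse (f x)))) (at x)"
      by (rule Deriv.has_derivative_inverse[OF nz[OF x] f'(1)[OF x]])
  next
    fix h
    show "continuous_on S (\<lambda>x. - (inverse (f x) * f' x h * inverse (f x)))"
      using nz by (intro continuous_intros f'(2) C1_on_imp_continuous_on[OF assms(1)]) auto
  qed
qed

lemma directional_derivative_tendsto:
  assumes "(f has_derivative D) (at x)"
  shows "((\<lambda>t. (f (x + t *\<^sub>R h) - f x) /\<^sub>R t) \<longlongrightarrow> D h) (at_right 0)"
proof -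
  have "((\<lambda>t. x + t *\<^sub>R h) has_derivative (\<lambda>t. t *\<^sub>R h)) (at_right 0)"
    by (auto intro!: derivative_eq_intros)
  moreover have "(f has_derivative D) (at (x + 0 *\<^sub>R h))"
    using assms by simp
  ultimately have "((\<lambda>t. f (x + t *\<^sub>R h)) has_derivative (\<lambda>t. D (t *\<^sub>R h))) (at_right 0)"
    by (rule has_derivative_compose)
  then have "((\<lambda>t. (1 / norm (t - 0)) *\<^sub>R
      (f (x + t *\<^sub>R h) - (f (x + 0 *\<^sub>R h) + D ((t - 0) *\<^sub>R h)))) \<longlongrightarrow> 0) (at_right 0)"
    unfolding has_derivative_within by blast
  moreover have "\<forall>\<^sub>F t in at_right 0. (1 / norm (t - 0)) *\<^sub>R
      (f (x + t *\<^sub>R h) - (f (x + 0 *\<^sub>R h) + D ((t - 0) *\<^sub>R h)))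
      = (f (x + t *\<^sub>R h) - f x) /\<^sub>R t - D h"
    unfolding eventually_at_right_field
    using has_derivative_bounded_linear[OF assms]
    by (intro exI[of _ 1]) (auto simp: linear_simps divide_inverse scaleR_right_diff_distrib
        scaleR_right_distrib)
  ultimately have "((\<lambda>t. (f (x + t *\<^sub>R h) - f x) /\<^sub>R t - D h) \<longlongrightarrow> 0) (at_right 0)"
    using tendsto_cong by fastforce
  then show ?thesis
    by (rule LIM_zero_cancel)
qed

text \<open>
  Bounds on difference quotients along a single ray pass to the derivative in its direction. The
  lower bound is the one that makes derivatives of strongly injective maps injective.
\<close>

lemma norm_derivative_le:
  assumes "(f has_derivative D) (at x)" "0 < d"
    and "\<And>t. 0 < t \<Longrightarrow> t < d \<Longrightarrow> norm (f (x + t *\<^sub>R h) - f x) \<le> L * t"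
  shows "norm (D h) \<le> L"
proof (rule tendsto_upperbound[OF tendsto_norm[OF directional_derivative_tendsto[OF assms(1)]]])
  show "\<forall>\<^sub>F t in at_right 0. norm ((f (x + t *\<^sub>R h) - f x) /\<^sub>R t) \<le> L"
    unfolding eventually_at_right_field
    using assms(2,3) by (intro exI[of _ d]) (auto simp: divide_simps mult.commute)
qed simp

lemma norm_derivative_ge:
  assumes "(f has_derivative D) (at x)" "0 < d"
    and "\<And>t. 0 < t \<Longrightarrow> t < d \<Longrightarrow> L * t \<le> norm (f (x + t *\<^sub>R h) - f x)"
  shows "L \<le> norm (D h)"
proof (rule tendsto_lowerbound[OF tendsto_norm[OF directional_derivative_tendsto[OF assms(1)]]])
  show "\<forall>\<^sub>F t in at_right 0. L \<le> norm ((f (x + t *\<^sub>R h) - f x) /\<^sub>R t)"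
    unfolding eventually_at_right_field
    using assms(2,3) by (intro exI[of _ d]) (auto simp: divide_simps mult.commute)
qed simp

lemma norm_derivative_le_lipschitz:
  assumes D: "(f has_derivative D) (at x)" and S: "open S" "x \<in> S"
    and lip: "\<And>y. y \<in> S \<Longrightarrow> norm (f y - f x) \<le> L * norm (y - x)"
  shows "norm (D h) \<le> L * norm h"
proof -
  obtain e where e: "0 < e" "ball x e \<subseteq> S"
    using S openE by blast
  have pos: "0 < norm h + 1"
    using norm_ge_zero[of h] by linarith
  define d where "d = e / (norm h + 1)"
  show ?thesis
  proof (rule norm_derivative_le[OF D])
    show "0 < d" using e(1) pos by (simp add: d_def)
    fix t assume t: "0 < t" "t < d"
    have "t * norm h \<le> t * (norm h + 1)"
      using t by simp
    also have "\<dots> < e"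
      using t(2) pos by (simp add: d_def field_simps)
    finally have "x + t *\<^sub>R h \<in> S"
      using e(2) t by (auto simp: dist_norm)
    from lip[OF this] show "norm (f (x + t *\<^sub>R h) - f x) \<le> L * norm h * t"
      using t by (simp add: mult_ac)
  qed
qed

text \<open>
  When \<open>g - f\<close> has a small Lipschitz constant for each of two maps \<open>f\<close>, the derivatives of these maps
  are close in operator norm. So the derivatives of a sequence of approximations converge uniformly;
  the limit is continuous, and it is the derivative of \<open>g\<close> because the Lipschitz error bounds the
  difference quotients of \<open>g - f\<close> as well.
\<close>

theorem C1_on_lipschitz_limit:
  fixes g :: "'a::euclidean_space \<Rightarrow> 'b::banach"
  assumes S: "open S"
    and approx: "\<And>e. e > 0 \<Longrightarrow> \<exists>f. C1_on f S \<and>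
      (\<forall>x\<in>S. \<forall>y\<in>S. norm ((g x - f x) - (g y - f y)) \<le> e * norm (x - y))"
  shows "C1_on g S"
proof -
  define e where "e n = inverse (real (Suc n))" for n
  have e_pos: "0 < e n" for n
    by (simp add: e_def)
  have e_lim: "e \<longlonglongrightarrow> 0"
    unfolding e_def by (rule LIMSEQ_inverse_real_of_nat)
  have "\<forall>n. \<exists>f. C1_on f S \<and>
      (\<forall>x\<in>S. \<forall>y\<in>S. norm ((g x - f x) - (g y - f y)) \<le> e n * norm (x - y))"
    using approx e_pos by blast
  then obtain f where C1: "\<And>n. C1_on (f n) S"
    and close: "\<And>n x y. x \<in> S \<Longrightarrow> y \<in> S \<Longrightarrow>
      norm ((g x - f n x) - (g y - f n y)) \<le> e n * norm (x - y)"
    by metis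
  define f' where "f' n x = frechet_derivative (f n) (at x)" for n x
  have f': "(f n has_derivative f' n x) (at x)" if "x \<in> S" for n x
    using C1[of n] that by (simp add: C1_on_def f'_def frechet_derivative_works)
  have cont: "continuous_on S (\<lambda>x. f' n x h)" for n h
    using C1[of n] by (simp add: C1_on_def f'_def)
  have cauchy: "norm (f' n x h - f' m x h) \<le> (e n + e m) * norm h" if x: "x \<in> S" for n m x h
  proof (rule norm_derivative_le_lipschitz[OF has_derivative_diff[OF f'[OF x] f'[OF x]] S x])
    fix y assume y: "y \<in> S"
    have "norm (f n y - f m y - (f n x - f m x))
        = norm (((g y - f m y) - (g x - f m x)) - ((g y - f n y) - (g x - f n x)))"
      by (simp add: algebra_simps)
    also have "\<dots> \<le> e m * norm (y - x) + e n * norm (y - x)"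
      by (rule order_trans[OF norm_triangle_ineq4 add_mono[OF close[OF y x] close[OF y x]]])
    finally show "norm (f n y - f m y - (f n x - f m x)) \<le> (e n + e m) * norm (y - x)"
      by (simp add: algebra_simps)
  qed
  define g' where "g' x h = lim (\<lambda>n. f' n x h)" for x h
  have g'_lim: "(\<lambda>n. f' n x h) \<longlonglongrightarrow> g' x h" if x: "x \<in> S" for x h
  proof -
    have "Cauchy (\<lambda>n. f' n x h)"
    proof (rule metric_CauchyI)
      fix r :: real assume r: "0 < r"
      have "(\<lambda>n. (e n + e n) * norm h) \<longlonglongrightarrow> (0 + 0) * norm h"
        by (intro tendsto_intros e_lim)
      then have "\<forall>\<^sub>F n in sequentially. (e n + e n) * norm h < r"
        using r by (intro order_tendstoD(2)) auto
      then obtain N where N: "(e N + e N) * norm h < r"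
        by (auto simp: eventually_sequentially)
      have mono: "e n \<le> e N" if "N \<le> n" for n
        using that by (simp add: e_def field_simps)
      show "\<exists>M. \<forall>m\<ge>M. \<forall>n\<ge>M. dist (f' m x h) (f' n x h) < r"
      proof (intro exI[of _ N] allI impI)
        fix m n assume "N \<le> m" "N \<le> n"
        then have "(e m + e n) * norm h \<le> (e N + e N) * norm h"
          by (intro mult_right_mono add_mono mono) auto
        then show "dist (f' m x h) (f' n x h) < r"
          using cauchy[OF x, of m h n] N by (simp add: dist_norm)
      qed
    qed
    then show ?thesis
      by (simp add: g'_def Cauchy_convergent_iff convergent_LIMSEQ_iff)
  qed
  have g'_close: "norm (f' n x h - g' x h) \<le> e n * norm h" if x: "x \<in> S" for n x h
  proof (rule tendsto_le[OF sequentially_bot])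
    show "(\<lambda>m. norm (f' n x h - f' m x h)) \<longlonglongrightarrow> norm (f' n x h - g' x h)"
      by (intro tendsto_intros g'_lim x)
    have "(\<lambda>m. (e n + e m) * norm h) \<longlonglongrightarrow> (e n + 0) * norm h"
      by (intro tendsto_intros e_lim)
    then show "(\<lambda>m. (e n + e m) * norm h) \<longlonglongrightarrow> e n * norm h"
      by simp
  qed (simp add: cauchy x)
  have g'_linear: "linear (g' x)" if x: "x \<in> S" for x
  proof (rule linearI)
    fix h k :: 'a and c :: real
    have lin: "linear (f' n x)" for n
      using f'[OF x] has_derivative_linear by blast
    have "(\<lambda>n. f' n x h + f' n x k) \<longlonglongrightarrow> g' x h + g' x k"
      by (intro tendsto_intros g'_lim x)
    then show "g' x (h + k) = g' x h + g' x k"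
      using g'_lim[OF x, of "h + k"] LIMSEQ_unique by (simp add: linear_add[OF lin]) blast
    have "(\<lambda>n. c *\<^sub>R f' n x h) \<longlonglongrightarrow> c *\<^sub>R g' x h"
      by (intro tendsto_intros g'_lim x)
    then show "g' x (c *\<^sub>R h) = c *\<^sub>R g' x h"
      using g'_lim[OF x, of "c *\<^sub>R h"] LIMSEQ_unique by (simp add: linear_scale[OF lin]) blast
  qed
  show ?thesis
  proof (rule C1_onI)
    fix x assume x: "x \<in> S"
    show "(g has_derivative g' x) (at x)"
      unfolding has_derivative_at_alt
    proof (intro conjI allI impI)
      show "bounded_linear (g' x)"
        using g'_linear[OF x] linear_conv_bounded_linear by blast
      fix r :: real assume r: "0 < r"
      have "\<forall>\<^sub>F n in sequentially. e n < r / 3"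
        using order_tendstoD(2)[OF e_lim, of "r / 3"] r by simp
      then obtain n where n: "e n < r / 3"
        by (auto simp: eventually_sequentially)
      obtain d where d: "0 < d" "\<And>y. norm (y - x) < d \<Longrightarrow>
          norm (f n y - f n x - f' n x (y - x)) \<le> r / 3 * norm (y - x)"
        using f'[OF x, of n] r unfolding has_derivative_at_alt
        by (metis divide_pos_pos zero_less_numeral)
      obtain d' where d': "0 < d'" "ball x d' \<subseteq> S"
        using S x openE by blast
      show "\<exists>d>0. \<forall>y. norm (y - x) < d \<longrightarrow> norm (g y - g x - g' x (y - x)) \<le> r * norm (y - x)"
      proof (intro exI[of _ "min d d'"] conjI allI impI)
        fix y assume y: "norm (y - x) < min d d'"
        then have yS: "y \<in> S"
          using d'(2) by (auto simp: dist_norm norm_minus_commute)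
        have "norm (g y - g x - g' x (y - x))
            = norm (((g y - f n y) - (g x - f n x)) + (f n y - f n x - f' n x (y - x))
              + (f' n x (y - x) - g' x (y - x)))"
          by (simp add: algebra_simps)
        also have "\<dots> \<le> e n * norm (y - x) + r / 3 * norm (y - x) + e n * norm (y - x)"
          using y by (intro norm_triangle_le add_mono close[OF yS x] d(2) g'_close[OF x]) auto
        also have "\<dots> = (e n + r / 3 + e n) * norm (y - x)"
          by (simp add: algebra_simps)
        also have "\<dots> \<le> r * norm (y - x)"
          using n by (intro mult_right_mono) auto
        finally show "norm (g y - g x - g' x (y - x)) \<le> r * norm (y - x)" .
      qed (use d(1) d'(1) in simp)
    qed
  next
    fix h
    have "uniform_limit S (\<lambda>n x. f' n x h) (\<lambda>x. g' x h) sequentially"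
    proof (rule uniform_limitI)
      fix r :: real assume r: "0 < r"
      have "(\<lambda>n. e n * norm h) \<longlonglongrightarrow> 0 * norm h"
        by (intro tendsto_intros e_lim)
      then have "\<forall>\<^sub>F n in sequentially. e n * norm h < r"
        using r by (intro order_tendstoD(2)) auto
      then show "\<forall>\<^sub>F n in sequentially. \<forall>x\<in>S. dist (f' n x h) (g' x h) < r"
        by eventually_elim (auto simp: dist_norm intro: le_less_trans[OF g'_close])
    qed
    then show "continuous_on S (\<lambda>x. g' x h)"
      by (rule uniform_limit_theorem[rotated]) (simp_all add: cont)
  qed
qed

text \<open>
  The derivative is uniformly continuous on a compact neighbourhood of \<open>K\<close>.
\<close>

lemma C1_on_uniform_linearization:
  fixes f :: "'a::euclidean_space \<Rightarrow> 'b::real_normed_vector"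
  assumes C1: "C1_on f S" and S: "open S" and K: "compact K" "K \<subseteq> S" and e: "0 < e"
  obtains d where "0 < d" "\<And>x h. x \<in> K \<Longrightarrow> norm h < d \<Longrightarrow>
    norm (f (x + h) - f x - frechet_derivative f (at x) h) \<le> e * norm h"
proof -
  obtain D where D: "\<And>x. x \<in> S \<Longrightarrow> (f has_derivative blinfun_apply (D x)) (at x)" "continuous_on S D"
    using C1_on_blinfun[OF C1] by metis
  obtain d1 where d1: "0 < d1" "(\<Union>x\<in>K. cball x d1) \<subseteq> S"
    using compact_subset_open_imp_cball_epsilon_subset[OF K(1) S K(2)] by metis
  let ?K = "\<Union>x\<in>K. cball x d1"
  have "compact ?K"
    using K(1) by (rule compact_minkowski_sum_cball)
  then have "uniformly_continuous_on ?K D"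
    using D(2) d1(2) by (intro compact_uniformly_continuous continuous_on_subset[OF D(2)])
  then obtain d2 where d2: "0 < d2"
    "\<And>x y. x \<in> ?K \<Longrightarrow> y \<in> ?K \<Longrightarrow> dist y x < d2 \<Longrightarrow> dist (D y) (D x) < e"
    using e unfolding uniformly_continuous_on_def by meson
  show ?thesis
  proof (rule that[of "min d1 d2"])
    fix x h :: 'a assume x: "x \<in> K" and h: "norm h < min d1 d2"
    let ?B = "ball x (min d1 d2)"
    have sub: "?B \<subseteq> ?K"
      using x by force
    have xS: "x \<in> S" using x K(2) by blast
    have "norm (f (x + h) - f x - blinfun_apply (D x) (x + h - x)) \<le> norm (x + h - x) * e"
    proof (rule differentiable_bound_linearization[of x "x + h" ?B])
      fix t :: real assume t: "t \<in> {0..1}"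
      then have "\<bar>t\<bar> * norm h \<le> 1 * norm h"
        by (intro mult_right_mono) auto
      moreover have "dist x (x + t *\<^sub>R (x + h - x)) = \<bar>t\<bar> * norm h"
        by (simp add: dist_norm)
      ultimately show "x + t *\<^sub>R (x + h - x) \<in> ?B"
        using h by (simp only: mem_ball)
    next
      fix y assume "y \<in> ?B"
      then have "y \<in> S"
        using sub d1(2) by blast
      then show "(f has_derivative blinfun_apply (D y)) (at y within ?B)"
        by (rule has_derivative_at_withinI[OF D(1)])
      have "dist (D y) (D x) < e"
      proof (rule d2(2))
        show "x \<in> ?K"
          by (rule subsetD[OF sub]) (use d1(1) d2(1) in simp)
        show "y \<in> ?K"
          by (rule subsetD[OF sub \<open>y \<in> ?B\<close>])
        show "dist y x < d2"
          using \<open>y \<in> ?B\<close> by (simp add: dist_commute)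
      qed
      moreover have "blinfun_apply (D y) - blinfun_apply (D x) = blinfun_apply (D y - D x)"
        by (simp add: fun_eq_iff blinfun.diff_left)
      ultimately show "onorm (blinfun_apply (D y) - blinfun_apply (D x)) \<le> e"
        by (simp add: dist_norm norm_blinfun.rep_eq del: minus_apply)
    qed (use d1(1) d2(1) in auto)
    moreover have "frechet_derivative f (at x) = blinfun_apply (D x)"
      using frechet_derivative_at[OF D(1)[OF xS]] by simp
    ultimately show "norm (f (x + h) - f x - frechet_derivative f (at x) h) \<le> e * norm h"
      by (simp add: mult.commute)
  qed (use d1(1) d2(1) in simp)
qed

section \<open>Differentiability of spectral functions\<close>

text \<open>
  A linear retraction, through which polynomial maps with values in square matrices become maps into
  the space of symmetric matrices.
\<close>

definition symmetrize :: "real^'n^'n \<Rightarrow> 'n::finite sym_mat" where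
  "symmetrize M = Sym ((1 / 2) *\<^sub>R (M + transpose M))"

lemma mat_of_symmetrize: "mat_of (symmetrize M) = (1 / 2) *\<^sub>R (M + transpose M)"
  unfolding symmetrize_def
  by (rule Sym_inverse) (simp add: transpose_def vec_eq_iff add.commute)

lemma symmetrize_mat_of: "symmetrize (mat_of X) = X"
  by (simp add: mat_of_symmetrize flip: mat_of_inject scaleR_2)

lemma bounded_linear_symmetrize: "bounded_linear symmetrize"
  unfolding linear_conv_bounded_linear [symmetric]
  by (rule linearI)
    (simp_all add: mat_of_symmetrize mat_of_simps transpose_def vec_eq_iff algebra_simps flip: mat_of_inject)

lemma bounded_linear_mat_of: "bounded_linear mat_of"
  unfolding linear_conv_bounded_linear [symmetric]
  by (rule linearI) (simp_all add: mat_of_simps)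

lemma spectral_fun_const: "mat_of (spectral_fun (\<lambda>t. c) W) = mat c"
proof -
  obtain P d where P: "orthogonal_matrix P" and W: "W = conj_diag P d"
    using spectral_decomposition by blast
  have "diag_mat (vec_map (\<lambda>t. c) d) = c *\<^sub>R mat 1"
    by (simp add: diag_mat_def vec_map_def mat_def vec_eq_iff)
  then show ?thesis
    using P
    by (simp add: W spectral_fun_conj_diag mat_of_conj_diag matrix_mult.scaleR_left matrix_mult.scaleR_right
        orthogonal_matrix_def) (simp add: mat_def vec_eq_iff)
qed

lemma C1_on_mat_of_spectral_fun_power:
  "C1_on (\<lambda>W :: 'n::finite sym_mat. mat_of (spectral_fun (\<lambda>t. t ^ k) W)) UNIV"
proof (induction k)
  case 0
  then show ?case
    by (simp add: spectral_fun_const C1_on_const)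
next
  case (Suc k)
  show ?case
    unfolding mat_of_spectral_fun_power_Suc
    by (intro C1_on_bilinear[OF bounded_bilinear_matrix_mult] Suc C1_on_bounded_linear
        bounded_linear_mat_of)
qed

lemma C1_on_spectral_fun_power: "C1_on (spectral_fun (\<lambda>t. t ^ k) :: 'n::finite sym_mat \<Rightarrow> _) UNIV"
proof -
  have "C1_on (\<lambda>W :: 'n sym_mat. symmetrize (mat_of (spectral_fun (\<lambda>t. t ^ k) W))) UNIV"
    by (rule C1_on_compose[OF C1_on_bounded_linear[OF bounded_linear_symmetrize]
          C1_on_mat_of_spectral_fun_power, where T = UNIV]) simp
  then show ?thesis
    by (simp add: symmetrize_mat_of)
qed

lemma C1_on_spectral_fun_polynomial:
  "C1_on (spectral_fun (\<lambda>t. \<Sum>i\<le>n. a i * t ^ i) :: 'n::finite sym_mat \<Rightarrow> _) UNIV"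
proof -
  have "spectral_fun (\<lambda>t. \<Sum>i\<le>n. a i * t ^ i) = (\<lambda>W :: 'n sym_mat. \<Sum>i\<le>n. a i *\<^sub>R spectral_fun (\<lambda>t. t ^ i) W)"
    by (simp add: fun_eq_iff spectral_fun_sum spectral_fun_cmult)
  moreover have "C1_on \<dots> UNIV"
    by (rule C1_on_sum, rule C1_on_compose[OF C1_on_bounded_linear[OF bounded_linear_scaleR_right]
          C1_on_spectral_fun_power, where T = UNIV]) simp
  ultimately show ?thesis by simp
qed

text \<open>
  The approximation is applied to the derivative and then integrated: this is what makes the error
  small as a Lipschitz constant and not only in size.
\<close>

lemma polynomial_lipschitz_approximation:
  fixes \<phi> :: "real \<Rightarrow> real"
  assumes deriv: "\<And>t. (\<phi> has_real_derivative \<phi>' t) (at t)"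
    and cont: "continuous_on UNIV \<phi>'" and "0 < e"
  obtains a n where "\<And>s t. \<bar>s\<bar> \<le> M \<Longrightarrow> \<bar>t\<bar> \<le> M \<Longrightarrow>
    \<bar>(\<phi> s - (\<Sum>i\<le>n. a i * s ^ i)) - (\<phi> t - (\<Sum>i\<le>n. a i * t ^ i))\<bar> \<le> e * \<bar>s - t\<bar>"
proof -
  have "continuous_on {-M..M} \<phi>'"
    using cont continuous_on_subset by blast
  from Stone_Weierstrass_real_polynomial_function[OF compact_Icc this \<open>0 < e\<close>]
  obtain q where "real_polynomial_function q" and q: "\<And>x. x \<in> {-M..M} \<Longrightarrow> \<bar>\<phi>' x - q x\<bar> < e"
    by blast
  then obtain c n where c: "q = (\<lambda>x. \<Sum>i\<le>n. c i * x ^ i)"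
    by (auto simp: real_polynomial_function_iff_sum)
  define a where "a i = (if i = 0 then 0 else c (i - 1) / real i)" for i
  define p where "p x = (\<Sum>i\<le>Suc n. a i * x ^ i)" for x
  have p_eq: "p x = (\<Sum>i\<le>n. c i / real (Suc i) * x ^ Suc i)" for x
    unfolding p_def sum.atMost_Suc_shift by (simp add: a_def)
  have p': "(p has_real_derivative q x) (at x)" for x
    unfolding p_eq[abs_def] c
    by (rule DERIV_cong, (rule derivative_intros)+) (auto intro!: sum.cong)
  show ?thesis
  proof (rule that[of a "Suc n", folded p_def])
    fix s t assume s: "\<bar>s\<bar> \<le> M" and t: "\<bar>t\<bar> \<le> M"
    have "norm ((\<phi> s - p s) - (\<phi> t - p t)) \<le> e * norm (s - t)"
    proof (rule field_differentiable_bound[of "{-M..M}" "\<lambda>x. \<phi> x - p x" "\<lambda>x. \<phi>' x - q x"])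
      show "((\<lambda>x. \<phi> x - p x) has_field_derivative \<phi>' x - q x) (at x within {-M..M})" for x
        using DERIV_diff[OF deriv p'] has_field_derivative_at_within by blast
      show "norm (\<phi>' x - q x) \<le> e" if "x \<in> {-M..M}" for x
        using q[OF that] by simp
    qed (use s t in auto)
    then show "\<bar>(\<phi> s - p s) - (\<phi> t - p t)\<bar> \<le> e * \<bar>s - t\<bar>"
      by simp
  qed
qed

text \<open>
  On a ball all eigenvalues lie in one interval. A polynomial that approximates \<open>\<phi>\<close> there in the
  Lipschitz sense does the same for the spectral functions, with the same constant, and a spectral
  polynomial is a polynomial in the matrix. No formula for the derivative is involved.
\<close>

theorem C1_on_spectral_fun:
  fixes \<phi> :: "real \<Rightarrow> real"
  assumes deriv: "\<And>t. (\<phi> has_real_derivative \<phi>' t) (at t)"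
    and cont: "continuous_on UNIV \<phi>'"
  shows "C1_on (spectral_fun \<phi> :: 'n::finite sym_mat \<Rightarrow> _) UNIV"
proof -
  have ball: "C1_on (spectral_fun \<phi> :: 'n sym_mat \<Rightarrow> _) (ball 0 M)" for M
  proof (rule C1_on_lipschitz_limit)
    fix e :: real assume e: "0 < e"
    obtain a n where lip: "\<And>s t. \<bar>s\<bar> \<le> M \<Longrightarrow> \<bar>t\<bar> \<le> M \<Longrightarrow>
        \<bar>(\<phi> s - (\<Sum>i\<le>n. a i * s ^ i)) - (\<phi> t - (\<Sum>i\<le>n. a i * t ^ i))\<bar> \<le> e * \<bar>s - t\<bar>"
      by (rule polynomial_lipschitz_approximation[OF deriv cont e, where M = M]) blast
    let ?p = "\<lambda>t. \<Sum>i\<le>n. a i * t ^ i"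
    show "\<exists>f :: 'n sym_mat \<Rightarrow> 'n sym_mat. C1_on f (ball 0 M) \<and> (\<forall>x\<in>ball 0 M. \<forall>y\<in>ball 0 M.
        norm ((spectral_fun \<phi> x - f x) - (spectral_fun \<phi> y - f y)) \<le> e * norm (x - y))"
    proof (intro exI[of _ "spectral_fun ?p"] conjI ballI)
      show "C1_on (spectral_fun ?p :: 'n sym_mat \<Rightarrow> _) (ball 0 M)"
        using C1_on_spectral_fun_polynomial C1_on_subset by blast
      fix x y :: "'n sym_mat" assume "x \<in> ball 0 M" "y \<in> ball 0 M"
      then show "norm ((spectral_fun \<phi> x - spectral_fun ?p x) - (spectral_fun \<phi> y - spectral_fun ?p y)) \<le> e * norm (x - y)"
        unfolding spectral_fun_diff [symmetric]
        using e by (intro spectral_fun_lipschitz lip) auto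
    qed
  qed simp
  have D: "spectral_fun \<phi> differentiable (at x)" if "x \<in> ball 0 M" for x :: "'n sym_mat" and M
    using ball[of M] that by (auto simp: C1_on_def)
  show ?thesis
    unfolding C1_on_def
  proof (intro conjI ballI allI)
    fix x :: "'n sym_mat"
    show "spectral_fun \<phi> differentiable (at x)"
      using D[of x "norm x + 1"] by simp
  next
    fix h :: "'n sym_mat"
    have "isCont (\<lambda>x. frechet_derivative (spectral_fun \<phi>) (at x) h) x" for x :: "'n sym_mat"
      using ball[of "norm x + 1"] continuous_on_interior
      by (auto simp: C1_on_def continuous_on_eq_continuous_at)
    then show "continuous_on UNIV (\<lambda>x. frechet_derivative (spectral_fun \<phi>) (at (x :: 'n sym_mat)) h)"
      by (simp add: continuous_at_imp_continuous_on)
  qed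
qed

section \<open>The Huber function and its spectral function\<close>

lemma huber_eq: "huber e t = (if e = 0 then max 0 t else if t \<le> 0 then 0
    else if t \<le> \<bar>e\<bar> then t\<^sup>2 / (2 * \<bar>e\<bar>) else t - \<bar>e\<bar> / 2)"
  by (auto simp: huber_def)

text \<open>
  Squared positive parts are differentiable, so this form needs no discussion of the breakpoints.
\<close>

lemma huber_one: "huber 1 t = ((max 0 t)\<^sup>2 - (max 0 (t - 1))\<^sup>2) / 2"
  by (auto simp: huber_eq max_def power2_eq_square field_simps)

lemma huber_scale: "0 < e \<Longrightarrow> huber e t = e * huber 1 (inverse e * t)"
  by (auto simp: huber_eq field_simps power2_eq_square)

lemma DERIV_square_pos_part: "((\<lambda>t::real. (max 0 t)\<^sup>2) has_real_derivative 2 * max 0 x) (at x)"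
  unfolding has_field_derivative_def has_derivative_at_alt
proof (intro conjI allI impI)
  show "bounded_linear ((*) (2 * max 0 x))"
    by (rule bounded_linear_mult_right)
  fix e :: real assume e: "0 < e"
  have "\<bar>(max 0 y)\<^sup>2 - (max 0 x)\<^sup>2 - 2 * max 0 x * (y - x)\<bar> \<le> (y - x)\<^sup>2" for y
  proof -
    consider "0 \<le> x" "0 \<le> y" | "0 \<le> x" "y < 0" | "x < 0" "0 \<le> y" | "x < 0" "y < 0"
      by linarith
    then show ?thesis
    proof cases
      case 2
      then have xy: "x * y \<le> 0" by (simp add: mult_nonneg_nonpos)
      have "(max 0 y)\<^sup>2 - (max 0 x)\<^sup>2 - 2 * max 0 x * (y - x) = x * x - 2 * (x * y)"
        using 2 by (simp add: power2_eq_square algebra_simps)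
      moreover have "(y - x)\<^sup>2 = y * y + (x * x - 2 * (x * y))"
        by (simp add: power2_eq_square algebra_simps)
      ultimately show ?thesis
        using xy zero_le_square[of x] zero_le_square[of y] by linarith
    next
      case 3
      then have xy: "x * y \<le> 0" by (simp add: mult_nonpos_nonneg)
      have "(max 0 y)\<^sup>2 - (max 0 x)\<^sup>2 - 2 * max 0 x * (y - x) = y * y"
        using 3 by (simp add: power2_eq_square algebra_simps)
      moreover have "(y - x)\<^sup>2 = y * y + (x * x - 2 * (x * y))"
        by (simp add: power2_eq_square algebra_simps)
      ultimately show ?thesis
        using xy zero_le_square[of x] zero_le_square[of y] by linarith
    next
      case 1
      then have "(max 0 y)\<^sup>2 - (max 0 x)\<^sup>2 - 2 * max 0 x * (y - x) = (y - x)\<^sup>2"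
        by (simp add: power2_eq_square algebra_simps)
      then show ?thesis by simp
    qed simp
  qed
  then have bound: "\<bar>(max 0 y)\<^sup>2 - (max 0 x)\<^sup>2 - 2 * max 0 x * (y - x)\<bar> \<le> \<bar>y - x\<bar> * \<bar>y - x\<bar>" for y
    by (simp add: power2_eq_square flip: abs_mult)
  show "\<exists>d>0. \<forall>y. norm (y - x) < d \<longrightarrow>
      norm ((max 0 y)\<^sup>2 - (max 0 x)\<^sup>2 - 2 * max 0 x * (y - x)) \<le> e * norm (y - x)"
  proof (intro exI[of _ e] conjI allI impI e)
    fix y assume "norm (y - x) < e"
    then have "\<bar>y - x\<bar> * \<bar>y - x\<bar> \<le> e * \<bar>y - x\<bar>"
      by (intro mult_right_mono) auto
    then show "norm ((max 0 y)\<^sup>2 - (max 0 x)\<^sup>2 - 2 * max 0 x * (y - x)) \<le> e * norm (y - x)"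
      using bound[of y] by simp
  qed
qed

lemma DERIV_huber_one: "(huber 1 has_real_derivative max 0 x - max 0 (x - 1)) (at x)"
proof -
  have "((\<lambda>t. (max 0 (t - 1))\<^sup>2) has_real_derivative 2 * max 0 (x - 1)) (at x)"
  proof -
    have "((\<lambda>t. t - 1) has_real_derivative 1) (at x)"
      by (auto intro!: derivative_eq_intros)
    from DERIV_chain2[OF DERIV_square_pos_part this] show ?thesis by simp
  qed
  from DERIV_cdivide[OF DERIV_diff[OF DERIV_square_pos_part this], of 2]
  show ?thesis
    unfolding huber_one[abs_def] by (simp add: diff_divide_distrib)
qed

lemma C1_on_spectral_fun_huber: "C1_on (spectral_fun (huber 1) :: 'n::finite sym_mat \<Rightarrow> _) UNIV"
  by (rule C1_on_spectral_fun[OF DERIV_huber_one]) (intro continuous_intros)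

text \<open>
  Homogeneity of the Huber function in both arguments reduces differentiability in \<open>\<epsilon>\<close> and \<open>W\<close>
  jointly to that of a single spectral function.
\<close>

lemma Phi_scale:
  assumes "0 < e"
  shows "Phi e W = e *\<^sub>R spectral_fun (huber 1) (inverse e *\<^sub>R W)"
proof -
  have "huber e = (\<lambda>t. e * huber 1 (inverse e * t))"
    using huber_scale[OF assms] by auto
  then show ?thesis
    by (simp add: Phi_eq_spectral_fun spectral_fun_scaleR spectral_fun_cmult)
qed

lemma huber_abs: "huber \<bar>e\<bar> t = huber e t"
  by (simp add: huber_eq)

lemma huber_mono_nonexpansive:
  assumes "t \<le> s"
  shows "0 \<le> huber e s - huber e t" "huber e s - huber e t \<le> s - t"
proof -
  have one: "huber 1 x \<le> huber 1 y \<and> huber 1 y - huber 1 x \<le> y - x" if "x \<le> y" for x y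
  proof
    show "huber 1 x \<le> huber 1 y"
      by (rule DERIV_nonneg_imp_nondecreasing[OF that]) (use DERIV_huber_one in force)
    have "((\<lambda>t. t - huber 1 t) has_real_derivative (1 - (max 0 z - max 0 (z - 1)))) (at z)" for z
      by (intro DERIV_diff DERIV_ident DERIV_huber_one)
    then have "x - huber 1 x \<le> y - huber 1 y"
      by (intro DERIV_nonneg_imp_nondecreasing[OF that]) force
    then show "huber 1 y - huber 1 x \<le> y - x" by simp
  qed
  have "0 \<le> huber e s - huber e t \<and> huber e s - huber e t \<le> s - t"
  proof (cases "e = 0")
    case True
    then show ?thesis using assms by (auto simp: huber_eq)
  next
    case False
    then have e: "0 < \<bar>e\<bar>" by simp
    have "inverse \<bar>e\<bar> * t \<le> inverse \<bar>e\<bar> * s"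
      using assms by (intro mult_left_mono) auto
    note * = one[OF this]
    have eq: "huber e s - huber e t = \<bar>e\<bar> * (huber 1 (inverse \<bar>e\<bar> * s) - huber 1 (inverse \<bar>e\<bar> * t))"
      using huber_scale[OF e] by (simp add: huber_abs right_diff_distrib)
    have "\<bar>e\<bar> * (huber 1 (inverse \<bar>e\<bar> * s) - huber 1 (inverse \<bar>e\<bar> * t))
        \<le> \<bar>e\<bar> * (inverse \<bar>e\<bar> * s - inverse \<bar>e\<bar> * t)"
      using * by (intro mult_left_mono) auto
    also have "\<dots> = s - t"
      using False by (simp add: field_simps)
    finally show ?thesis
      unfolding eq using * by simp
  qed
  then show "0 \<le> huber e s - huber e t" "huber e s - huber e t \<le> s - t" by auto
qed

lemma huber_firm: "(huber e s - huber e t)\<^sup>2 \<le> (huber e s - huber e t) * (s - t)"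
proof -
  have *: "(huber e y - huber e x)\<^sup>2 \<le> (huber e y - huber e x) * (y - x)" if "x \<le> y" for x y
    unfolding power2_eq_square
    using huber_mono_nonexpansive[OF that] by (intro mult_left_mono)
  show ?thesis
    using *[of t s] *[of s t] by (cases "t \<le> s") (auto simp: power2_commute algebra_simps)
qed

lemma huber_smoothing_error: "\<bar>huber e t - huber e' t\<bar> \<le> \<bar>e - e'\<bar>"
proof -
  have *: "\<bar>huber a t - huber b t\<bar> \<le> b - a" if "0 \<le> a" "a \<le> b" for a b
  proof -
    consider "t \<le> 0" | "0 < t" "t \<le> a" | "0 < t" "a < t" "t \<le> b" | "b < t" "0 < t"
      by linarith
    then show ?thesis
    proof cases
      case 2
      then have a: "0 < a" and b: "0 < b" using that by auto
      have "t\<^sup>2 \<le> a * b"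
        unfolding power2_eq_square using 2 that by (intro mult_mono) auto
      have eq: "huber a t - huber b t = (b - a) * (t\<^sup>2 / (2 * a * b))"
        using 2 that a b by (simp add: huber_eq field_simps)
      have "0 \<le> t\<^sup>2 / (2 * a * b)" "t\<^sup>2 / (2 * a * b) \<le> 1"
        using a b \<open>t\<^sup>2 \<le> a * b\<close> by (auto simp: divide_le_eq mult.assoc)
          (smt (verit) mult_pos_pos)
      then show ?thesis
        unfolding eq using that
        by (simp add: abs_mult mult_left_le del: times_divide_eq_right)
    next
      case 3
      then have b: "0 < b" using that by auto
      have "t\<^sup>2 / (2 * b) \<le> t / 2"
        using 3 b by (simp add: power2_eq_square field_simps)
      moreover have "t - b / 2 \<le> t\<^sup>2 / (2 * b)"
        using b zero_le_square[of "t - b"] by (simp add: power2_eq_square field_simps)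
      ultimately show ?thesis
        using 3 that b by (auto simp: huber_eq abs_le_iff)
    qed (use that in \<open>auto simp: huber_eq\<close>)
  qed
  have "\<bar>huber (abs e) t - huber (abs e') t\<bar> \<le> \<bar>e - e'\<bar>"
  proof (cases "abs e \<le> abs e'")
    case True
    from *[OF abs_ge_zero this] show ?thesis by linarith
  next
    case False
    then have "abs e' \<le> abs e" by simp
    from *[OF abs_ge_zero this] show ?thesis by linarith
  qed
  then show ?thesis
    by (simp only: huber_abs)
qed

lemma Phi_lipschitz:
  fixes W W' :: "'n::finite sym_mat" and e e' :: real
  shows "norm (Phi e W - Phi e' W') \<le> norm (W - W') + CARD('n) * \<bar>e - e'\<bar>"
proof -
  have "norm (Phi e W - Phi e W') \<le> 1 * norm (W - W')"
    unfolding Phi_eq_spectral_fun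
  proof (rule spectral_fun_lipschitz)
    show "\<bar>huber e s - huber e t\<bar> \<le> 1 * \<bar>s - t\<bar>" for s t
      using huber_mono_nonexpansive[of t s e] huber_mono_nonexpansive[of s t e]
      by (cases "t \<le> s") auto
  qed simp
  moreover have "norm (Phi e W' - Phi e' W') \<le> CARD('n) * \<bar>e - e'\<bar>"
    unfolding Phi_eq_spectral_fun spectral_fun_diff [symmetric]
    by (rule norm_spectral_fun_le) (rule huber_smoothing_error)
  ultimately show ?thesis
    using norm_triangle_ineq[of "Phi e W - Phi e W'" "Phi e W' - Phi e' W'"] by simp
qed

lemma Phi_firmly_nonexpansive:
  "(norm (Phi e W - Phi e W'))\<^sup>2 \<le> (Phi e W - Phi e W') \<bullet> (W - W')"
  unfolding Phi_eq_spectral_fun by (rule spectral_fun_firmly_nonexpansive) (rule huber_firm)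

lemma Phi_zero_right: "Phi e (0 :: 'n::finite sym_mat) = 0"
proof -
  have P: "orthogonal_matrix (mat 1 :: real^'n^'n)"
    by (rule orthogonal_matrix_id)
  have "vec_map (huber e) (0 :: real^'n) = 0"
    by (simp add: vec_map_def vec_eq_iff huber_eq)
  then show ?thesis
    using spectral_fun_conj_diag[OF P, of "huber e" 0] by (simp add: Phi_eq_spectral_fun)
qed

lemma C1_on_Phi: "C1_on (\<lambda>(e, W :: 'n::finite sym_mat). Phi e W) {p. 0 < fst p}"
proof -
  let ?S = "{p :: real \<times> 'n sym_mat. 0 < fst p}"
  have fst: "C1_on fst ?S" and snd: "C1_on snd ?S"
    by (intro C1_on_bounded_linear bounded_linear_fst bounded_linear_snd)+
  have "C1_on (\<lambda>p. inverse (fst p) *\<^sub>R snd p) ?S"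
    by (intro C1_on_bilinear[OF bounded_bilinear_scaleR] C1_on_inverse fst snd) auto
  then have "C1_on (\<lambda>p. spectral_fun (huber 1) (inverse (fst p) *\<^sub>R snd p)) ?S"
    by (rule C1_on_compose[OF C1_on_spectral_fun_huber]) simp
  from C1_on_bilinear[OF bounded_bilinear_scaleR fst this] show ?thesis
    by (rule C1_on_cong_open) (auto simp: Phi_scale intro!: open_Collect_less continuous_intros)
qed

lemma continuous_on_Phi: "continuous_on UNIV (\<lambda>p. Phi (fst p) (snd p :: 'n::finite sym_mat))"
proof -
  have "isCont (\<lambda>p. Phi (fst p) (snd p :: 'n sym_mat)) (e, W)" for e W
  proof -
    have "isCont (\<lambda>p :: real \<times> 'n sym_mat. norm (snd p - W) + CARD('n) * \<bar>fst p - e\<bar>) (e, W)"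
      by (intro continuous_intros)
    then have "((\<lambda>p :: real \<times> 'n sym_mat. norm (snd p - W) + CARD('n) * \<bar>fst p - e\<bar>) \<longlongrightarrow> 0)
        (at (e, W))"
      by (simp add: isCont_def)
    moreover have "\<forall>\<^sub>F p in at (e, W). norm (Phi (fst p) (snd p) - Phi e W)
        \<le> norm (snd p - W) + CARD('n) * \<bar>fst p - e\<bar>"
      by (rule always_eventually) (simp add: Phi_lipschitz)
    ultimately have "((\<lambda>p. Phi (fst p) (snd p) - Phi e W) \<longlongrightarrow> 0) (at (e, W))"
      by (rule Lim_null_comparison[rotated])
    then show ?thesis
      by (simp add: isCont_def LIM_zero_iff)
  qed
  then show ?thesis
    by (intro continuous_at_imp_continuous_on) auto
qed

section \<open>The smoothed KKT map\<close>

context sdp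
begin

lemma bounded_linear_opA: "bounded_linear opA"
  unfolding linear_conv_bounded_linear [symmetric]
  by (rule linearI) (simp_all add: opA_def vec_eq_iff inner_simps)

lemma bounded_linear_adjA: "bounded_linear adjA"
  unfolding linear_conv_bounded_linear [symmetric]
  by (rule linearI) (simp_all add: adjA_def scaleR_sum_right scaleR_left_distrib sum.distrib)

lemmas opA_simps = bounded_linear.linear[OF bounded_linear_opA, THEN linear_add]
  bounded_linear.linear[OF bounded_linear_opA, THEN linear_diff]
  bounded_linear.linear[OF bounded_linear_opA, THEN linear_scale]
  bounded_linear.linear[OF bounded_linear_opA, THEN linear_0]

lemmas adjA_simps = bounded_linear.linear[OF bounded_linear_adjA, THEN linear_add]
  bounded_linear.linear[OF bounded_linear_adjA, THEN linear_diff]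
  bounded_linear.linear[OF bounded_linear_adjA, THEN linear_scale]
  bounded_linear.linear[OF bounded_linear_adjA, THEN linear_0]

end

locale regularized_sdp = smoothed_sdp A b C kappa_p kappa_c
  for A :: "'m::finite \<Rightarrow> 'n::finite sym_mat"
    and b :: "real^'m"
    and C :: "'n sym_mat"
    and kappa_p :: real
    and kappa_c :: real +
  assumes kappa_p_pos: "0 < kappa_p"
    and kappa_c_pos: "0 < kappa_c"
begin

lemma E_apply: "E (e, X, y, Z) = (opA X + (kappa_p * \<bar>e\<bar>) *\<^sub>R y - b, - adjA y - Z + C,
    (1 + kappa_c * \<bar>e\<bar>) *\<^sub>R X - Phi e (X - Z))"
  by (simp add: E_def)

text \<open>
  Let \<open>x\<close>, \<open>v\<close>, \<open>z\<close> be the increments of the arguments, \<open>V\<close> that of \<open>\<Phi>\<close>, and \<open>R\<^sub>1\<close>, \<open>R\<^sub>2\<close>, \<open>R\<^sub>3\<close> those of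
  the components of \<open>E\<close>. Firm nonexpansiveness says \<open>V \<bullet> (x - z - V) \<ge> 0\<close>. Eliminating \<open>V\<close> by the third
  component and \<open>x \<bullet> z\<close> by the first two leaves \<open>\<kappa>\<^sub>c \<epsilon> \<parallel>x\<parallel>\<^sup>2 + \<kappa>\<^sub>p \<epsilon> \<parallel>v\<parallel>\<^sup>2\<close>, bounded by the size of the
  \<open>R\<^sub>i\<close> times the size of the increments; the second component then bounds \<open>z\<close>.
\<close>

lemma E_coercive:
  assumes a: "0 < a"
  obtains c where "0 < c" "\<And>e u u'. a \<le> e \<Longrightarrow> c * norm (u - u') \<le> norm (E (e, u) - E (e, u'))"
proof -
  obtain M where M: "0 < M" "\<And>y. norm (adjA y) \<le> norm y * M"
    using bounded_linear.pos_bounded[OF bounded_linear_adjA] by blast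
  define m where "m = a * min kappa_c kappa_p"
  have m: "0 < m"
    using a kappa_p_pos kappa_c_pos by (simp add: m_def)
  define K where "K = 1 + 2 * (4 + M) / m"
  have K: "1 \<le> K"
    using m M(1) by (simp add: K_def)
  define L where "L = (1 + M) * K + 1"
  have L: "0 < L"
    using K M(1) by (simp add: L_def add_pos_pos)
  have bound: "norm (u - u') \<le> L * norm (E (e, u) - E (e, u'))" if e: "a \<le> e" for e u u'
  proof -
    obtain X y Z where u: "u = (X, y, Z)" by (cases u)
    obtain X' y' Z' where u': "u' = (X', y', Z')" by (cases u')
    define x v z where "x = X - X'" and "v = y - y'" and "z = Z - Z'"
    define V where "V = Phi e (X - Z) - Phi e (X' - Z')"
    define k p where "k = kappa_c * e" and "p = kappa_p * e"
    define R1 R2 R3 where "R1 = opA x + p *\<^sub>R v" and "R2 = - adjA v - z" and "R3 = (1 + k) *\<^sub>R x - V"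
    define q where "q = norm (E (e, u) - E (e, u'))"
    have e0: "0 < e" using a e by simp
    have R: "E (e, u) - E (e, u') = (R1, R2, R3)"
      using e0 unfolding u u' E_apply R1_def R2_def R3_def V_def x_def v_def z_def p_def k_def
      by (simp add: opA_simps adjA_simps algebra_simps)
    have q1: "norm R1 \<le> q" and q2: "norm R2 \<le> q" and q3: "norm R3 \<le> q"
      unfolding q_def R
      using norm_fst_le[of R1 "(R2, R3)"] norm_snd_le[of "(R2, R3)" R1]
        norm_fst_le[of R2 R3] norm_snd_le[of R3 R2] by auto
    have q0: "0 \<le> q" by (simp add: q_def)
    have mk: "m \<le> k"
    proof -
      have "m \<le> a * kappa_c" using a by (simp add: m_def)
      also have "\<dots> \<le> e * kappa_c" using e kappa_c_pos by simp
      finally show ?thesis by (simp add: k_def mult.commute)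
    qed
    have mp: "m \<le> p"
    proof -
      have "m \<le> a * kappa_p" using a by (simp add: m_def)
      also have "\<dots> \<le> e * kappa_p" using e kappa_p_pos by simp
      finally show ?thesis by (simp add: p_def mult.commute)
    qed
    have k0: "0 < k" using m mk by simp
    have xz: "x \<bullet> z = - (R1 \<bullet> v) + p * (v \<bullet> v) - x \<bullet> R2"
    proof -
      have "R1 \<bullet> v = x \<bullet> adjA v + p * (v \<bullet> v)"
        unfolding R1_def by (simp only: inner_simps inner_opA)
      moreover have "x \<bullet> R2 = - (x \<bullet> adjA v) - x \<bullet> z"
        unfolding R2_def by (simp only: inner_simps inner_minus_right)
      ultimately show ?thesis by simp
    qed
    have "0 \<le> V \<bullet> (x - z) - V \<bullet> V"
      using Phi_firmly_nonexpansive[of e "X - Z" "X' - Z'"]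
      by (simp add: V_def x_def z_def power2_norm_eq_inner algebra_simps)
    also have "\<dots> = V \<bullet> (x - z - V)"
      by (simp only: inner_diff_right)
    also have "\<dots> = ((1 + k) *\<^sub>R x - R3) \<bullet> (R3 - k *\<^sub>R x - z)"
      unfolding R3_def by (simp add: algebra_simps)
    also have "\<dots> = (1 + k) * (x \<bullet> R3) - (1 + k) * k * (x \<bullet> x) - (1 + k) * (x \<bullet> z)
        - R3 \<bullet> R3 + k * (x \<bullet> R3) + R3 \<bullet> z"
      by (simp only: inner_simps) (simp add: inner_commute algebra_simps)
    finally have nonneg: "0 \<le> \<dots>" .
    have "(1 + k) * (R1 \<bullet> v + x \<bullet> R2) + (1 + 2 * k) * (x \<bullet> R3) + R3 \<bullet> z
        = (1 + k) * (k * (x \<bullet> x) + p * (v \<bullet> v)) + R3 \<bullet> R3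
          + ((1 + k) * (x \<bullet> R3) - (1 + k) * k * (x \<bullet> x) - (1 + k) * (x \<bullet> z)
            - R3 \<bullet> R3 + k * (x \<bullet> R3) + R3 \<bullet> z)"
      unfolding xz by (simp add: algebra_simps)
    then have "(1 + k) * (k * (x \<bullet> x) + p * (v \<bullet> v))
        \<le> (1 + k) * (R1 \<bullet> v + x \<bullet> R2) + (1 + 2 * k) * (x \<bullet> R3) + R3 \<bullet> z"
      using nonneg inner_ge_zero[of R3] by linarith
    also have "\<dots> \<le> (1 + k) * (q * norm v + norm x * q) + (1 + 2 * k) * (norm x * q) + q * norm z"
    proof -
      have "R1 \<bullet> v \<le> q * norm v"
        by (rule order_trans[OF norm_cauchy_schwarz mult_right_mono[OF q1]]) simp
      moreover have "x \<bullet> R2 \<le> norm x * q"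
        by (rule order_trans[OF norm_cauchy_schwarz mult_left_mono[OF q2]]) simp
      moreover have "x \<bullet> R3 \<le> norm x * q"
        by (rule order_trans[OF norm_cauchy_schwarz mult_left_mono[OF q3]]) simp
      moreover have "R3 \<bullet> z \<le> q * norm z"
        by (rule order_trans[OF norm_cauchy_schwarz mult_right_mono[OF q3]]) simp
      ultimately show ?thesis
        using k0 by (intro add_mono mult_left_mono) auto
    qed
    also have "\<dots> \<le> (1 + k) * (q * (3 * norm x + norm v + norm z))"
      using k0 q0 by (simp add: algebra_simps)
    finally have "k * (x \<bullet> x) + p * (v \<bullet> v) \<le> q * (3 * norm x + norm v + norm z)"
      using k0 by simp
    moreover have "m * (x \<bullet> x) \<le> k * (x \<bullet> x)" "m * (v \<bullet> v) \<le> p * (v \<bullet> v)"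
      using mk mp by (intro mult_right_mono; simp)+
    ultimately have main: "m * ((norm x)\<^sup>2 + (norm v)\<^sup>2) \<le> q * (3 * norm x + norm v + norm z)"
      by (simp add: power2_norm_eq_inner algebra_simps)
    have z: "norm z \<le> M * norm v + q"
    proof -
      have "z = - adjA v - R2" by (simp add: R2_def)
      then have "norm z \<le> norm (adjA v) + norm R2"
        using norm_triangle_ineq4[of "- adjA v" R2] by simp
      then show ?thesis using M(2)[of v] q2 by (simp add: mult.commute)
    qed
    define S where "S = norm x + norm v"
    have S: "S \<le> K * q"
    proof (rule ccontr)
      assume "\<not> S \<le> K * q"
      then have KqS: "K * q < S" by simp
      then have qS: "q \<le> S" "0 < S"
        using K q0 mult_right_mono[OF K q0] by (auto intro: le_less_trans mult_nonneg_nonneg)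
      have "m * S\<^sup>2 \<le> 2 * (m * ((norm x)\<^sup>2 + (norm v)\<^sup>2))"
        using mult_left_mono[OF sum_squares_bound[of "norm x" "norm v"], of m] m
        by (simp add: S_def power2_sum algebra_simps)
      also have "\<dots> \<le> 2 * (q * (3 * norm x + norm v + norm z))"
        using main by simp
      also have "\<dots> \<le> 2 * (q * ((4 + M) * S))"
      proof -
        have "3 * norm x + norm v + norm z \<le> 3 * norm x + norm v + M * norm v + S"
          using z qS by simp
        also have "\<dots> \<le> (4 + M) * S"
          using M(1) by (simp add: S_def algebra_simps)
        finally show ?thesis
          using q0 by (intro mult_left_mono) auto
      qed
      finally have "m * S * S \<le> 2 * (4 + M) * q * S"
        by (simp add: power2_eq_square algebra_simps)
      then have "m * S \<le> 2 * (4 + M) * q"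
        using qS(2) by simp
      then have "S \<le> 2 * (4 + M) / m * q"
        using m by (simp add: field_simps)
      then show False
        using KqS q0 by (simp add: K_def algebra_simps)
    qed
    have "norm (u - u') \<le> norm x + (norm v + norm z)"
      unfolding u u' x_def v_def z_def
      by (simp) (meson norm_Pair_le add_left_mono order_trans)
    also have "\<dots> \<le> S + M * S + q"
    proof -
      have "M * norm v \<le> M * S"
        using M(1) by (intro mult_left_mono) (auto simp: S_def)
      then show ?thesis
        using z by (simp add: S_def)
    qed
    also have "\<dots> = (1 + M) * S + q"
      by (simp add: algebra_simps)
    also have "\<dots> \<le> (1 + M) * (K * q) + q"
      using S M(1) by (intro add_right_mono mult_left_mono) auto
    also have "\<dots> = L * q"
      by (simp add: L_def algebra_simps)
    finally show ?thesis by (simp add: q_def)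
  qed
  show ?thesis
  proof (rule that[of "1 / L"])
    show "1 / L * norm (u - u') \<le> norm (E (e, u) - E (e, u'))" if "a \<le> e" for e u u'
      using bound[OF that, of u u'] L by (simp add: field_simps)
  qed (use L in simp)
qed

lemma C1_on_E: "C1_on E {w. 0 < fst w}"
proof -
  let ?S = "{w :: ('n, 'm) point. 0 < fst w}"
  have e: "C1_on (\<lambda>w. fst w) ?S" and X: "C1_on (\<lambda>w. fst (snd w)) ?S"
    and y: "C1_on (\<lambda>w. fst (snd (snd w))) ?S" and Z: "C1_on (\<lambda>w. snd (snd (snd w))) ?S"
    by (intro C1_on_bounded_linear bounded_linear_intros)+
  note lin = C1_on_compose[OF C1_on_bounded_linear, where T = UNIV]
  note opp = lin[OF bounded_linear_minus[OF bounded_linear_ident]]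
  have 1: "C1_on (\<lambda>w. opA (fst (snd w)) + ((kappa_p * fst w) *\<^sub>R fst (snd (snd w)) + (- b))) ?S"
    by (intro C1_on_add C1_on_const lin[OF bounded_linear_opA] X y
        C1_on_bilinear[OF bounded_bilinear_scaleR] lin[OF bounded_linear_mult_right] e) auto
  have 2: "C1_on (\<lambda>w. (- adjA (fst (snd (snd w)))) + ((- snd (snd (snd w))) + C)) ?S"
    by (intro C1_on_add C1_on_const opp lin[OF bounded_linear_adjA] y Z) auto
  have "C1_on (\<lambda>w. fst (snd w) + (- snd (snd (snd w)))) ?S"
    by (intro C1_on_add X opp Z) auto
  from C1_on_compose[OF C1_on_Phi C1_on_Pair[OF e this]]
  have Phi: "C1_on (\<lambda>w. Phi (fst w) (fst (snd w) + (- snd (snd (snd w))))) ?S"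
    by auto
  have 3: "C1_on (\<lambda>w. (1 + kappa_c * fst w) *\<^sub>R fst (snd w)
      + (- Phi (fst w) (fst (snd w) + (- snd (snd (snd w)))))) ?S"
    by (intro C1_on_add C1_on_const C1_on_bilinear[OF bounded_bilinear_scaleR] X
        lin[OF bounded_linear_mult_right] e opp Phi) auto
  show ?thesis
    using C1_on_Pair[OF 1 C1_on_Pair[OF 2 3]]
    by (rule C1_on_cong_open) (auto simp: E_def intro!: open_Collect_less continuous_intros)
qed

lemma continuous_on_Ehat: "continuous_on UNIV Ehat"
proof -
  note lin = bounded_linear.continuous_on
  have "continuous_on UNIV (\<lambda>w :: ('n, 'm) point. Phi (fst w) (fst (snd w) - snd (snd (snd w))))"
    using continuous_on_compose2[OF continuous_on_Phi,
        of UNIV "\<lambda>w. (fst w, fst (snd w) - snd (snd (snd w)))"]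
    by (simp add: continuous_intros)
  then have "continuous_on UNIV (\<lambda>w. (fst w, opA (fst (snd w)) + (kappa_p * \<bar>fst w\<bar>) *\<^sub>R fst (snd (snd w)) - b,
      - adjA (fst (snd (snd w))) - snd (snd (snd w)) + C,
      (1 + kappa_c * \<bar>fst w\<bar>) *\<^sub>R fst (snd w) - Phi (fst w) (fst (snd w) - snd (snd (snd w)))))"
    by (intro continuous_intros lin[OF bounded_linear_opA] lin[OF bounded_linear_adjA])
  then show ?thesis
    by (simp add: Ehat_def[abs_def] E_def split_beta)
qed

end

section \<open>Newton directions\<close>

context regularized_sdp
begin

lemma E_has_derivative:
  assumes "0 < fst w"
  shows "(E has_derivative frechet_derivative E (at w)) (at w)"
proof -
  have "E differentiable (at w)"
    using C1_on_E assms unfolding C1_on_def by blast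
  then show ?thesis
    by (simp add: frechet_derivative_works)
qed

lemma derivative_coercive:
  assumes a: "0 < a"
  obtains c where "0 < c" "\<And>w u. a \<le> fst w \<Longrightarrow> c * norm u \<le> norm (frechet_derivative E (at w) (0, u))"
proof -
  obtain c where c: "0 < c" "\<And>e u u'. a \<le> e \<Longrightarrow> c * norm (u - u') \<le> norm (E (e, u) - E (e, u'))"
    using E_coercive[OF a] by blast
  have "c * norm u \<le> norm (frechet_derivative E (at w) (0, u))" if w: "a \<le> fst w" for w u
  proof (rule norm_derivative_ge[OF E_has_derivative, of _ 1])
    show "0 < fst w" using a w by simp
    fix t :: real assume t: "0 < t"
    show "c * norm u * t \<le> norm (E (w + t *\<^sub>R (0, u)) - E w)"
      using c(2)[OF w, of "snd w + t *\<^sub>R u" "snd w"] t by (cases w) (simp add: mult_ac)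
  qed simp
  then show ?thesis
    using that c(1) by blast
qed

text \<open>
  The coefficient map is injective, and its domain and codomain have the same dimension.
\<close>

lemma newton_system_solvable:
  assumes w: "0 < fst w"
  obtains u where "frechet_derivative E (at w) (0, u) = v"
proof -
  let ?D = "frechet_derivative E (at w)"
  have lin: "linear ?D"
    using has_derivative_linear[OF E_has_derivative[OF w]] .
  obtain c where c: "0 < c" "\<And>u. c * norm u \<le> norm (?D (0, u))"
    using derivative_coercive[OF w] by (metis order_refl)
  have lin0: "linear (\<lambda>u. ?D (0, u))"
    using linear_compose[OF bounded_linear.linear[OF bounded_linear_Pair[OF bounded_linear_zero
            bounded_linear_ident]] lin]
    by (simp add: o_def)
  moreover have "inj (\<lambda>u. ?D (0, u))"
  proof (rule linear_injective_0[OF lin0, THEN iffD2], intro allI impI)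
    fix u assume "?D (0, u) = 0"
    then have "c * norm u \<le> 0"
      using c(2)[of u] by simp
    then show "u = 0"
      using c(1) by (simp add: mult_le_0_iff)
  qed
  ultimately have "surj (\<lambda>u. ?D (0, u))"
    by (rule linear_injective_imp_surjective) simp
  then obtain u where "v = ?D (0, u)"
    by (rule surjE)
  then show ?thesis using that by simp
qed

end

locale regularized_ssn = ssn A b C kappa_p kappa_c eps_hat r r_hat eta_hat \<rho> \<sigma> \<tau>
    + regularized_sdp A b C kappa_p kappa_c
  for A :: "'m::finite \<Rightarrow> 'n::finite sym_mat"
    and b :: "real^'m"
    and C :: "'n sym_mat"
    and kappa_p kappa_c eps_hat r r_hat eta_hat \<rho> \<sigma> \<tau> :: real +
  assumes eps_hat: "0 < eps_hat" and r: "0 < r" "r < 1" and r_hat: "0 < r_hat"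
    and eta_hat: "0 < eta_hat" "eta_hat < 1" and delta: "\<delta> < 1"
    and rho: "0 < \<rho>" "\<rho> < 1" and sigma: "0 < \<sigma>" "\<sigma> < 1/2" and tau: "0 < \<tau>"
begin

lemma delta_pos: "0 < \<delta>"
  using eta_hat by (simp add: \<delta>_def less_max_iff_disj)

lemma norm_Ehat_pos: "0 < fst w \<Longrightarrow> 0 < norm (Ehat w)"
  by (auto simp: Ehat_def prod_eq_iff)

text \<open>
  The exponent \<open>1 + \<tau>\<close> exceeds 1, so the power is at most the norm itself as long as the norm is at
  most 1, and beyond that the minimum takes over.
\<close>

lemma zeta_le: "zeta w * eps_hat \<le> r * eps_hat * norm (Ehat w)"
proof -
  let ?N = "norm (Ehat w)"
  have "min 1 (?N powr (1 + \<tau>)) \<le> ?N"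
  proof (cases "?N \<le> 1")
    case True
    then have "?N powr (1 + \<tau>) \<le> ?N powr 1"
      using tau by (intro powr_mono') auto
    then show ?thesis by simp
  qed simp
  then show ?thesis
    using r eps_hat by (simp add: zeta_def mult_ac)
qed

lemma zeta_nonneg: "0 \<le> zeta w" and zeta_le_r: "zeta w \<le> r"
  using r by (simp_all add: zeta_def mult_left_le)

lemma zeta_pos: "Ehat w \<noteq> 0 \<Longrightarrow> 0 < zeta w"
  using r by (simp add: zeta_def)

lemma zeta_mono: "norm (Ehat w) \<le> norm (Ehat w') \<Longrightarrow> zeta w \<le> zeta w'"
  unfolding zeta_def using r tau
  by (intro mult_left_mono min.mono powr_mono2) auto

text \<open>
  The exact solution of the Newton system has residual zero and is therefore admissible.
\<close>

lemma newton_direction_exists: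
  assumes w: "0 < fst w"
  shows "\<exists>dw. newton_direction w dw"
proof -
  let ?D = "frechet_derivative E (at w)"
  define de where "de = - fst w + zeta w * eps_hat"
  obtain u where u: "?D (0, u) = - E w - ?D (de, 0)"
    using newton_system_solvable[OF w] by blast
  have "?D (de, u) = ?D (de, 0) + ?D (0, u)"
    using linear_add[OF has_derivative_linear[OF E_has_derivative[OF w]], of "(de, 0)" "(0, u)"]
    by simp
  then have "E w + ?D (de, u) = 0"
    using u by simp
  moreover have "0 \<le> eta w"
    using r_hat by (simp add: eta_def)
  ultimately have "newton_direction w (de, u)"
    using E_has_derivative[OF w] eta_hat
    by (auto simp: newton_direction_def de_def differentiable_def)
  then show ?thesis ..
qed

text \<open>
  The \<open>\<epsilon>\<close>-component is explicit, and coercivity of the derivative bounds the others by the right-hand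
  side of the Newton system.
\<close>

lemma newton_direction_bounded:
  assumes K: "compact K" "\<And>w. w \<in> K \<Longrightarrow> a \<le> fst w" and a: "0 < a"
  obtains M where "0 < M" "\<And>w dw. w \<in> K \<Longrightarrow> newton_direction w dw \<Longrightarrow> norm dw \<le> M"
proof -
  obtain c where c: "0 < c"
    "\<And>w u. a \<le> fst w \<Longrightarrow> c * norm u \<le> norm (frechet_derivative E (at w) (0, u))"
    using derivative_coercive[OF a] by blast
  have "compact (Ehat ` K)"
    using K(1) continuous_on_subset[OF continuous_on_Ehat] by (intro compact_continuous_image) auto
  from compact_imp_bounded[OF this] obtain B1 where B1: "\<And>w. w \<in> K \<Longrightarrow> norm (Ehat w) \<le> B1"
    unfolding bounded_iff by fast
  have "continuous_on K (\<lambda>w. frechet_derivative E (at w) (1, 0))"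
  proof (rule continuous_on_subset)
    show "continuous_on {w. 0 < fst w} (\<lambda>w. frechet_derivative E (at w) (1, 0))"
      using C1_on_E unfolding C1_on_def by blast
    show "K \<subseteq> {w. 0 < fst w}"
      using K(2) a by force
  qed
  then have "compact ((\<lambda>w. frechet_derivative E (at w) (1, 0)) ` K)"
    using K(1) by (rule compact_continuous_image)
  from compact_imp_bounded[OF this] obtain B2 where B2: "\<And>w. w \<in> K \<Longrightarrow> norm (frechet_derivative E (at w) (1, 0)) \<le> B2"
    unfolding bounded_iff by fast
  define Me where "Me = B1 + eps_hat"
  define M where "M = Me + (2 * B1 + Me * B2) / c"
  have bound: "norm dw \<le> M" if w: "w \<in> K" and nd: "newton_direction w dw" for w dw
  proof -
    let ?D = "frechet_derivative E (at w)"
    obtain de u where dw: "dw = (de, u)" by (cases dw)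
    have w0: "0 < fst w" using K(2)[OF w] a by simp
    have lin: "linear ?D"
      using has_derivative_linear[OF E_has_derivative[OF w0]] .
    have B1': "norm (E w) \<le> B1" "\<bar>fst w\<bar> \<le> B1"
      using B1[OF w] norm_snd_le[of "E w" "fst w"] norm_fst_le[of "fst w" "E w"]
      by (auto simp: Ehat_def)
    have "de = - fst w + zeta w * eps_hat"
      using nd by (simp add: newton_direction_def dw)
    moreover have "zeta w * eps_hat \<le> 1 * eps_hat"
      using zeta_le_r[of w] r eps_hat by (intro mult_right_mono) auto
    moreover have "0 \<le> zeta w * eps_hat"
      using zeta_nonneg eps_hat by simp
    ultimately have de: "\<bar>de\<bar> \<le> Me"
      using B1' by (simp add: Me_def)
    define R where "R = E w + ?D dw"
    have "norm R \<le> eta_hat * norm (Ehat w)"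
      using nd by (simp add: newton_direction_def R_def)
    also have "\<dots> \<le> 1 * norm (Ehat w)"
      using eta_hat by (intro mult_right_mono) auto
    finally have R: "norm R \<le> B1"
      using B1[OF w] by simp
    have "?D dw = de *\<^sub>R ?D (1, 0) + ?D (0, u)"
      using linear_add[OF lin, of "(de, 0)" "(0, u)"] linear_scale[OF lin, of de "(1, 0)"]
      by (simp add: dw)
    then have "?D (0, u) = R - E w - de *\<^sub>R ?D (1, 0)"
      by (simp add: R_def)
    then have "norm (?D (0, u)) \<le> norm R + norm (E w) + \<bar>de\<bar> * norm (?D (1, 0))"
      using norm_triangle_ineq4[of "R - E w" "de *\<^sub>R ?D (1, 0)"] norm_triangle_ineq4[of R "E w"]
      by simp
    also have "\<dots> \<le> B1 + B1 + Me * B2"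
      using R B1' de B2[OF w] by (intro add_mono mult_mono) auto
    finally have "c * norm u \<le> 2 * B1 + Me * B2"
      using c(2)[OF K(2)[OF w], of u] by simp
    then have "norm u \<le> (2 * B1 + Me * B2) / c"
      using c(1) by (simp add: field_simps)
    then show ?thesis
      using norm_Pair_le[of de u] de by (simp add: dw M_def)
  qed
  show ?thesis
    using bound by (intro that[of "max M 1"]) force+
qed

section \<open>Line search and convergence of the residuals\<close>

text \<open>
  The linear model of \<open>Ehat\<close> along an admissible direction is \<open>(1 - t) Ehat(w) + t (\<zeta> \<epsilon>\<^sub>0, R)\<close>, where
  \<open>\<epsilon>\<^sub>0\<close> stands for \<open>eps_hat\<close>, and the second vector has norm at most \<open>\<delta> \<parallel>Ehat(w)\<parallel>\<close>; so the norm shrinks by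
  the factor \<open>1 - t (1 - \<delta>)\<close>. For small \<open>t\<close>, uniformly on \<open>K\<close>, the linearization error consumes at
  most a quarter of this gain, and the rest suffices because \<open>\<sigma> < 1/2\<close>.
\<close>

lemma line_search_uniform:
  assumes K: "compact K" "\<And>w. w \<in> K \<Longrightarrow> a \<le> fst w" and a: "0 < a"
  obtains s where "0 < s" "\<And>w dw t. w \<in> K \<Longrightarrow> newton_direction w dw \<Longrightarrow> 0 < t \<Longrightarrow> t \<le> s \<Longrightarrow>
    psi (w + t *\<^sub>R dw) \<le> (1 - 2 * \<sigma> * (1 - \<delta>) * t) * psi w"
proof -
  obtain M where M: "0 < M" "\<And>w dw. w \<in> K \<Longrightarrow> newton_direction w dw \<Longrightarrow> norm dw \<le> M"
    using newton_direction_bounded[OF K a] by blast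
  define \<beta> where "\<beta> = 1 - \<delta>"
  have \<beta>: "0 < \<beta>" "\<beta> < 1"
    using delta delta_pos by (auto simp: \<beta>_def)
  \<comment> \<open>Since \<open>a\<close> bounds the residual norm from below, this \<open>e\<close> makes the linearization error at most
    \<open>t \<beta> / 4\<close> times the residual norm.\<close>
  define e where "e = \<beta> / 4 * a / M"
  have e: "0 < e"
    using \<beta> a M(1) by (simp add: e_def)
  have "K \<subseteq> {w. 0 < fst w}"
    using K(2) a by force
  moreover have "open {w :: ('n, 'm) point. 0 < fst w}"
    by (intro open_Collect_less continuous_intros)
  ultimately obtain d where d: "0 < d" "\<And>w h. w \<in> K \<Longrightarrow> norm h < d \<Longrightarrow>
      norm (E (w + h) - E w - frechet_derivative E (at w) h) \<le> e * norm h"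
    using C1_on_uniform_linearization[OF C1_on_E _ K(1) _ e] by metis
  define s where "s = min (1/2) (d / (2 * M))"
  show ?thesis
  proof (rule that[of s])
    show "0 < s" using d(1) M(1) by (simp add: s_def)
    fix w dw and t :: real assume w: "w \<in> K" and nd: "newton_direction w dw" and t: "0 < t" "t \<le> s"
    let ?D = "frechet_derivative E (at w)" and ?N = "norm (Ehat w)"
    have w0: "0 < fst w" using K(2)[OF w] a by simp
    have lin: "linear ?D"
      using has_derivative_linear[OF E_has_derivative[OF w0]] .
    have "t * norm dw \<le> t * M"
      using M(2)[OF w nd] t by simp
    also have "\<dots> \<le> d / (2 * M) * M"
      using t M(1) by (intro mult_right_mono) (auto simp: s_def)
    also have "\<dots> < d"
      using d(1) M(1) by simp
    finally have small: "norm (t *\<^sub>R dw) < d"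
      using t by simp
    define R where "R = E w + ?D dw"
    define rem where "rem = E (w + t *\<^sub>R dw) - E w - ?D (t *\<^sub>R dw)"
    have aN: "a \<le> ?N"
      using K(2)[OF w] a norm_fst_le[of "fst w" "E w"] by (simp add: Ehat_def)
    have "norm rem \<le> e * norm (t *\<^sub>R dw)"
      unfolding rem_def by (rule d(2)[OF w small])
    also have "\<dots> \<le> e * (t * M)"
      using M(2)[OF w nd] t e by (intro mult_left_mono) auto
    also have "\<dots> = t * (\<beta> / 4) * a"
      using M(1) by (simp add: e_def)
    also have "\<dots> \<le> t * (\<beta> / 4) * ?N"
      using aN t \<beta> by (intro mult_left_mono) auto
    finally have rem: "norm rem \<le> t * (\<beta> / 4) * ?N" .
    have R: "norm (zeta w * eps_hat, R) \<le> \<delta> * ?N"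
    proof -
      let ?m = "max (r * eps_hat) eta_hat"
      have "\<bar>zeta w * eps_hat\<bar> \<le> ?m * ?N"
      proof -
        have "zeta w * eps_hat \<le> ?m * ?N"
          by (rule order_trans[OF zeta_le]) (intro mult_right_mono, auto)
        moreover have "0 \<le> zeta w * eps_hat"
          using zeta_nonneg[of w] eps_hat by simp
        ultimately show ?thesis by (simp only: abs_of_nonneg)
      qed
      moreover have "norm R \<le> ?m * ?N"
      proof -
        have "eta_hat * ?N \<le> ?m * ?N"
          by (intro mult_right_mono) auto
        then show ?thesis
          using nd by (simp add: newton_direction_def R_def)
      qed
      ultimately have "(zeta w * eps_hat)\<^sup>2 + (norm R)\<^sup>2 \<le> (?m * ?N)\<^sup>2 + (?m * ?N)\<^sup>2"
        using power_mono[of "\<bar>zeta w * eps_hat\<bar>" "?m * ?N" 2] power_mono[of "norm R" "?m * ?N" 2]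
        by (intro add_mono) (simp_all only: power2_abs abs_ge_zero norm_ge_zero)
      also have "\<dots> = (\<delta> * ?N)\<^sup>2"
        by (simp add: \<delta>_def power_mult_distrib)
      finally have "norm (zeta w * eps_hat, R) \<le> sqrt ((\<delta> * ?N)\<^sup>2)"
        unfolding norm_Pair real_norm_def power2_abs by (rule real_sqrt_le_mono)
      then show ?thesis
        using delta_pos by simp
    qed
    have "E (w + t *\<^sub>R dw) = (1 - t) *\<^sub>R E w + t *\<^sub>R R + rem"
      by (simp add: rem_def R_def linear_scale[OF lin] algebra_simps)
    moreover have "fst (w + t *\<^sub>R dw) = (1 - t) * fst w + t * (zeta w * eps_hat)"
    proof -
      have fst_dw: "fst dw = - fst w + zeta w * eps_hat"
        using nd by (simp add: newton_direction_def)
      show ?thesis by (simp add: fst_dw algebra_simps)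
    qed
    ultimately have eq: "Ehat (w + t *\<^sub>R dw)
        = (1 - t) *\<^sub>R Ehat w + t *\<^sub>R (zeta w * eps_hat, R) + (0, rem)"
      by (simp add: Ehat_def)
    have "norm (Ehat (w + t *\<^sub>R dw))
        \<le> norm ((1 - t) *\<^sub>R Ehat w) + norm (t *\<^sub>R (zeta w * eps_hat, R)) + norm (0 :: real, rem)"
      unfolding eq
      using norm_triangle_ineq[of "(1 - t) *\<^sub>R Ehat w + t *\<^sub>R (zeta w * eps_hat, R)" "(0, rem)"]
        norm_triangle_ineq[of "(1 - t) *\<^sub>R Ehat w" "t *\<^sub>R (zeta w * eps_hat, R)"]
      by linarith
    also have "\<dots> \<le> (1 - t) * ?N + t * (\<delta> * ?N) + t * (\<beta> / 4) * ?N"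
    proof (intro add_mono)
      show "norm ((1 - t) *\<^sub>R Ehat w) \<le> (1 - t) * ?N"
        using t by (simp add: s_def)
      show "norm (t *\<^sub>R (zeta w * eps_hat, R)) \<le> t * (\<delta> * ?N)"
        unfolding norm_scaleR using mult_left_mono[OF R, of t] t by simp
      show "norm (0 :: real, rem) \<le> t * (\<beta> / 4) * ?N"
        using rem by (simp add: norm_Pair)
    qed
    also have "\<dots> = (1 - 3 / 4 * \<beta> * t) * ?N"
      by (simp add: \<beta>_def field_simps)
    finally have "psi (w + t *\<^sub>R dw) \<le> ((1 - 3 / 4 * \<beta> * t) * ?N)\<^sup>2"
      unfolding psi_def by (rule power_mono) simp
    also have "\<dots> = (1 - 3 / 4 * \<beta> * t)\<^sup>2 * psi w"
      by (simp add: psi_def power_mult_distrib)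
    also have "\<dots> \<le> (1 - 2 * \<sigma> * (1 - \<delta>) * t) * psi w"
    proof (rule mult_right_mono)
      have bt: "\<beta> * t \<le> 1 / 2" "0 < \<beta> * t"
        using mult_mono[of \<beta> 1 t "1/2"] \<beta> t by (auto simp: s_def)
      have "(\<beta> * t) * (\<beta> * t) \<le> 1 / 2 * (\<beta> * t)"
        using bt by (intro mult_right_mono) auto
      moreover have "2 * \<sigma> * (\<beta> * t) \<le> 1 * (\<beta> * t)"
        using bt sigma by (intro mult_right_mono) auto
      ultimately have "(1 - 3 / 4 * (\<beta> * t))\<^sup>2 \<le> 1 - 2 * \<sigma> * (\<beta> * t)"
      proof -
        have "(1 - 3 / 4 * x)\<^sup>2 = 1 - 3 / 2 * x + 9 / 16 * (x * x)" for x :: real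
          by (simp add: power2_eq_square field_simps)
        then show ?thesis
          using \<open>(\<beta> * t) * (\<beta> * t) \<le> 1 / 2 * (\<beta> * t)\<close> \<open>2 * \<sigma> * (\<beta> * t) \<le> 1 * (\<beta> * t)\<close> bt
          by simp
      qed
      then show "(1 - 3 / 4 * \<beta> * t)\<^sup>2 \<le> 1 - 2 * \<sigma> * (1 - \<delta>) * t"
        unfolding \<beta>_def [symmetric] by (simp only: mult.assoc)
    qed (simp add: psi_def)
    finally show "psi (w + t *\<^sub>R dw) \<le> (1 - 2 * \<sigma> * (1 - \<delta>) * t) * psi w" .
  qed
qed

lemma line_search_terminates:
  assumes w: "0 < fst w" and nd: "newton_direction w dw"
  shows "\<exists>l. line_search w dw l"
proof -
  obtain s where s: "0 < s" "\<And>t. 0 < t \<Longrightarrow> t \<le> s \<Longrightarrow>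
      psi (w + t *\<^sub>R dw) \<le> (1 - 2 * \<sigma> * (1 - \<delta>) * t) * psi w"
    using line_search_uniform[of "{w}" "fst w"] w nd by (metis compact_sing order_refl singletonD singletonI)
  obtain l where "\<rho> ^ l < s"
    using real_arch_pow_inv[OF s(1) rho(2)] by blast
  then have "line_search w dw l"
    unfolding line_search_def using rho by (intro s(2)) auto
  then show ?thesis ..
qed

text \<open>
  The new \<open>\<epsilon>\<close> is a convex combination of the old one and \<open>\<zeta>(w) \<epsilon>\<^sub>0\<close>, where \<open>\<epsilon>\<^sub>0\<close> stands for
  \<open>eps_hat\<close>, hence at least \<open>\<zeta>(w) \<epsilon>\<^sub>0\<close>; and \<open>\<zeta>\<close> does not increase because the residual does not.
\<close>

lemma ssn_step_invariant:
  assumes step: "ssn_step w w'" and w: "0 < fst w" "w \<in> nbhd"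
  shows "0 < fst w'" "w' \<in> nbhd" "psi w' \<le> psi w"
proof -
  obtain dw l where nz: "Ehat w \<noteq> 0" and nd: "newton_direction w dw" and ls: "line_search w dw l"
    and w': "w' = w + \<rho> ^ l *\<^sub>R dw"
    using step by (auto simp: ssn_step_def)
  let ?t = "\<rho> ^ l"
  have t: "0 < ?t" "?t \<le> 1"
    using rho by (auto intro: power_le_one)
  have "(1 - 2 * \<sigma> * (1 - \<delta>) * ?t) * psi w \<le> 1 * psi w"
    using sigma delta t by (intro mult_right_mono) (auto simp: psi_def)
  then show psi: "psi w' \<le> psi w"
    using ls by (simp add: line_search_def w')
  have fst_dw: "fst dw = - fst w + zeta w * eps_hat"
    using nd by (simp add: newton_direction_def)
  have "fst w' = (1 - ?t) * fst w + ?t * (zeta w * eps_hat)"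
    by (simp add: w' fst_dw algebra_simps)
  also have "(1 - ?t) * fst w + ?t * (zeta w * eps_hat)
      \<ge> (1 - ?t) * (zeta w * eps_hat) + ?t * (zeta w * eps_hat)"
    using w(2) t by (intro add_right_mono mult_left_mono) (auto simp: nbhd_def)
  finally have fst: "zeta w * eps_hat \<le> fst w'"
    by (simp add: algebra_simps)
  then show "0 < fst w'"
    using zeta_pos[OF nz] eps_hat by (meson less_le_trans mult_pos_pos)
  have "norm (Ehat w') \<le> norm (Ehat w)"
    using psi by (simp add: psi_def)
  then have "zeta w' * eps_hat \<le> zeta w * eps_hat"
    using eps_hat by (intro mult_right_mono zeta_mono) auto
  then show "w' \<in> nbhd"
    using fst by (simp add: nbhd_def)
qed

lemma ssn_iterate_invariant: "ssn_iterate w \<Longrightarrow> 0 < fst w \<and> w \<in> nbhd"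
proof (induction rule: ssn_iterate.induct)
  case (start X0 y0 Z0)
  have "zeta (eps_hat, X0, y0, Z0) * eps_hat \<le> 1 * eps_hat"
    using zeta_le_r[of "(eps_hat, X0, y0, Z0)"] r eps_hat by (intro mult_right_mono) auto
  then show ?case
    using eps_hat by (simp add: nbhd_def)
next
  case (step w w')
  then show ?case using ssn_step_invariant by blast
qed

theorem ssn_well_defined: "well_defined"
  unfolding well_defined_def
  using ssn_iterate_invariant newton_direction_exists line_search_terminates by blast

lemma Ehat_iterate_nonzero: "ssn_iterate w \<Longrightarrow> Ehat w \<noteq> 0"
  using ssn_iterate_invariant[of w] norm_Ehat_pos[of w] by (simp del: split_paired_All split_paired_Ex)

lemma ssn_step_exists:
  assumes "ssn_iterate w"
  shows "\<exists>w'. ssn_step w w'"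
proof -
  have w: "0 < fst w" using ssn_iterate_invariant[OF assms] by simp
  obtain dw where dw: "newton_direction w dw"
    using newton_direction_exists[OF w] by blast
  obtain l where l: "line_search w dw l"
    using line_search_terminates[OF w dw] by blast
  let ?l = "LEAST l. line_search w dw l"
  have "line_search w dw ?l" "\<forall>l'<?l. \<not> line_search w dw l'"
    using LeastI[of "line_search w dw", OF l] not_less_Least by auto
  then show ?thesis
    using dw Ehat_iterate_nonzero[OF assms] unfolding ssn_step_def by blast
qed

theorem ssn_sequence_exists: "\<exists>w. ssn_sequence u0 w"
proof -
  have "\<exists>w. \<forall>k. (ssn_iterate (w k) \<and> (k = 0 \<longrightarrow> w k = (eps_hat, u0))) \<and> ssn_step (w k) (w (Suc k))"
  proof (rule dependent_nat_choice)
    show "\<exists>w. ssn_iterate w \<and> (0 = 0 \<longrightarrow> w = (eps_hat, u0))"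
      by (cases u0) (auto intro: ssn_iterate.start)
    show "\<exists>w'. (ssn_iterate w' \<and> (Suc k = 0 \<longrightarrow> w' = (eps_hat, u0))) \<and> ssn_step w w'"
      if "ssn_iterate w \<and> (k = 0 \<longrightarrow> w = (eps_hat, u0))" for w k
      using ssn_step_exists that ssn_iterate.step by blast
  qed
  then show ?thesis
    by (auto simp: ssn_sequence_def)
qed

lemma ssn_sequence_iterate:
  assumes "ssn_sequence u0 w"
  shows "ssn_iterate (w k)"
proof (induction k)
  case 0
  then show ?case
    using assms by (cases u0) (auto simp: ssn_sequence_def intro: ssn_iterate.start)
next
  case (Suc k)
  then show ?case
    using assms ssn_iterate.step by (auto simp: ssn_sequence_def)
qed

text \<open>
  Otherwise the residuals stay above some \<open>m > 0\<close>. Then \<open>\<zeta>\<close>, and with it \<open>\<epsilon>\<close>, is bounded below along the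
  run; coercivity, used against the point \<open>0\<close>, where the value of \<open>E\<close> does not depend on \<open>\<epsilon>\<close>, confines
  the iterates to a compact set. There the line search accepts a step length bounded below, so that
  \<open>psi\<close> decreases geometrically.
\<close>

theorem ssn_sequence_residual_tendsto_zero:
  assumes seq: "ssn_sequence u0 w"
  shows "(\<lambda>k. norm (Ehat (w k))) \<longlonglongrightarrow> 0"
proof (rule ccontr)
  assume contr: "\<not> (\<lambda>k. norm (Ehat (w k))) \<longlonglongrightarrow> 0"
  let ?N = "\<lambda>k. norm (Ehat (w k))"
  have inv: "0 < fst (w k)" "w k \<in> nbhd" for k
    using ssn_iterate_invariant[OF ssn_sequence_iterate[OF seq]] by auto
  have step: "ssn_step (w k) (w (Suc k))" for k
    using seq by (simp add: ssn_sequence_def)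
  have "?N (Suc k) \<le> ?N k" for k
    using ssn_step_invariant(3)[OF step inv] by (simp add: psi_def)
  then have dec: "decseq ?N"
    by (rule decseq_SucI)
  have "\<exists>m>0. \<forall>k. m \<le> ?N k"
  proof (rule ccontr)
    assume no: "\<not> (\<exists>m>0. \<forall>k. m \<le> ?N k)"
    have "?N \<longlonglongrightarrow> 0"
    proof (rule LIMSEQ_I)
      fix e :: real assume "0 < e"
      then obtain k0 where "?N k0 < e"
        using no by (meson not_le)
      then show "\<exists>k0. \<forall>k\<ge>k0. norm (?N k - 0) < e"
        using decseqD[OF dec] by (intro exI[of _ k0]) (auto intro: le_less_trans)
    qed
    then show False using contr by blast
  qed
  then obtain m where m: "0 < m" "\<And>k. m \<le> ?N k"
    by blast
  define a where "a = r * min 1 (m powr (1 + \<tau>)) * eps_hat"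
  have a: "0 < a"
    using m(1) r eps_hat by (simp add: a_def)
  have fst_ge: "a \<le> fst (w k)" for k
  proof -
    have "a \<le> zeta (w k) * eps_hat"
      unfolding a_def zeta_def using m r tau eps_hat
      by (intro mult_right_mono mult_left_mono min.mono powr_mono2) auto
    then show ?thesis
      using inv(2)[of k] by (simp add: nbhd_def)
  qed
  have N0: "?N k \<le> ?N 0" for k
    using decseqD[OF dec] by simp
  have fst_le: "fst (w k) \<le> ?N 0" for k
    using N0[of k] norm_fst_le[of "fst (w k)" "E (w k)"] by (simp add: Ehat_def)
  obtain c where c: "0 < c" "\<And>e u u'. a \<le> e \<Longrightarrow> c * norm (u - u') \<le> norm (E (e, u) - E (e, u'))"
    using E_coercive[OF a] by blast
  define B where "B = (?N 0 + norm (- b, C, 0 :: 'n sym_mat)) / c"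
  have snd_le: "norm (snd (w k)) \<le> B" for k
  proof -
    have "E (fst (w k), 0) = (- b, C, 0)"
      by (simp add: zero_prod_def E_apply opA_simps adjA_simps Phi_zero_right)
    then have "c * norm (snd (w k)) \<le> norm (E (w k) - (- b, C, 0))"
      using c(2)[OF fst_ge[of k], of "snd (w k)" 0] by simp
    also have "\<dots> \<le> norm (E (w k)) + norm (- b, C, 0 :: 'n sym_mat)"
      by (rule norm_triangle_ineq4)
    also have "norm (E (w k)) \<le> ?N 0"
      using N0[of k] norm_snd_le[of "E (w k)" "fst (w k)"] by (simp add: Ehat_def)
    finally show ?thesis
      using c(1) by (simp add: B_def field_simps)
  qed
  let ?K = "{a..?N 0} \<times> cball (0 :: ('n, 'm) primal_dual) B"
  have wK: "w k \<in> ?K" for k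
    using fst_ge[of k] fst_le[of k] snd_le[of k] by (cases "w k") auto
  have K': "a \<le> fst v" if "v \<in> ?K" for v
    using that by auto
  have K: "compact ?K"
    by (intro compact_Times compact_Icc compact_cball)
  obtain s where s: "0 < s" "\<And>w dw t. w \<in> ?K \<Longrightarrow> newton_direction w dw \<Longrightarrow> 0 < t \<Longrightarrow> t \<le> s \<Longrightarrow>
      psi (w + t *\<^sub>R dw) \<le> (1 - 2 * \<sigma> * (1 - \<delta>) * t) * psi w"
    using line_search_uniform[OF K K' a] by blast
  define s' where "s' = \<rho> * min s 1"
  have "s' \<le> \<rho> * 1"
    unfolding s'_def using rho by (intro mult_left_mono) auto
  then have "s' < 1"
    using rho by simp
  moreover have "0 < s'"
    using s(1) rho by (simp add: s'_def)
  ultimately have s': "0 < s'" "s' < 1"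
    by blast+
  define q where "q = 1 - 2 * \<sigma> * (1 - \<delta>) * s'"
  have prod: "0 < 2 * \<sigma> * (1 - \<delta>) * s'"
    using sigma delta s' by simp
  have "2 * \<sigma> * (1 - \<delta>) * s' \<le> 1 * 1 * 1"
    using sigma delta delta_pos s' by (intro mult_mono) auto
  then have q: "0 \<le> q" "q < 1"
    using prod by (auto simp: q_def)
  have contraction: "psi (w (Suc k)) \<le> q * psi (w k)" for k
  proof -
    obtain dw l where nd: "newton_direction (w k) dw" and ls: "line_search (w k) dw l"
      and least: "\<And>l'. l' < l \<Longrightarrow> \<not> line_search (w k) dw l'"
      and w': "w (Suc k) = w k + \<rho> ^ l *\<^sub>R dw"
      using step[of k] by (auto simp: ssn_step_def)
    have "s' \<le> \<rho> ^ l"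
    proof (cases l)
      case 0
      then show ?thesis using s' by simp
    next
      case (Suc l')
      then have "\<not> line_search (w k) dw l'" using least by simp
      then have "s < \<rho> ^ l'"
        using s(2)[OF wK nd, of "\<rho> ^ l'"] rho by (force simp: line_search_def)
      then show ?thesis
        using rho by (simp add: s'_def Suc)
    qed
    then have "2 * \<sigma> * (1 - \<delta>) * s' \<le> 2 * \<sigma> * (1 - \<delta>) * \<rho> ^ l"
      using sigma delta by (intro mult_left_mono) auto
    then have "(1 - 2 * \<sigma> * (1 - \<delta>) * \<rho> ^ l) * psi (w k) \<le> q * psi (w k)"
      by (intro mult_right_mono) (auto simp: q_def psi_def)
    then show ?thesis
      using ls by (simp add: line_search_def w')
  qed
  have geometric: "psi (w k) \<le> q ^ k * psi (w 0)" for k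
  proof (induction k)
    case (Suc k)
    have "psi (w (Suc k)) \<le> q * (q ^ k * psi (w 0))"
      by (rule order_trans[OF contraction mult_left_mono[OF Suc q(1)]])
    then show ?case by (simp add: mult_ac)
  qed simp
  have "(\<lambda>k. q ^ k * psi (w 0)) \<longlonglongrightarrow> 0 * psi (w 0)"
    using q by (intro tendsto_intros LIMSEQ_realpow_zero)
  then have "\<forall>\<^sub>F k in sequentially. q ^ k * psi (w 0) < m\<^sup>2"
    using m(1) by (intro order_tendstoD(2)) auto
  then obtain k where "q ^ k * psi (w 0) < m\<^sup>2"
    by (auto simp: eventually_sequentially)
  moreover have "m\<^sup>2 \<le> psi (w k)"
    unfolding psi_def using m by (intro power_mono) auto
  ultimately show False
    using geometric[of k] by simp
qed

theorem accumulation_point_solves: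
  assumes seq: "ssn_sequence u0 w" and acc: "accumulation_point w a"
  shows "Ehat a = 0"
proof -
  obtain s where s: "strict_mono s" "(w \<circ> s) \<longlonglongrightarrow> a"
    using acc by (auto simp: accumulation_point_def)
  have "isCont Ehat a"
    using continuous_on_Ehat unfolding continuous_on_eq_continuous_at[OF open_UNIV] by blast
  from tendsto_norm[OF isCont_tendsto_compose[OF this s(2)]]
  have "(\<lambda>k. norm (Ehat ((w \<circ> s) k))) \<longlonglongrightarrow> norm (Ehat a)" .
  moreover have "(\<lambda>k. norm (Ehat ((w \<circ> s) k))) \<longlonglongrightarrow> 0"
    using LIMSEQ_subseq_LIMSEQ[OF ssn_sequence_residual_tendsto_zero[OF seq] s(1)]
    by (simp add: o_def)
  ultimately have "norm (Ehat a) = 0"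
    by (rule LIMSEQ_unique)
  then show ?thesis by simp
qed

end

section \<open>Strict feasibility from a bounded set of KKT solutions\<close>

lemma pd_cone_identity: "symmetrize (mat 1) \<in> pd_cone"
  by (simp add: pd_cone_def mat_of_symmetrize flip: scaleR_2)

lemma pd_cone_add_psd: "X \<in> pd_cone \<Longrightarrow> Y \<in> psd_cone \<Longrightarrow> X + Y \<in> pd_cone"
  by (simp add: pd_cone_iff psd_cone_iff inner_add_left add_pos_nonneg)

lemma pd_cone_scaleR: "X \<in> pd_cone \<Longrightarrow> 0 < t \<Longrightarrow> t *\<^sub>R X \<in> pd_cone"
  by (simp add: pd_cone_iff)

lemma pd_imp_psd: "X \<in> pd_cone \<Longrightarrow> X \<in> psd_cone"
  unfolding pd_cone_def psd_cone_def by (auto, metis inner_zero_left less_imp_le order_refl)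

lemma psd_cone_add: "X \<in> psd_cone \<Longrightarrow> Y \<in> psd_cone \<Longrightarrow> X + Y \<in> psd_cone"
  by (simp add: psd_cone_iff inner_add_left)

lemma psd_cone_scaleR: "X \<in> psd_cone \<Longrightarrow> 0 \<le> t \<Longrightarrow> t *\<^sub>R X \<in> psd_cone"
  by (simp add: psd_cone_iff)

lemma outer_psd: "outer x \<in> psd_cone"
  by (simp add: psd_cone_iff inner_outer_outer)

lemma convex_pd_cone: "convex (pd_cone :: 'n::finite sym_mat set)"
proof (rule convexI)
  fix X Y :: "'n sym_mat" and u v :: real
  assume XY: "X \<in> pd_cone" "Y \<in> pd_cone" and uv: "0 \<le> u" "0 \<le> v" "u + v = 1"
  show "u *\<^sub>R X + v *\<^sub>R Y \<in> pd_cone"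
  proof (cases "u = 0")
    case True
    then show ?thesis using XY uv by simp
  next
    case False
    then show ?thesis
      using XY uv by (intro pd_cone_add_psd pd_cone_scaleR psd_cone_scaleR pd_imp_psd) auto
  qed
qed

text \<open>
  Scaling an element of the cone down shows the first claim, scaling it up shows that \<open>D\<close> is nonnegative
  on the cone; approximating \<open>x x\<^sup>T\<close> by positive definite matrices gives the second.
\<close>

lemma bounded_below_on_pd_cone:
  fixes D :: "'n::finite sym_mat"
  assumes below: "\<And>P. P \<in> pd_cone \<Longrightarrow> \<beta> \<le> D \<bullet> P"
  shows "\<beta> \<le> 0" "D \<in> psd_cone"
proof -
  let ?I = "symmetrize (mat 1) :: 'n sym_mat"
  have scaled: "\<beta> \<le> t * (D \<bullet> P)" if "P \<in> pd_cone" "0 < t" for P t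
    using below[OF pd_cone_scaleR[OF that]] by simp
  show \<beta>: "\<beta> \<le> 0"
  proof (rule field_le_epsilon)
    fix e :: real assume e: "0 < e"
    have "\<beta> \<le> e / (\<bar>D \<bullet> ?I\<bar> + 1) * (D \<bullet> ?I)"
      using e by (intro scaled pd_cone_identity) (simp add: divide_pos_pos)
    also have "\<dots> \<le> e / (\<bar>D \<bullet> ?I\<bar> + 1) * (\<bar>D \<bullet> ?I\<bar> + 1)"
      using e by (intro mult_left_mono) auto
    finally show "\<beta> \<le> 0 + e"
      by simp
  qed
  have pd: "0 \<le> D \<bullet> P" if P: "P \<in> pd_cone" for P
  proof (rule ccontr)
    assume "\<not> 0 \<le> D \<bullet> P"
    then have neg: "D \<bullet> P < 0" by simp
    then have "0 < (\<beta> - 1) / (D \<bullet> P)"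
      using \<beta> by (simp add: divide_neg_neg)
    from scaled[OF P this] show False
      using neg by simp
  qed
  show "D \<in> psd_cone"
    unfolding psd_cone_iff
  proof (intro allI, rule field_le_epsilon)
    fix x :: "real^'n" and e :: real assume e: "0 < e"
    let ?t = "e / (\<bar>D \<bullet> ?I\<bar> + 1)"
    have t: "0 < ?t" using e by (simp add: divide_pos_pos)
    have "0 \<le> D \<bullet> (?t *\<^sub>R ?I + outer x)"
      by (intro pd pd_cone_add_psd pd_cone_scaleR pd_cone_identity outer_psd t)
    also have "\<dots> = ?t * (D \<bullet> ?I) + D \<bullet> outer x"
      by (simp only: inner_add_right inner_scaleR_right)
    also have "?t * (D \<bullet> ?I) \<le> ?t * (\<bar>D \<bullet> ?I\<bar> + 1)"
      using t by (intro mult_left_mono) auto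
    also have "\<dots> = e"
      by simp
    finally show "0 \<le> D \<bullet> outer x + e"
      by simp
  qed
qed

lemma bounded_ray_imp_zero:
  fixes d :: "'a::real_normed_vector"
  assumes "\<And>t. 0 \<le> t \<Longrightarrow> norm (x + t *\<^sub>R d) \<le> B"
  shows "d = 0"
proof (rule ccontr)
  assume d: "d \<noteq> 0"
  have B: "0 \<le> B"
    using assms[of 0] norm_ge_zero[of x] by (simp only: scaleR_zero_left add_0_right) linarith
  define t where "t = (B + norm x + 1) / norm d"
  have "0 \<le> t"
    using B by (simp add: t_def)
  have "norm (t *\<^sub>R d) \<le> norm (x + t *\<^sub>R d) + norm x"
    using norm_triangle_ineq4[of "x + t *\<^sub>R d" x] by simp
  also have "\<dots> \<le> B + norm x"
    using assms[OF \<open>0 \<le> t\<close>] by simp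
  finally show False
    using \<open>0 \<le> t\<close> d by (simp add: t_def)
qed

context sdp
begin

lemma kkt_solution_norm_bound:
  assumes "bounded kkt_solutions"
  obtains B where "\<And>X y Z. (X, y, Z) \<in> kkt_solutions \<Longrightarrow> norm X \<le> B \<and> norm y \<le> B"
proof -
  obtain B where B: "\<And>u. u \<in> kkt_solutions \<Longrightarrow> norm u \<le> B"
    using assms unfolding bounded_iff by blast
  show ?thesis
  proof (rule that)
    fix X y Z assume "(X, y, Z) \<in> kkt_solutions"
    from B[OF this] show "norm X \<le> B \<and> norm y \<le> B"
      using norm_fst_le[of X "(y, Z)"] norm_snd_le[of "(y, Z)" X] norm_fst_le[of y Z] by simp
  qed
qed

text \<open>
  A vector in the kernel is a direction of recession of the set of KKT solutions.
\<close>

lemma adjA_injective: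
  assumes ne: "kkt_solutions \<noteq> {}" and bdd: "bounded kkt_solutions"
  shows "inj adjA"
proof (rule linear_injective_0[OF bounded_linear.linear[OF bounded_linear_adjA], THEN iffD2],
    intro allI impI)
  fix v assume v: "adjA v = 0"
  obtain X y Z where sol: "(X, y, Z) \<in> kkt_solutions"
    using ne by auto
  obtain B where B: "\<And>X y Z. (X, y, Z) \<in> kkt_solutions \<Longrightarrow> norm X \<le> B \<and> norm y \<le> B"
    using kkt_solution_norm_bound[OF bdd] by blast
  have "norm (y + t *\<^sub>R v) \<le> B" for t
  proof -
    have "(X, y + t *\<^sub>R v, Z) \<in> kkt_solutions"
      using sol by (simp add: kkt_solutions_def adjA_simps v)
    then show ?thesis using B by blast
  qed
  then show "v = 0"
    by (rule bounded_ray_imp_zero)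
qed

text \<open>
  Otherwise the affine space of dual slacks is separated from the cone by some \<open>D \<noteq> 0\<close>. Such a \<open>D\<close> is
  positive semidefinite with \<open>opA D = 0\<close> and \<open>C \<bullet> D \<le> 0\<close>, hence a direction of recession of the set of
  KKT solutions.
\<close>

lemma dual_strictly_feasible:
  assumes ne: "kkt_solutions \<noteq> {}" and bdd: "bounded kkt_solutions"
  shows "\<exists>y. C - adjA y \<in> pd_cone"
proof (rule ccontr)
  assume none: "\<nexists>y. C - adjA y \<in> pd_cone"
  let ?S = "range (\<lambda>y. C - adjA y)"
  have "convex ?S"
  proof -
    have "?S = (\<lambda>Y. C + Y) ` ((\<lambda>y. adjA (- y)) ` UNIV)"
      using adjA_simps(3)[of "-1"] by (simp add: image_image)
    moreover have "linear (\<lambda>y. adjA (- y))"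
      using adjA_simps(3)[of "-1"] bounded_linear.linear[OF bounded_linear_adjA]
      by (simp add: linear_compose_neg)
    ultimately show ?thesis
      by (metis convex_UNIV convex_linear_image convex_translation)
  qed
  moreover have "?S \<inter> pd_cone = {}"
    using none by auto
  moreover have "(pd_cone :: 'n sym_mat set) \<noteq> {}"
    using pd_cone_identity by blast
  ultimately obtain D \<beta> where D0: "D \<noteq> 0" and S: "\<And>y. D \<bullet> (C - adjA y) \<le> \<beta>"
    and P: "\<And>P. P \<in> pd_cone \<Longrightarrow> \<beta> \<le> D \<bullet> P"
    using separating_hyperplane_sets[of ?S "pd_cone"] convex_pd_cone by blast
  have \<beta>: "\<beta> \<le> 0" and D: "D \<in> psd_cone"
    using bounded_below_on_pd_cone[of \<beta> D] P by auto
  have ray: "D \<bullet> C - opA D \<bullet> y \<le> 0" for y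
    using S[of y] \<beta> by (simp add: inner_opA inner_diff_right)
  have AD: "opA D = 0"
  proof (rule ccontr)
    assume nz: "opA D \<noteq> 0"
    then have pos: "0 < opA D \<bullet> opA D" by simp
    define s where "s = (\<bar>D \<bullet> C\<bar> + 1) / (opA D \<bullet> opA D)"
    have "D \<bullet> C + s * (opA D \<bullet> opA D) \<le> 0"
      using ray[of "- s *\<^sub>R opA D"] by simp
    then show False
      using pos by (simp add: s_def)
  qed
  have CD: "D \<bullet> C \<le> 0"
    using ray[of 0] by simp
  obtain X y Z where sol: "(X, y, Z) \<in> kkt_solutions"
    using ne by auto
  have DZ: "D \<bullet> Z = 0"
  proof -
    have "Z = C - adjA y"
      using sol by (auto simp: kkt_solutions_def algebra_simps)
    then have "D \<bullet> Z = D \<bullet> C"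
      using AD by (simp add: inner_diff_right flip: inner_opA)
    moreover have "0 \<le> D \<bullet> Z"
      using sol D by (intro psd_inner_nonneg) (auto simp: kkt_solutions_def)
    ultimately show ?thesis using CD by simp
  qed
  obtain B where B: "\<And>X y Z. (X, y, Z) \<in> kkt_solutions \<Longrightarrow> norm X \<le> B \<and> norm y \<le> B"
    using kkt_solution_norm_bound[OF bdd] by blast
  have "norm (X + t *\<^sub>R D) \<le> B" if t: "0 \<le> t" for t
  proof -
    have "(X + t *\<^sub>R D, y, Z) \<in> kkt_solutions"
      using sol D t
      by (auto simp: kkt_solutions_def opA_simps AD DZ inner_add_left intro: psd_cone_add psd_cone_scaleR)
    then show ?thesis using B by blast
  qed
  then have "D = 0"
    by (rule bounded_ray_imp_zero)
  then show False using D0 by simp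
qed

end

section \<open>Bounded level sets of the residual\<close>

context regularized_sdp
begin

text \<open>
  Pairing with strictly feasible points measures size: \<open>X \<bullet> Z\<^sub>0 + X\<^sub>0 \<bullet> Z\<close> dominates \<open>\<parallel>X\<parallel> + \<parallel>Z\<parallel>\<close> up to
  constants. The linear equations express the same sum as \<open>X \<bullet> Z\<close> plus constants, plus terms of the
  order of the residual times the size of the point. The product \<open>X \<bullet> Z\<close> is small as well, because the
  positive and negative parts \<open>V\<close>, \<open>S\<close> of \<open>X - Z\<close> are orthogonal and agree with \<open>X\<close> and \<open>Z\<close> up to the
  residual and regularization terms that enter with a favourable sign. When the residual is small,
  the linear terms are absorbed.
\<close>

theorem residual_level_set_bounded:
  assumes X0: "X0 \<in> pd_cone" "opA X0 = b"
    and y0: "C - adjA y0 \<in> pd_cone"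
    and inj: "inj adjA"
  obtains q0 B where "0 < q0" "\<And>w. 0 \<le> fst w \<Longrightarrow> norm (Ehat w) \<le> q0 \<Longrightarrow> norm w \<le> B"
proof -
  define Z0 where "Z0 = C - adjA y0"
  obtain l where l: "0 < l" "\<And>S. S \<in> psd_cone \<Longrightarrow> l * norm S \<le> X0 \<bullet> S"
    using pd_inner_coercive[OF X0(1)] by blast
  obtain m where m: "0 < m" "\<And>S. S \<in> psd_cone \<Longrightarrow> m * norm S \<le> Z0 \<bullet> S"
    using pd_inner_coercive[OF y0] unfolding Z0_def by blast
  obtain g where g: "0 < g" "\<And>y. g * norm y \<le> norm (adjA y)"
    using linear_inj_bounded_below_pos[OF bounded_linear.linear[OF bounded_linear_adjA] inj] by metis
  define K where "K = 1 + real CARD('n)"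
  have K: "1 \<le> K" by (simp add: K_def)
  \<comment> \<open>With \<open>q\<close> the residual norm, \<open>c1\<close> collects the coefficients of the terms \<open>q \<parallel>X\<parallel>\<close> and \<open>q \<parallel>Z\<parallel>\<close>, and
    \<open>c0\<close> collects everything that stays bounded for \<open>q \<le> 1\<close>.\<close>
  define c1 where "c1 = 3 * K + 1 + 1 / g + (l + norm X0) * kappa_c"
  define c0 where "c0 = K\<^sup>2 + \<bar>X0 \<bullet> Z0\<bar> + norm y0 + kappa_p * (norm y0)\<^sup>2 + norm X0
      + K * (m + norm Z0) + (l + norm X0) * K + (norm C + 1) / g"
  have c1: "0 < c1"
    using K g l kappa_c_pos unfolding c1_def
    by (intro add_pos_nonneg) auto
  define lm where "lm = min l m"
  have lm: "0 < lm" using l m by (simp add: lm_def)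
  define q0 where "q0 = min 1 (lm / (2 * c1))"
  define B0 where "B0 = 2 * c0 / lm"
  have bound: "norm w \<le> 1 + B0 + (norm C + B0 + 1) / g"
    if w0: "0 \<le> fst w" and wq: "norm (Ehat w) \<le> q0" for w
  proof -
    obtain e X y Z where w: "w = (e, X, y, Z)" by (cases w)
    define q where "q = norm (Ehat w)"
    define R1 R2 R3 where "R1 = fst (E w)" and "R2 = fst (snd (E w))" and "R3 = snd (snd (E w))"
    have E: "E w = (R1, R2, R3)" by (simp add: R1_def R2_def R3_def)
    have e0: "0 \<le> e" using w0 by (simp add: w)
    have Rq: "e \<le> q" "norm R1 \<le> q" "norm R2 \<le> q" "norm R3 \<le> q"
      using norm_fst_le[of "fst w" "E w"] norm_snd_le[of "E w" "fst w"]
        norm_fst_le[of R1 "(R2, R3)"] norm_snd_le[of "(R2, R3)" R1]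
        norm_fst_le[of R2 R3] norm_snd_le[of R3 R2] e0
      unfolding q_def Ehat_def E by (auto simp: w)
    have q: "0 \<le> q" "q \<le> 1" "q * c1 \<le> lm / 2"
    proof -
      show "0 \<le> q" by (simp add: q_def)
      have "q \<le> q0" using wq by (simp add: q_def)
      then show "q \<le> 1" by (simp add: q0_def)
      have "q * c1 \<le> lm / (2 * c1) * c1"
        using \<open>q \<le> q0\<close> c1 by (intro mult_right_mono) (auto simp: q0_def)
      then show "q * c1 \<le> lm / 2" using c1 by simp
    qed
    define k p where "k = kappa_c * e" and "p = kappa_p * e"
    have k: "0 \<le> k" "k \<le> kappa_c * q" and p: "0 \<le> p" "p \<le> kappa_p"
      using e0 Rq(1) q(2) kappa_c_pos kappa_p_pos by (auto simp: k_def p_def mult_left_le)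
    define U where "U = X - Z"
    define V where "V = Phi 0 U"
    define S where "S = V - U"
    \<comment> \<open>Replacing the smoothing by the projection \<open>Phi 0\<close> costs a multiple of \<open>e\<close>, and \<open>e\<close> is itself a
      component of \<open>Ehat\<close>.\<close>
    define R where "R = R3 + (Phi e U - V)"
    define T where "T = K * q"
    have T: "0 \<le> T" "T \<le> K"
      using K q by (auto simp: T_def mult_left_le)
    have R: "norm R \<le> T"
    proof -
      have "norm (Phi e U - V) \<le> CARD('n) * e"
        using Phi_lipschitz[of e U 0 U] e0 by (simp add: V_def)
      also have "\<dots> \<le> CARD('n) * q"
        using Rq(1) by (intro mult_left_mono) auto
      finally show ?thesis
        using norm_triangle_ineq[of R3 "Phi e U - V"] Rq(4) by (simp add: R_def T_def K_def algebra_simps)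
    qed
    have residuals: "R1 = opA X + p *\<^sub>R y - b" "R2 = - adjA y - Z + C" "R3 = (1 + k) *\<^sub>R X - Phi e U"
      using e0 by (simp_all add: R1_def R2_def R3_def w E_apply k_def p_def U_def)
    have V_eq: "V = (1 + k) *\<^sub>R X - R"
      by (simp add: R_def residuals)
    have S_eq: "S = k *\<^sub>R X + Z - R"
      unfolding S_def U_def by (simp add: V_eq algebra_simps)
    have "huber 0 t = max 0 t" for t by (simp add: huber_eq)
    then have V_spec: "V = spectral_fun (max 0) U"
      by (simp add: V_def Phi_eq_spectral_fun ext[of "huber 0" "max 0"])
    have S_spec: "S = spectral_fun (\<lambda>t. max 0 t - t) U"
      by (simp add: S_def V_spec spectral_fun_diff spectral_fun_ident)
    have V: "V \<in> psd_cone" and S: "S \<in> psd_cone" and VS: "V \<bullet> S = 0"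
      unfolding V_spec S_spec
      by (auto intro!: spectral_fun_psd spectral_fun_orthogonal simp: max_def)
    define x z v where "x = norm X" and "z = norm Z" and "v = norm y"
    have nonneg: "0 \<le> x" "0 \<le> z" "0 \<le> v" by (auto simp: x_def z_def v_def)
    have normV: "norm V \<le> (1 + k) * x + T" "(1 + k) * x \<le> norm V + T"
    proof -
      show "norm V \<le> (1 + k) * x + T"
        using norm_triangle_ineq4[of "(1 + k) *\<^sub>R X" R] R k by (simp add: V_eq x_def)
      have "norm ((1 + k) *\<^sub>R X) \<le> norm V + norm R"
        using norm_triangle_ineq[of V R] by (simp add: V_eq)
      then show "(1 + k) * x \<le> norm V + T"
        using R k by (simp add: x_def)
    qed
    have XZ0: "m * x - K * (m + norm Z0) \<le> X \<bullet> Z0"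
    proof -
      have "(1 + k) * (X \<bullet> Z0) = Z0 \<bullet> V + R \<bullet> Z0"
        unfolding V_eq by (simp add: inner_diff_right inner_commute)
      moreover have "m * ((1 + k) * x - T) \<le> Z0 \<bullet> V"
        by (rule order_trans[OF mult_left_mono m(2)[OF V]]) (use normV(2) m(1) in auto)
      moreover have "- (T * norm Z0) \<le> R \<bullet> Z0"
      proof -
        have "\<bar>R \<bullet> Z0\<bar> \<le> T * norm Z0"
          by (rule order_trans[OF Cauchy_Schwarz_ineq2 mult_right_mono[OF R]]) simp
        then show ?thesis by simp
      qed
      ultimately have "m * ((1 + k) * x - T) - T * norm Z0 \<le> (1 + k) * (X \<bullet> Z0)"
        by linarith
      moreover have "T * (m + norm Z0) \<le> (1 + k) * (K * (m + norm Z0))"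
      proof -
        have "T * (m + norm Z0) \<le> K * (m + norm Z0)"
          using T m(1) by (intro mult_right_mono) auto
        also have "\<dots> \<le> (1 + k) * (K * (m + norm Z0))"
        proof -
          have "0 \<le> k * (K * (m + norm Z0))"
            using k K m(1) by simp
          then show ?thesis by (simp add: algebra_simps)
        qed
        finally show ?thesis .
      qed
      ultimately have "(1 + k) * (m * x - K * (m + norm Z0)) \<le> (1 + k) * (X \<bullet> Z0)"
        by (simp add: algebra_simps)
      then show ?thesis using k by simp
    qed
    have X0Z: "l * z - (l + norm X0) * (k * x + T) \<le> X0 \<bullet> Z"
    proof -
      have "Z = S - k *\<^sub>R X + R"
        by (simp add: S_eq)
      then have "X0 \<bullet> Z = X0 \<bullet> S - k * (X0 \<bullet> X) + X0 \<bullet> R"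
        by (simp only: inner_simps)
      moreover have "l * (z - (k * x + T)) \<le> X0 \<bullet> S"
      proof (rule order_trans[OF mult_left_mono l(2)[OF S]])
        have "norm Z \<le> norm (S - k *\<^sub>R X) + norm R"
          using norm_triangle_ineq[of "S - k *\<^sub>R X" R] by (simp add: S_eq)
        also have "norm (S - k *\<^sub>R X) \<le> norm S + k * x"
          using norm_triangle_ineq4[of S "k *\<^sub>R X"] k by (simp add: x_def)
        finally show "z - (k * x + T) \<le> norm S"
          using R by (simp add: z_def)
      qed (use l(1) in simp)
      moreover have "k * (X0 \<bullet> X) \<le> k * (norm X0 * x)"
        using k norm_cauchy_schwarz[of X0 X] by (intro mult_left_mono) (auto simp: x_def)
      moreover have "- (norm X0 * T) \<le> X0 \<bullet> R"
      proof -
        have "\<bar>X0 \<bullet> R\<bar> \<le> norm X0 * T"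
          by (rule order_trans[OF Cauchy_Schwarz_ineq2 mult_left_mono[OF R]]) simp
        then show ?thesis by simp
      qed
      ultimately have "l * (z - (k * x + T)) - k * (norm X0 * x) - norm X0 * T \<le> X0 \<bullet> Z"
        by linarith
      then show ?thesis by (simp add: algebra_simps)
    qed
    have XZ: "X \<bullet> Z \<le> 2 * T * x + T\<^sup>2 + T * z"
    proof -
      have "(1 + k) * (X \<bullet> Z) = (V + R) \<bullet> Z"
        by (simp add: V_eq)
      also have "\<dots> = V \<bullet> (S - k *\<^sub>R X + R) + R \<bullet> Z"
        by (simp add: S_eq inner_add_left)
      also have "\<dots> = V \<bullet> R + R \<bullet> Z - k * (V \<bullet> X)"
        by (simp add: inner_add_right inner_diff_right VS)
      also have "V \<bullet> X = (1 + k) * (X \<bullet> X) - R \<bullet> X"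
        unfolding V_eq by (simp add: inner_diff_left)
      finally have "(1 + k) * (X \<bullet> Z) = V \<bullet> R + R \<bullet> Z - k * ((1 + k) * (X \<bullet> X)) + k * (R \<bullet> X)"
        by (simp add: algebra_simps)
      moreover have "0 \<le> k * ((1 + k) * (X \<bullet> X))"
        using k by simp
      moreover have "V \<bullet> R \<le> ((1 + k) * x + T) * T"
        by (rule order_trans[OF norm_cauchy_schwarz mult_mono[OF normV(1) R]])
          (use k nonneg T in auto)
      moreover have "R \<bullet> Z \<le> T * z"
        unfolding z_def by (rule order_trans[OF norm_cauchy_schwarz mult_right_mono[OF R]]) simp
      moreover have "k * (R \<bullet> X) \<le> k * (T * x)"
        unfolding x_def using k
        by (intro mult_left_mono order_trans[OF norm_cauchy_schwarz mult_right_mono[OF R]]) auto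
      ultimately have "(1 + k) * (X \<bullet> Z) \<le> ((1 + k) * x + T) * T + T * z + k * (T * x)"
        by linarith
      also have "\<dots> \<le> (1 + k) * (2 * T * x + T\<^sup>2 + T * z)"
        using k T nonneg by (simp add: algebra_simps power2_eq_square)
      finally show ?thesis using k by simp
    qed
    have cross: "X \<bullet> Z0 + X0 \<bullet> Z \<le> X \<bullet> Z + \<bar>X0 \<bullet> Z0\<bar> + q * (v + norm y0)
        + kappa_p * (norm y0)\<^sup>2 + q * (x + norm X0)"
    proof -
      have AX: "opA (X - X0) = R1 - p *\<^sub>R y"
        by (simp add: opA_simps residuals X0(2))
      have ZZ: "Z - Z0 = - adjA (y - y0) - R2"
        by (simp add: residuals Z0_def adjA_simps)
      have "(X - X0) \<bullet> (Z - Z0) = - ((X - X0) \<bullet> adjA (y - y0)) - (X - X0) \<bullet> R2"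
        unfolding ZZ by (simp only: inner_simps inner_minus_right)
      also have "(X - X0) \<bullet> adjA (y - y0) = R1 \<bullet> (y - y0) - p * (y \<bullet> (y - y0))"
        unfolding inner_opA [symmetric] AX by (simp only: inner_diff_left inner_scaleR_left)
      finally have eq: "X \<bullet> Z0 + X0 \<bullet> Z = X \<bullet> Z + X0 \<bullet> Z0 + R1 \<bullet> (y - y0)
          + p * (y \<bullet> y0 - y \<bullet> y) + (X - X0) \<bullet> R2"
        by (simp add: inner_diff_left inner_diff_right algebra_simps)
      have "R1 \<bullet> (y - y0) \<le> q * (v + norm y0)"
        unfolding v_def
        by (rule order_trans[OF norm_cauchy_schwarz mult_mono[OF Rq(2) norm_triangle_ineq4]])
          (use q in auto)
      moreover have "(X - X0) \<bullet> R2 \<le> (x + norm X0) * q"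
        unfolding x_def
        by (rule order_trans[OF norm_cauchy_schwarz mult_mono[OF norm_triangle_ineq4 Rq(3)]]) auto
      moreover have "p * (y \<bullet> y0 - y \<bullet> y) \<le> kappa_p * (norm y0)\<^sup>2"
      proof -
        have "y \<bullet> y0 \<le> v * norm y0"
          unfolding v_def by (rule norm_cauchy_schwarz)
        moreover have "2 * (v * norm y0) \<le> v\<^sup>2 + (norm y0)\<^sup>2"
          using sum_squares_bound[of v "norm y0"] by (simp add: mult.assoc)
        moreover have "y \<bullet> y = v\<^sup>2"
          by (simp add: v_def power2_norm_eq_inner)
        ultimately have "y \<bullet> y0 - y \<bullet> y \<le> (norm y0)\<^sup>2"
          using zero_le_power2[of v] zero_le_power2[of "norm y0"] by linarith
        then have "p * (y \<bullet> y0 - y \<bullet> y) \<le> p * (norm y0)\<^sup>2"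
          using p by (intro mult_left_mono)
        also have "\<dots> \<le> kappa_p * (norm y0)\<^sup>2"
          using p by (intro mult_right_mono) auto
        finally show ?thesis .
      qed
      ultimately show ?thesis
        unfolding eq by (simp add: mult.commute)
    qed
    have yv: "v \<le> (norm C + 1) / g + z / g"
    proof -
      have "adjA y = C - Z - R2" by (simp add: residuals)
      then have "norm (adjA y) \<le> norm C + norm Z + norm R2"
        using norm_triangle_ineq4[of "C - Z" R2] norm_triangle_ineq4[of C Z] by simp
      then have "g * v \<le> norm C + 1 + z"
        using g(2)[of y] Rq(3) q(2) by (simp add: v_def z_def)
      then show ?thesis
        using g(1) by (simp add: field_simps)
    qed
    have "m * x + l * z \<le> c0 + q * c1 * (x + z)"
    proof -
      have T2: "T\<^sup>2 \<le> K\<^sup>2"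
        using T by (intro power_mono)
      have "(l + norm X0) * (k * x + T) \<le> (l + norm X0) * (kappa_c * q * x + K)"
        using l(1) k T nonneg by (intro mult_left_mono add_mono mult_right_mono) auto
      then have lx: "(l + norm X0) * (k * x + T) \<le> q * ((l + norm X0) * kappa_c) * x + (l + norm X0) * K"
        by (simp add: algebra_simps)
      have qv: "q * v \<le> (norm C + 1) / g + q * (1 / g) * z"
      proof -
        have "q * v \<le> q * ((norm C + 1) / g) + q * (z / g)"
          using mult_left_mono[OF yv q(1)] by (simp add: distrib_left)
        also have "q * ((norm C + 1) / g) \<le> 1 * ((norm C + 1) / g)"
          using q g(1) by (intro mult_right_mono) auto
        finally show ?thesis by simp
      qed
      have qy: "q * norm y0 \<le> norm y0" "q * norm X0 \<le> norm X0"
        using q by (auto simp: mult_left_le_one_le)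
      have "m * x + l * z \<le> K * (m + norm Z0) + X \<bullet> Z0 + X0 \<bullet> Z + (l + norm X0) * (k * x + T)"
        using XZ0 X0Z by linarith
      also have "\<dots> \<le> c0 + (2 * T * x + T * z + q * x + q * (1 / g) * z + q * ((l + norm X0) * kappa_c) * x)"
        using cross XZ T2 lx qv qy unfolding c0_def distrib_left by linarith
      also have "2 * T * x + T * z + q * x + q * (1 / g) * z + q * ((l + norm X0) * kappa_c) * x
          \<le> q * c1 * (x + z)"
      proof -
        have "q * c1 * (x + z) - (2 * T * x + T * z + q * x + q * (1 / g) * z + q * ((l + norm X0) * kappa_c) * x)
          = q * (K * x + 1 / g * x + 2 * K * z + z + (l + norm X0) * kappa_c * z)"
          by (simp add: c1_def T_def algebra_simps add_divide_distrib)
        moreover have "0 \<le> \<dots>"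
          using q K g(1) l(1) kappa_c_pos nonneg by simp
        ultimately show ?thesis by linarith
      qed
      finally show ?thesis by simp
    qed
    moreover have "lm * (x + z) \<le> m * x + l * z"
    proof -
      have "lm * x \<le> m * x" "lm * z \<le> l * z"
        using nonneg by (auto intro!: mult_right_mono simp: lm_def)
      then show ?thesis by (simp add: distrib_left)
    qed
    moreover have "q * c1 * (x + z) \<le> lm / 2 * (x + z)"
      using q(3) nonneg by (intro mult_right_mono) auto
    ultimately have "lm / 2 * (x + z) \<le> c0"
      by (simp add: field_simps)
    then have xz: "x + z \<le> B0"
      using lm by (simp add: B0_def field_simps)
    have "norm w \<le> \<bar>e\<bar> + (x + (v + z))"
      unfolding w x_def v_def z_def
      by (rule order_trans[OF norm_Pair_le]) (simp add: order_trans[OF norm_Pair_le] norm_Pair_le)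
    also have "v \<le> (norm C + B0 + 1) / g"
    proof -
      have "(norm C + 1) / g + z / g \<le> (norm C + B0 + 1) / g"
        using xz nonneg g(1) by (simp add: add_divide_distrib[symmetric] divide_right_mono)
      then show ?thesis using yv by linarith
    qed
    finally show ?thesis
      using e0 Rq(1) q(2) xz by simp
  qed
  have "0 < q0"
    using lm c1 by (simp add: q0_def)
  from that[OF this bound] show ?thesis by blast
qed

end

section \<open>Global convergence\<close>

context regularized_ssn
begin

text \<open>
  As the residuals tend to 0, the run eventually stays in a bounded level set.
\<close>

theorem accumulation_point_exists:
  assumes X0: "X0 \<in> pd_cone" "opA X0 = b"
    and kkt: "kkt_solutions \<noteq> {}" "bounded kkt_solutions"
    and seq: "ssn_sequence u0 w"
  shows "\<exists>a. accumulation_point w a"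
proof -
  obtain y0 where y0: "C - adjA y0 \<in> pd_cone"
    using dual_strictly_feasible[OF kkt] by blast
  obtain q0 B where q0: "0 < q0"
    and B: "\<And>w. 0 \<le> fst w \<Longrightarrow> norm (Ehat w) \<le> q0 \<Longrightarrow> norm w \<le> B"
    using residual_level_set_bounded[OF X0 y0 adjA_injective[OF kkt]] by metis
  have "\<forall>\<^sub>F k in sequentially. norm (Ehat (w k)) < q0"
    using order_tendstoD(2)[OF ssn_sequence_residual_tendsto_zero[OF seq] q0] .
  then obtain N where N: "\<And>k. N \<le> k \<Longrightarrow> norm (Ehat (w k)) < q0"
    by (auto simp: eventually_sequentially)
  have "norm (w (k + N)) \<le> B" for k
    using ssn_iterate_invariant[OF ssn_sequence_iterate[OF seq], of "k + N"] N[of "k + N"]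
    by (intro B) auto
  then have "bounded (range (\<lambda>k. w (k + N)))"
    unfolding bounded_iff by blast
  then obtain a s where s: "strict_mono s" "((\<lambda>k. w (k + N)) \<circ> s) \<longlonglongrightarrow> a"
    using bounded_imp_convergent_subsequence by blast
  have "strict_mono (\<lambda>k. s k + N)"
    using s(1) by (simp add: strict_mono_def)
  moreover have "(w \<circ> (\<lambda>k. s k + N)) \<longlonglongrightarrow> a"
    using s(2) by (simp add: o_def)
  ultimately show ?thesis
    unfolding accumulation_point_def by blast
qed

end

theorem theorem2:
  fixes A :: "'m::finite \<Rightarrow> 'n::finite sym_mat"
    and b :: "real^'m"
    and C :: "'n sym_mat"
    and kappa_p kappa_c eps_hat r r_hat eta_hat \<rho> \<sigma> \<tau> :: real
  assumes primal_solvable: "sdp.primal_optimal A b C \<noteq> {}"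
    and slater: "\<exists>X. X \<in> pd_cone \<and> sdp.opA A X = b"
    and "kappa_p > 0" and "kappa_c > 0"
    and "eps_hat > 0" and "0 < r" and "r < 1" and "r_hat > 0"
    and "0 < eta_hat" and "eta_hat < 1"
    and "ssn.\<delta> eps_hat r eta_hat < 1"
    and "0 < \<rho>" and "\<rho> < 1" and "0 < \<sigma>" and "\<sigma> < 1/2" and "0 < \<tau>" and "\<tau> \<le> 1"
  shows
    "ssn.well_defined A b C kappa_p kappa_c eps_hat r r_hat eta_hat \<rho> \<sigma> \<tau>
     \<and> (\<forall>w. ssn.ssn_iterate A b C kappa_p kappa_c eps_hat r r_hat eta_hat \<rho> \<sigma> \<tau> w \<longrightarrow>
           smoothed_sdp.Ehat A b C kappa_p kappa_c w \<noteq> 0)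
     \<and> (\<forall>u0. \<exists>w. ssn.ssn_sequence A b C kappa_p kappa_c eps_hat r r_hat eta_hat \<rho> \<sigma> \<tau> u0 w)
     \<and> (\<forall>u0 w. ssn.ssn_sequence A b C kappa_p kappa_c eps_hat r r_hat eta_hat \<rho> \<sigma> \<tau> u0 w \<longrightarrow>
           range w \<subseteq> ssn.nbhd A b C kappa_p kappa_c eps_hat r \<tau>
           \<and> (\<forall>a. accumulation_point w a \<longrightarrow> smoothed_sdp.Ehat A b C kappa_p kappa_c a = 0)
           \<and> (sdp.kkt_solutions A b C \<noteq> {} \<and> bounded (sdp.kkt_solutions A b C) \<longrightarrow>
                (\<exists>a. accumulation_point w a)))"
proof -
  interpret regularized_ssn A b C kappa_p kappa_c eps_hat r r_hat eta_hat \<rho> \<sigma> \<tau>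
    using assms by unfold_locales
  obtain X0 where X0: "X0 \<in> pd_cone" "opA X0 = b"
    using slater by blast
  show ?thesis
  proof (intro conjI allI impI)
    show "well_defined" by (rule ssn_well_defined)
    show "Ehat w \<noteq> 0" if "ssn_iterate w" for w
      using that by (rule Ehat_iterate_nonzero)
    show "\<exists>w. ssn_sequence u0 w" for u0
      by (rule ssn_sequence_exists)
    fix u0 w assume seq: "ssn_sequence u0 w"
    show "range w \<subseteq> nbhd"
      using ssn_iterate_invariant[OF ssn_sequence_iterate[OF seq]] by blast
    show "Ehat a = 0" if "accumulation_point w a" for a
      using accumulation_point_solves[OF seq that] .
    show "\<exists>a. accumulation_point w a" if "kkt_solutions \<noteq> {} \<and> bounded kkt_solutions"
      using accumulation_point_exists[OF X0 _ _ seq] that by blast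
  qed
qed

end
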